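(* Let $\Omega\subset\mathbf{R}^n$ be a non-empty bounded open set regular enough that there is a (unique) bounded linear trace map $T$ defined on $W_2^1(\Omega)$, which maps $W_2^1(\Omega)$ onto the border Sobolev space $W_2^{1/2}(\mathrm{bdr}\,\Omega)$ and has null-space $\mathring{W}_2^1(\Omega)$. Fix $f\in\mathcal{L}_2(\Omega)$. Then for each $g_0\in W_2^{1/2}(\mathrm{bdr}\,\Omega)$ there is a unique $u\in W_2^1(\Omega)$ with $Tu=g_0$ that minimizes $$w\mapsto\frac12\|w\|_\nabla^2-(f|w)_2$$ over all $w\in W_2^1(\Omega)$ with $Tw=g_0$; it is given by $u=\hat S\big(f,E(g_0)\big)$. The solution map $$W_2^{1/2}(\mathrm{bdr}\,\Omega)\ni g_0\mapsto\hat S\big(f,E(g_0)\big)\in W_2^1(\Omega)$$ is affine (linear plus constant) and continuous, and it is linear if $f=0$.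
   Context: All functions are real-valued. $\mathcal{L}_2(\Omega)$ is the Lebesgue space of square-integrable functions on $\Omega$ (modulo null sets), with scalar product $(u|v)_2=\int_\Omega uv$. $W_2^1(\Omega)$ is the Sobolev space of functions in $\mathcal{L}_2(\Omega)$ whose first-order weak partial derivatives are in $\mathcal{L}_2(\Omega)$. For $u,v\in W_2^1(\Omega)$ put $(u|v)_\nabla=\int_\Omega\sum_{i=1}^n\partial_iu\,\partial_iv$ and $\|u\|_\nabla^2=(u|u)_\nabla$; the scalar product of $W_2^1(\Omega)$ is $(\cdot|\cdot)_{1,2}=(\cdot|\cdot)_2+(\cdot|\cdot)_\nabla$, with norm $\|\cdot\|_{1,2}$. $\mathring{W}_2^1(\Omega)$ is, as usual, the closed subspace of $W_2^1(\Omega)$ of functions vanishing on the border, i.e. the closure of $C_c^\infty(\Omega)$ in $W_2^1(\Omega)$. $\mathrm{bdr}\,\Omega$ is the topological boundary of $\Omega$, and $W_2^{1/2}(\mathrm{bdr}\,\Omega)$ is the usual (complete) Sobolev space of order $1/2$ of functions on it. The trace map $T$ is the usual restriction-to-border map: if $u\in W_2^1(\Omega)$ extends continuously to $\bar u$ on $\bar\Omega$, then $Tu=\bar u|_{\mathrm{bdr}\,\Omega}$. The quotient trace map $\hat T: W_2^1(\Omega)/\mathring{W}_2^1(\Omega)\to W_2^{1/2}(\mathrm{bdr}\,\Omega)$, $\hat T(g+\mathring{W}_2^1(\Omega))=Tg$, is an isomorphism of normed spaces (linear homeomorphism), where the quotient has the quotient norm. $E=\hat T^{-1}$ denotes its inverse,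 so $E(g_0)$ is the class of all $g\in W_2^1(\Omega)$ with $Tg=g_0$. Quotient solution map: for $f\in\mathcal{L}_2(\Omega)$ and $g\in W_2^1(\Omega)$, let $S(f,g)$ be the unique $u\in W_2^1(\Omega)$ with $u-g\in\mathring{W}_2^1(\Omega)$ minimizing $w\mapsto\frac12\|w\|_\nabla^2-(f|w)_2$ over all $w\in W_2^1(\Omega)$ with $w-g\in\mathring{W}_2^1(\Omega)$. $S(f,g)$ depends on $g$ only through its class $g+\mathring{W}_2^1(\Omega)$, and $\hat S:\mathcal{L}_2(\Omega)\times W_2^1(\Omega)/\mathring{W}_2^1(\Omega)\to W_2^1(\Omega)$ is defined by $\hat S(f,g+\mathring{W}_2^1(\Omega))=S(f,g)$. *)

theory Defs
  imports "HOL-Analysis.Analysis"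
begin

section \<open>Functions modulo null sets\<close>

definition ae_rel :: "'a::topological_space measure \<Rightarrow> ('a \<Rightarrow> real) \<Rightarrow> ('a \<Rightarrow> real) \<Rightarrow> bool" where
  "ae_rel M f g \<longleftrightarrow> f \<in> borel_measurable borel \<and> g \<in> borel_measurable borel \<and> (AE x in M. f x = g x)"

lemma part_equivp_ae_rel: "part_equivp (ae_rel M)"
proof (rule part_equivpI)
  show "\<exists>f. ae_rel M f f"
    by (rule exI[of _ "\<lambda>_. 0"]) (simp add: ae_rel_def)
  show "symp (ae_rel M)"
    by (rule sympI) (auto simp: ae_rel_def elim: eventually_mono)
  show "transp (ae_rel M)"
    by (rule transpI) (auto simp: ae_rel_def elim: eventually_elim2)
qed

lemma ae_rel_0: "ae_rel M (\<lambda>_. 0) (\<lambda>_. 0)"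
  by (simp add: ae_rel_def)

lemma ae_rel_plus:
  "ae_rel M f f' \<Longrightarrow> ae_rel M g g' \<Longrightarrow> ae_rel M (\<lambda>x. f x + g x) (\<lambda>x. f' x + g' x)"
  by (auto simp: ae_rel_def elim: eventually_elim2)

lemma ae_rel_minus:
  "ae_rel M f f' \<Longrightarrow> ae_rel M g g' \<Longrightarrow> ae_rel M (\<lambda>x. f x - g x) (\<lambda>x. f' x - g' x)"
  by (auto simp: ae_rel_def elim: eventually_elim2)

lemma ae_rel_uminus: "ae_rel M f f' \<Longrightarrow> ae_rel M (\<lambda>x. - f x) (\<lambda>x. - f' x)"
  by (auto simp: ae_rel_def elim: eventually_mono)

lemma ae_rel_scale: "ae_rel M f f' \<Longrightarrow> ae_rel M (\<lambda>x. c * f x) (\<lambda>x. c * f' x)"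
  by (auto simp: ae_rel_def elim: eventually_mono)

text \<open>Functions on \<open>\<real>\<^sup>n\<close> modulo Lebesgue null sets. A function on an open set \<open>\<Omega>\<close> modulo null sets
  is represented by its extension by \<open>0\<close>, so that the spaces over the various \<open>\<Omega>\<close> become
  linear subspaces of this one type. Every Lebesgue measurable function agrees almost everywhere
  with a Borel measurable one, so Borel representatives suffice.\<close>

quotient_type 'n lebfun = "real^'n::finite \<Rightarrow> real" / partial: "ae_rel lborel"
  by (rule part_equivp_ae_rel)

instantiation lebfun :: (finite) real_vector
begin

lift_definition zero_lebfun :: "'a lebfun" is "\<lambda>_. 0"
  by (rule ae_rel_0)
lift_definition plus_lebfun :: "'a lebfun \<Rightarrow> 'a lebfun \<Rightarrow> 'a lebfun" is "\<lambda>f g x. f x + g x"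
  by (rule ae_rel_plus)
lift_definition minus_lebfun :: "'a lebfun \<Rightarrow> 'a lebfun \<Rightarrow> 'a lebfun" is "\<lambda>f g x. f x - g x"
  by (rule ae_rel_minus)
lift_definition uminus_lebfun :: "'a lebfun \<Rightarrow> 'a lebfun" is "\<lambda>f x. - f x"
  by (rule ae_rel_uminus)
lift_definition scaleR_lebfun :: "real \<Rightarrow> 'a lebfun \<Rightarrow> 'a lebfun" is "\<lambda>c f x. c * f x"
  by (rule ae_rel_scale)

instance
  by standard (transfer; auto simp: ae_rel_def algebra_simps)+

end

text \<open>The \<open>s\<close>-dimensional Hausdorff measure, normalized to agree with \<open>s\<close>-dimensional volume.
  \<open>hausdorff_outer s\<close> is a metric outer measure, hence countably additive on the Borel sets.\<close>

definition hausdorff_pre :: "nat \<Rightarrow> real \<Rightarrow> 'a::metric_space set \<Rightarrow> ennreal" where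
  "hausdorff_pre s \<delta> A =
     (INF C \<in> {C :: nat \<Rightarrow> 'a set. A \<subseteq> (\<Union>i. C i) \<and> (\<forall>i. bounded (C i) \<and> diameter (C i) \<le> \<delta>)}.
        \<Sum>i. if C i = {} then 0 else ennreal (unit_ball_vol (real s) * (diameter (C i) / 2) ^ s))"

definition hausdorff_outer :: "nat \<Rightarrow> 'a::metric_space set \<Rightarrow> ennreal" where
  "hausdorff_outer s A = (SUP \<delta> \<in> {0<..}. hausdorff_pre s \<delta> A)"

definition hausdorff_measure :: "nat \<Rightarrow> 'a::metric_space measure" where
  "hausdorff_measure s = measure_of UNIV (sets borel) (hausdorff_outer s)"

text \<open>Functions on \<open>\<real>\<^sup>n\<close> modulo null sets of the \<open>(n-1)\<close>-dimensional Hausdorff measure. Again,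
  functions on the border of \<open>\<Omega>\<close> are represented by their extensions by \<open>0\<close>.\<close>

quotient_type 'n bdrfun = "real^'n::finite \<Rightarrow> real" / partial: "ae_rel (hausdorff_measure (CARD('n) - 1))"
  by (rule part_equivp_ae_rel)

instantiation bdrfun :: (finite) real_vector
begin

lift_definition zero_bdrfun :: "'a bdrfun" is "\<lambda>_. 0"
  by (rule ae_rel_0)
lift_definition plus_bdrfun :: "'a bdrfun \<Rightarrow> 'a bdrfun \<Rightarrow> 'a bdrfun" is "\<lambda>f g x. f x + g x"
  by (rule ae_rel_plus)
lift_definition minus_bdrfun :: "'a bdrfun \<Rightarrow> 'a bdrfun \<Rightarrow> 'a bdrfun" is "\<lambda>f g x. f x - g x"
  by (rule ae_rel_minus)
lift_definition uminus_bdrfun :: "'a bdrfun \<Rightarrow> 'a bdrfun" is "\<lambda>f x. - f x"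
  by (rule ae_rel_uminus)
lift_definition scaleR_bdrfun :: "real \<Rightarrow> 'a bdrfun \<Rightarrow> 'a bdrfun" is "\<lambda>c f x. c * f x"
  by (rule ae_rel_scale)

instance
  by standard (transfer; auto simp: ae_rel_def algebra_simps)+

end

section \<open>Sobolev spaces on an open set\<close>

definition partial_deriv :: "'n::finite \<Rightarrow> (real^'n \<Rightarrow> real) \<Rightarrow> real^'n \<Rightarrow> real" where
  "partial_deriv i \<phi> x = frechet_derivative \<phi> (at x) (axis i 1)"

primrec C_k :: "nat \<Rightarrow> (real^'n::finite \<Rightarrow> real) \<Rightarrow> bool" where
  "C_k 0 \<phi> \<longleftrightarrow> continuous_on UNIV \<phi>"
| "C_k (Suc k) \<phi> \<longleftrightarrow> (\<forall>x. \<phi> differentiable at x) \<and> (\<forall>i. C_k k (partial_deriv i \<phi>))"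

definition test_functions :: "(real^'n::finite) set \<Rightarrow> (real^'n \<Rightarrow> real) set" where
  "test_functions \<Omega> = {\<phi>. (\<forall>k. C_k k \<phi>) \<and> compact (closure {x. \<phi> x \<noteq> 0}) \<and> closure {x. \<phi> x \<noteq> 0} \<subseteq> \<Omega>}"

definition L2 :: "(real^'n::finite) set \<Rightarrow> 'n lebfun set" where
  "L2 \<Omega> = {u. set_integrable lborel \<Omega> (\<lambda>x. (rep_lebfun u x)\<^sup>2) \<and> (AE x in lborel. x \<notin> \<Omega> \<longrightarrow> rep_lebfun u x = 0)}"

definition inner_2 :: "(real^'n::finite) set \<Rightarrow> 'n lebfun \<Rightarrow> 'n lebfun \<Rightarrow> real" where
  "inner_2 \<Omega> u v = (LINT x:\<Omega>|lborel. rep_lebfun u x * rep_lebfun v x)"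

definition has_weak_partial :: "(real^'n::finite) set \<Rightarrow> 'n \<Rightarrow> 'n lebfun \<Rightarrow> 'n lebfun \<Rightarrow> bool" where
  "has_weak_partial \<Omega> i u v \<longleftrightarrow>
     (\<forall>\<phi> \<in> test_functions \<Omega>. (LINT x:\<Omega>|lborel. rep_lebfun u x * partial_deriv i \<phi> x)
                            = - (LINT x:\<Omega>|lborel. rep_lebfun v x * \<phi> x))"

definition W12 :: "(real^'n::finite) set \<Rightarrow> 'n lebfun set" where
  "W12 \<Omega> = {u \<in> L2 \<Omega>. \<forall>i. \<exists>v \<in> L2 \<Omega>. has_weak_partial \<Omega> i u v}"

definition weak_partial :: "(real^'n::finite) set \<Rightarrow> 'n \<Rightarrow> 'n lebfun \<Rightarrow> 'n lebfun" where
  "weak_partial \<Omega> i u = (THE v. v \<in> L2 \<Omega> \<and> has_weak_partial \<Omega> i u v)"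

definition inner_nabla :: "(real^'n::finite) set \<Rightarrow> 'n lebfun \<Rightarrow> 'n lebfun \<Rightarrow> real" where
  "inner_nabla \<Omega> u v =
     (LINT x:\<Omega>|lborel. \<Sum>i\<in>UNIV. rep_lebfun (weak_partial \<Omega> i u) x * rep_lebfun (weak_partial \<Omega> i v) x)"

definition norm_nabla :: "(real^'n::finite) set \<Rightarrow> 'n lebfun \<Rightarrow> real" where
  "norm_nabla \<Omega> u = sqrt (inner_nabla \<Omega> u u)"

definition inner_12 :: "(real^'n::finite) set \<Rightarrow> 'n lebfun \<Rightarrow> 'n lebfun \<Rightarrow> real" where
  "inner_12 \<Omega> u v = inner_2 \<Omega> u v + inner_nabla \<Omega> u v"

definition norm_12 :: "(real^'n::finite) set \<Rightarrow> 'n lebfun \<Rightarrow> real" where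
  "norm_12 \<Omega> u = sqrt (inner_12 \<Omega> u u)"

definition W12_topology :: "(real^'n::finite) set \<Rightarrow> 'n lebfun topology" where
  "W12_topology \<Omega> = Metric_space.mtopology (W12 \<Omega>) (\<lambda>u v. norm_12 \<Omega> (u - v))"

definition W12_0 :: "(real^'n::finite) set \<Rightarrow> 'n lebfun set" where
  "W12_0 \<Omega> = W12_topology \<Omega> closure_of (abs_lebfun ` test_functions \<Omega>)"

section \<open>The border Sobolev space of order 1/2\<close>

definition border_measure :: "(real^'n::finite) set \<Rightarrow> (real^'n) measure" where
  "border_measure \<Omega> = restrict_space (hausdorff_measure (CARD('n) - 1)) (frontier \<Omega>)"

text \<open>The Gagliardo--Slobodeckij difference quotient of order 1/2 on the \<open>(n-1)\<close>-dimensional border: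
  the exponent of the distance is \<open>(n-1) + 2 * (1/2) = n\<close>. On the diagonal it is \<open>0\<close>.\<close>

definition slobodeckij_quot :: "'n::finite bdrfun \<Rightarrow> (real^'n) \<times> (real^'n) \<Rightarrow> real" where
  "slobodeckij_quot g = (\<lambda>(x, y). (rep_bdrfun g x - rep_bdrfun g y)\<^sup>2 / dist x y ^ CARD('n))"

definition W_half :: "(real^'n::finite) set \<Rightarrow> 'n bdrfun set" where
  "W_half \<Omega> = {g. (AE x in hausdorff_measure (CARD('n) - 1). x \<notin> frontier \<Omega> \<longrightarrow> rep_bdrfun g x = 0) \<and>
                 integrable (border_measure \<Omega>) (\<lambda>x. (rep_bdrfun g x)\<^sup>2) \<and>
                 integrable (border_measure \<Omega> \<Otimes>\<^sub>M border_measure \<Omega>) (slobodeckij_quot g)}"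

definition norm_half :: "(real^'n::finite) set \<Rightarrow> 'n bdrfun \<Rightarrow> real" where
  "norm_half \<Omega> g = sqrt ((LINT x|border_measure \<Omega>. (rep_bdrfun g x)\<^sup>2) +
                        (LINT z|(border_measure \<Omega> \<Otimes>\<^sub>M border_measure \<Omega>). slobodeckij_quot g z))"

definition W_half_topology :: "(real^'n::finite) set \<Rightarrow> 'n bdrfun topology" where
  "W_half_topology \<Omega> = Metric_space.mtopology (W_half \<Omega>) (\<lambda>g h. norm_half \<Omega> (g - h))"

section \<open>Trace maps and the quotient maps\<close>

text \<open>Linear maps between linear subspaces \<open>V\<close> and \<open>W\<close>; values outside \<open>V\<close> are irrelevant.\<close>

definition linear_between :: "'a::real_vector set \<Rightarrow> 'b::real_vector set \<Rightarrow> ('a \<Rightarrow> 'b) \<Rightarrow> bool" where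
  "linear_between V W L \<longleftrightarrow> L \<in> V \<rightarrow> W \<and> (\<forall>x\<in>V. \<forall>y\<in>V. L (x + y) = L x + L y) \<and>
     (\<forall>c. \<forall>x\<in>V. L (c *\<^sub>R x) = c *\<^sub>R L x)"

definition affine_between :: "'a::real_vector set \<Rightarrow> 'b::real_vector set \<Rightarrow> ('a \<Rightarrow> 'b) \<Rightarrow> bool" where
  "affine_between V W F \<longleftrightarrow> (\<exists>L. \<exists>c\<in>W. linear_between V W L \<and> (\<forall>x\<in>V. F x = L x + c))"

definition is_trace_map :: "(real^'n::finite) set \<Rightarrow> ('n lebfun \<Rightarrow> 'n bdrfun) \<Rightarrow> bool" where
  "is_trace_map \<Omega> T \<longleftrightarrow>
     linear_between (W12 \<Omega>) (W_half \<Omega>) T \<and>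
     (\<exists>C. \<forall>u \<in> W12 \<Omega>. norm_half \<Omega> (T u) \<le> C * norm_12 \<Omega> u) \<and>
     (\<forall>u \<in> W12 \<Omega>. \<forall>v. continuous_on (closure \<Omega>) v \<and> (AE x in lborel. x \<in> \<Omega> \<longrightarrow> rep_lebfun u x = v x)
        \<longrightarrow> T u = abs_bdrfun (\<lambda>x. if x \<in> frontier \<Omega> then v x else 0))"

definition coset :: "(real^'n::finite) set \<Rightarrow> 'n lebfun \<Rightarrow> 'n lebfun set" where
  "coset \<Omega> g = (\<lambda>h. g + h) ` W12_0 \<Omega>"

definition W12_quot :: "(real^'n::finite) set \<Rightarrow> 'n lebfun set set" where
  "W12_quot \<Omega> = coset \<Omega> ` W12 \<Omega>"

text \<open>\<open>the_elem\<close> picks the common value on all representatives of a coset.\<close>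

definition trace_quot :: "('n::finite lebfun \<Rightarrow> 'n bdrfun) \<Rightarrow> 'n lebfun set \<Rightarrow> 'n bdrfun" where
  "trace_quot T G = the_elem (T ` G)"

definition E :: "(real^'n::finite) set \<Rightarrow> ('n lebfun \<Rightarrow> 'n bdrfun) \<Rightarrow> 'n bdrfun \<Rightarrow> 'n lebfun set" where
  "E \<Omega> T = inv_into (W12_quot \<Omega>) (trace_quot T)"

definition energy :: "(real^'n::finite) set \<Rightarrow> 'n lebfun \<Rightarrow> 'n lebfun \<Rightarrow> real" where
  "energy \<Omega> f w = 1 / 2 * (norm_nabla \<Omega> w)\<^sup>2 - inner_2 \<Omega> f w"

definition minimizes_on :: "('a \<Rightarrow> real) \<Rightarrow> 'a set \<Rightarrow> 'a \<Rightarrow> bool" where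
  "minimizes_on J A u \<longleftrightarrow> u \<in> A \<and> (\<forall>w\<in>A. J u \<le> J w)"

definition S :: "(real^'n::finite) set \<Rightarrow> 'n lebfun \<Rightarrow> 'n lebfun \<Rightarrow> 'n lebfun" where
  "S \<Omega> f g = (THE u. minimizes_on (energy \<Omega> f) {w \<in> W12 \<Omega>. w - g \<in> W12_0 \<Omega>} u)"

definition S_quot :: "(real^'n::finite) set \<Rightarrow> 'n lebfun \<Rightarrow> 'n lebfun set \<Rightarrow> 'n lebfun" where
  "S_quot \<Omega> f G = the_elem (S \<Omega> f ` G)"

end

theory Submission
  imports Defs
begin

text \<open>The energy is a quadratic functional, minimized on the affine class \<open>g + W12_0 \<Omega>\<close> by the
  direct method: the parallelogram law turns a minimizing sequence into a Cauchy sequence for the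
  Dirichlet seminorm, and the Poincare inequality on the bounded domain into one for \<open>norm_12\<close>.
  The Euler--Lagrange equation makes the minimizer linear in the pair \<open>(f, g)\<close> and, for \<open>f = 0\<close>,
  bounded by \<open>norm_12 \<Omega> g\<close>. Continuity in the trace \<open>g\<^sub>0\<close> needs a lift \<open>g\<close> of \<open>g\<^sub>0\<close> whose norm is
  bounded by \<open>norm_half \<Omega> g\<^sub>0\<close>, which is the open mapping theorem for the trace map between the
  complete spaces \<open>W12 \<Omega>\<close> and \<open>W_half \<Omega>\<close>.\<close>

section \<open>Normed subspaces of a real vector space\<close>

text \<open>The spaces depend on the term \<open>\<Omega>\<close> and are subsets of one quotient
  type, so norms, completeness and the open mapping theorem are developed relative to a carrier set.
  The Dirichlet form is only semidefinite; on differences of admissible functions the Poincare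
  inequality supplies the missing definiteness. That inequality comes from integrating the square of
  a test function by parts against a coordinate function, and then passes to the closure. That this
  closure, \<open>W12_0 \<Omega>\<close>, is a subspace is read off from its being the null-space of
  the trace map. Since \<open>weak_partial\<close> is a \<open>THE\<close>-term, everything about
  the gradient rests on uniqueness of weak derivatives, hence on the fundamental lemma, obtained
  from bump functions and Lebesgue differentiation. The border norm is an L2 norm twice over: the
  Slobodeckij seminorm is the L2 norm, on the square of the border, of a difference quotient that is
  linear in the function. There the point is that null sets of the border become null strips of the
  square.\<close>

locale norm_on =
  fixes V :: "'a::real_vector set" and N :: "'a \<Rightarrow> real"
  assumes sub: "subspace V"
    and norm_add: "x \<in> V \<Longrightarrow> y \<in> V \<Longrightarrow> N (x + y) \<le> N x + N y"
    and norm_scale: "x \<in> V \<Longrightarrow> N (c *\<^sub>R x) = \<bar>c\<bar> * N x"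
    and norm_definite: "x \<in> V \<Longrightarrow> N x = 0 \<Longrightarrow> x = 0"
    and norm_nonneg: "0 \<le> N x"
    and norm_uminus: "N (- x) = N x"
begin

lemmas mem = subspace_0[OF sub] subspace_add[OF sub] subspace_diff[OF sub] subspace_neg[OF sub]
  subspace_scale[OF sub]

lemma norm_zero: "N 0 = 0"
  using norm_scale[OF subspace_0[OF sub], of 0] by simp

lemma norm_minus_commute: "N (x - y) = N (y - x)"
  using norm_uminus[of "y - x"] by simp

lemma norm_diff_triangle: "x \<in> V \<Longrightarrow> y \<in> V \<Longrightarrow> z \<in> V \<Longrightarrow> N (x - z) \<le> N (x - y) + N (y - z)"
  using norm_add[of "x - y" "y - z"] by (simp add: mem)

lemma norm_diff: "x \<in> V \<Longrightarrow> y \<in> V \<Longrightarrow> N (x - y) \<le> N x + N y"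
  using norm_diff_triangle[of x 0 y] by (simp add: mem norm_uminus)

text \<open>\<open>Metric_space\<close> asks for nonnegativity and symmetry of the distance at all
  points of the type, which is why \<open>norm_nonneg\<close> and \<open>norm_uminus\<close> carry
  no membership premise.\<close>

sublocale Metric_space V "\<lambda>x y. N (x - y)"
  by standard
    (auto simp: norm_nonneg norm_zero mem norm_minus_commute intro: norm_diff_triangle dest!: norm_definite[rotated])

end

definition Cauchy_on :: "('a::real_vector \<Rightarrow> real) \<Rightarrow> (nat \<Rightarrow> 'a) \<Rightarrow> bool" where
  "Cauchy_on N \<sigma> \<longleftrightarrow> (\<forall>e>0. \<exists>M. \<forall>m\<ge>M. \<forall>n\<ge>M. N (\<sigma> m - \<sigma> n) < e)"

definition complete_on :: "'a::real_vector set \<Rightarrow> ('a \<Rightarrow> real) \<Rightarrow> bool" where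
  "complete_on V N \<longleftrightarrow>
     (\<forall>\<sigma>. range \<sigma> \<subseteq> V \<and> Cauchy_on N \<sigma> \<longrightarrow> (\<exists>l\<in>V. (\<lambda>n. N (\<sigma> n - l)) \<longlonglongrightarrow> 0))"

lemma complete_onD:
  assumes "complete_on V N" "\<And>n. \<sigma> n \<in> V" "Cauchy_on N \<sigma>"
  obtains l where "l \<in> V" "(\<lambda>n. N (\<sigma> n - l)) \<longlonglongrightarrow> 0"
  using assms unfolding complete_on_def by blast

lemma Cauchy_onI_bound:
  assumes "\<And>m n. N (\<sigma> m - \<sigma> n) \<le> b m + b n" "b \<longlonglongrightarrow> (0::real)"
  shows "Cauchy_on N \<sigma>"
  unfolding Cauchy_on_def
proof (intro allI impI)
  fix e :: real
  assume "e > 0"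
  then have "\<forall>\<^sub>F n in sequentially. b n < e / 2"
    using assms(2) by (intro order_tendstoD) auto
  then obtain M where "\<And>n. n \<ge> M \<Longrightarrow> b n < e / 2"
    by (auto simp: eventually_sequentially)
  then show "\<exists>M. \<forall>m\<ge>M. \<forall>n\<ge>M. N (\<sigma> m - \<sigma> n) < e"
    using assms(1) by (intro exI[of _ M]) (smt (verit) field_sum_of_halves)
qed

lemma Cauchy_on_mono:
  assumes "Cauchy_on N \<sigma>" "\<And>m n. N' (\<tau> m - \<tau> n) \<le> N (\<sigma> m - \<sigma> n)"
  shows "Cauchy_on N' \<tau>"
  using assms unfolding Cauchy_on_def by (meson le_less_trans)

context norm_on
begin

text \<open>The Baire category theorem speaks of \<open>mcomplete\<close>, whereas the function
  spaces are proved complete by norms tending to 0.\<close>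

lemma mcomplete_iff: "mcomplete \<longleftrightarrow> complete_on V N"
  unfolding mcomplete_def complete_on_def MCauchy_def Cauchy_on_def limit_metric_sequentially
    lim_sequentially
  apply (rule all_cong1)
  apply (simp add: dist_real_def norm_nonneg subset_iff image_subset_iff)
  by metis

lemma limitin_iff:
  assumes "range \<sigma> \<subseteq> V"
  shows "limitin mtopology \<sigma> l sequentially \<longleftrightarrow> l \<in> V \<and> (\<lambda>n. N (\<sigma> n - l)) \<longlonglongrightarrow> 0"
  using assms unfolding limit_metric_sequentially lim_sequentially
  by (auto simp: dist_real_def norm_nonneg subset_iff)

text \<open>The distance bound \<open>2 * A\<close> is the sum of the geometric series; in
  \<open>bounded_preimage\<close> it controls the norm of the preimage.\<close>

lemma geometric_Cauchy:
  assumes V: "range \<sigma> \<subseteq> V" and step: "\<And>k. N (\<sigma> (Suc k) - \<sigma> k) \<le> A / 2 ^ k"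
  shows "Cauchy_on N \<sigma>" "N (\<sigma> k - \<sigma> 0) \<le> 2 * A"
proof -
  have A: "A \<ge> 0"
    using order_trans[OF norm_nonneg step[of 0]] by simp
  \<comment> \<open>The subtracted term makes the induction close: one more step costs
    \<open>A / 2 ^ (k + p)\<close>, which is half of what is subtracted at stage
    \<open>p\<close>.\<close>
  have *: "N (\<sigma> (k + p) - \<sigma> k) \<le> 2 * A / 2 ^ k - 2 * A / 2 ^ (k + p)" for k p
  proof (induction p)
    case 0
    then show ?case by (simp add: norm_zero)
  next
    case (Suc p)
    have "N (\<sigma> (k + Suc p) - \<sigma> k) \<le> N (\<sigma> (Suc (k + p)) - \<sigma> (k + p)) + N (\<sigma> (k + p) - \<sigma> k)"
      using V by (auto intro!: norm_diff_triangle)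
    also have "\<dots> \<le> A / 2 ^ (k + p) + (2 * A / 2 ^ k - 2 * A / 2 ^ (k + p))"
      using step Suc by (intro add_mono) auto
    finally show ?case by (simp add: field_simps)
  qed
  have **: "N (\<sigma> m - \<sigma> n) \<le> 2 * A / 2 ^ n" if "n \<le> m" for m n
    using *[of n "m - n"] that A by (smt (verit) divide_nonneg_pos le_add_diff_inverse zero_less_power)
  show "N (\<sigma> k - \<sigma> 0) \<le> 2 * A"
    using **[of 0 k] by simp
  have "N (\<sigma> m - \<sigma> n) \<le> 2 * A / 2 ^ m + 2 * A / 2 ^ n" for m n
    using **[of n m] **[of m n] A norm_minus_commute[of "\<sigma> m" "\<sigma> n"]
    by (smt (verit) divide_nonneg_pos linorder_linear zero_less_power)
  moreover have "(\<lambda>n. 2 * A / 2 ^ n) \<longlonglongrightarrow> 0"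
    by (rule LIMSEQ_divide_realpow_zero) simp
  ultimately show "Cauchy_on N \<sigma>"
    by (rule Cauchy_onI_bound)
qed

end

lemma linear_betweenD:
  assumes "linear_between V W L"
  shows "x \<in> V \<Longrightarrow> L x \<in> W" "x \<in> V \<Longrightarrow> y \<in> V \<Longrightarrow> L (x + y) = L x + L y"
    "x \<in> V \<Longrightarrow> L (c *\<^sub>R x) = c *\<^sub>R L x"
  using assms by (auto simp: linear_between_def)

lemma linear_between_diff:
  assumes "linear_between V W L" "subspace V" "x \<in> V" "y \<in> V"
  shows "L (x - y) = L x - L y"
  using linear_betweenD(2)[OF assms(1), of x "- y"] linear_betweenD(3)[OF assms(1), of y "-1"] assms
  by (simp add: subspace_neg)

text \<open>This is how \<open>W12_0\<close>, defined as a closure, is recognized as a subspace: it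
  is the null-space of the trace map.\<close>

lemma subspace_linear_kernel:
  assumes "linear_between V W L" "subspace V"
  shows "subspace {x \<in> V. L x = 0}"
  using assms linear_betweenD(2,3)[OF assms(1)] linear_betweenD(3)[OF assms(1), of 0 0]
  unfolding subspace_def by auto

section \<open>The open mapping theorem between complete carriers\<close>

locale bounded_surjection =
  X: norm_on X NX + Y: norm_on Y NY
  for X :: "'a::real_vector set" and NX and Y :: "'b::real_vector set" and NY +
  fixes T :: "'a \<Rightarrow> 'b"
  assumes lin: "linear_between X Y T" and onto: "T ` X = Y"
    and bounded: "\<exists>C. \<forall>x\<in>X. NY (T x) \<le> C * NX x"
    and X_complete: "complete_on X NX" and Y_complete: "complete_on Y NY"
begin

lemma T_diff: "x \<in> X \<Longrightarrow> y \<in> X \<Longrightarrow> T (x - y) = T x - T y"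
  using linear_between_diff[OF lin X.sub] .

text \<open>By surjectivity the images of the balls of integer radius exhaust \<open>Y\<close>; by
  Baire one of their closures has an interior point.\<close>

lemma closure_image_ball_has_interior:
  obtains n :: nat and y r where "y \<in> Y" "r > 0"
    "Y.mball y r \<subseteq> Y.mtopology closure_of (T ` {x\<in>X. NX x \<le> real n})"
proof -
  let ?A = "\<lambda>n::nat. Y.mtopology closure_of (T ` {x\<in>X. NX x \<le> real n})"
  have "Y \<subseteq> \<Union> (range ?A)"
  proof
    fix y assume "y \<in> Y"
    then obtain x where x: "x \<in> X" "y = T x"
      using onto by auto
    obtain n :: nat where "NX x \<le> n"
      using real_arch_simple by blast
    then have "y \<in> T ` {x\<in>X. NX x \<le> n}"
      using x by auto
    moreover have "T ` {x\<in>X. NX x \<le> n} \<subseteq> topspace Y.mtopology"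
      using onto by auto
    ultimately show "y \<in> \<Union> (range ?A)"
      using closure_of_subset by fast
  qed
  moreover have "\<Union> (range ?A) \<subseteq> Y"
    using closure_of_subset_topspace[of Y.mtopology] by fastforce
  ultimately have "\<Union> (range ?A) = Y" by auto
  then have "Y.mtopology interior_of \<Union> (range ?A) \<noteq> {}"
    using interior_of_topspace[of Y.mtopology] Y.mem(1) by auto
  then obtain n where "Y.mtopology interior_of ?A n \<noteq> {}"
    using Y.metric_Baire_category_alt[of "range ?A"] Y_complete
    by (force simp: Y.mcomplete_iff)
  then show ?thesis
    using that unfolding Y.metric_interior_of by blast
qed

text \<open>The ball found by Baire sits at some \<open>y0\<close>. Symmetrization moves it to the
  origin, and scaling then turns it into a bound linear in \<open>NY y\<close>, whence
  \<open>K = 2 * n / r\<close>. Closures give only approximate preimages; the error is chosen as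
  half of \<open>NY y\<close>.\<close>

lemma approximate_preimage:
  obtains K where "K \<ge> 0"
    "\<And>y. y \<in> Y \<Longrightarrow> \<exists>x\<in>X. NX x \<le> K * NY y \<and> NY (y - T x) \<le> NY y / 2"
proof -
  obtain n :: nat and y0 r where y0: "y0 \<in> Y" and r: "r > 0"
    and ball: "Y.mball y0 r \<subseteq> Y.mtopology closure_of (T ` {x\<in>X. NX x \<le> real n})"
    by (rule closure_image_ball_has_interior)
  have near: "\<exists>x\<in>X. NX x \<le> n \<and> NY (y0 + y - T x) < e" if "y \<in> Y" "NY y < r" "e > 0" for y e
  proof -
    have "y0 + y \<in> Y.mball y0 r"
      using that y0 Y.mem by (simp add: Y.norm_uminus)
    then have "y0 + y \<in> Y.mtopology closure_of (T ` {x\<in>X. NX x \<le> real n})"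
      using ball by blast
    then show ?thesis
      using \<open>e > 0\<close> unfolding Y.metric_closure_of by (auto dest!: spec[of _ e])
  qed
  have small: "\<exists>x\<in>X. NX x \<le> n \<and> NY (y - T x) < e" if y: "y \<in> Y" "NY y < r" and e: "e > 0" for y e
  proof -
    obtain x1 where x1: "x1 \<in> X" "NX x1 \<le> n" "NY (y0 + y - T x1) < e"
      using near[OF y e] by auto
    obtain x2 where x2: "x2 \<in> X" "NX x2 \<le> n" "NY (y0 + - y - T x2) < e"
      using near[of "- y" e] y e Y.mem by (auto simp: Y.norm_uminus)
    \<comment> \<open>Half the difference of near-preimages of \<open>y0 + y\<close> and
      \<open>y0 - y\<close>: the centre \<open>y0\<close> cancels, and neither the norm bound
      \<open>n\<close> nor the error \<open>e\<close> grows.\<close>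
    let ?x = "(1/2) *\<^sub>R (x1 - x2)"
    have x: "?x \<in> X" "T ?x = (1/2) *\<^sub>R (T x1 - T x2)"
      using x1 x2 X.mem linear_betweenD(3)[OF lin] T_diff by auto
    have TY: "T x1 \<in> Y" "T x2 \<in> Y"
      using x1 x2 onto by auto
    have "NX ?x \<le> n"
      using x1 x2 X.norm_diff[of x1 x2] X.norm_scale[of "x1 - x2" "1/2"] X.mem by auto
    moreover have "NY (y - T ?x) < e"
    proof -
      have "(1/2) *\<^sub>R (y + y) = y"
        by (metis scaleR_half_double)
      then have "y - T ?x = (1/2) *\<^sub>R ((y0 + y - T x1) - (y0 + - y - T x2))"
        unfolding x by (simp add: algebra_simps)
      then have "NY (y - T ?x) \<le> (1/2) * (NY (y0 + y - T x1) + NY (y0 + - y - T x2))"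
        using Y.norm_diff[of "y0 + y - T x1" "y0 + - y - T x2"] y y0 TY Y.mem
        by (simp add: Y.norm_scale)
      then show ?thesis using x1 x2 by simp
    qed
    ultimately show ?thesis using x by blast
  qed
  show ?thesis
  proof
    show "2 * real n / r \<ge> 0" using r by simp
    fix y assume y: "y \<in> Y"
    show "\<exists>x\<in>X. NX x \<le> 2 * real n / r * NY y \<and> NY (y - T x) \<le> NY y / 2"
    proof (cases "NY y = 0")
      case True
      then have "T 0 = 0" "y = 0"
        using linear_betweenD(3)[OF lin, of 0 0] X.mem Y.norm_definite y by auto
      then show ?thesis
        using X.mem(1) X.norm_zero Y.norm_zero by (intro bexI[of _ 0]) auto
    next
      case False
      then have pos: "NY y > 0"
        using Y.norm_nonneg[of y] by simp
      \<comment> \<open>Scales \<open>y\<close> to norm \<open>r / 2\<close>, inside the ball;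
        scaling back turns the error \<open>r / 4\<close> into \<open>NY y / 2\<close>.\<close>
      let ?c = "r / (2 * NY y)"
      have c: "?c > 0" using r pos by simp
      have "NY (?c *\<^sub>R y) < r"
        using Y.norm_scale[OF y, of ?c] c pos r by simp
      then obtain x where x: "x \<in> X" "NX x \<le> n" "NY (?c *\<^sub>R y - T x) < r / 4"
        using small[of "?c *\<^sub>R y" "r / 4"] y Y.mem r by auto
      let ?x = "inverse ?c *\<^sub>R x"
      have Tx: "T ?x = inverse ?c *\<^sub>R T x" "?x \<in> X" "T x \<in> Y"
        using x linear_betweenD[OF lin] X.mem by auto
      have "NX ?x = 2 * NY y / r * NX x"
        using X.norm_scale[OF x(1), of "inverse ?c"] c pos r by simp
      also have "\<dots> \<le> 2 * NY y / r * n"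
        using x pos r by (intro mult_left_mono) auto
      finally have 1: "NX ?x \<le> 2 * real n / r * NY y" by (simp add: mult_ac)
      have "inverse ?c *\<^sub>R ?c *\<^sub>R y = y"
        using c by auto
      then have "y - T ?x = inverse ?c *\<^sub>R (?c *\<^sub>R y - T x)"
        unfolding Tx by (simp add: scaleR_diff_right)
      then have "NY (y - T ?x) = inverse ?c * NY (?c *\<^sub>R y - T x)"
        using Y.norm_scale[of "?c *\<^sub>R y - T x" "inverse ?c"] c y Tx(3) Y.mem
        abs_of_pos[of "inverse ?c"] by (simp only: positive_imp_inverse_positive)
      also have "\<dots> \<le> inverse ?c * (r / 4)"
        by (rule mult_left_mono[OF less_imp_le[OF x(3)] less_imp_le[OF positive_imp_inverse_positive[OF c]]])
      also have "\<dots> = NY y / 2" using r pos by (simp add: field_simps)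
      finally show ?thesis using 1 Tx by blast
    qed
  qed
qed

text \<open>Adding at each step an approximate preimage of the residual \<open>y - T x\<close>
  halves the residual, so the corrections sum like a geometric series. Completeness of
  \<open>X\<close> gives an exact preimage at the price of doubling the constant.\<close>

theorem bounded_preimage:
  obtains K where "K \<ge> 0" "\<And>y. y \<in> Y \<Longrightarrow> \<exists>x\<in>X. T x = y \<and> NX x \<le> K * NY y"
proof -
  obtain K where K: "K \<ge> 0"
    "\<And>y. y \<in> Y \<Longrightarrow> \<exists>x\<in>X. NX x \<le> K * NY y \<and> NY (y - T x) \<le> NY y / 2"
    using approximate_preimage by blast
  then obtain g where g: "\<And>y. y \<in> Y \<Longrightarrow> g y \<in> X \<and> NX (g y) \<le> K * NY y \<and> NY (y - T (g y)) \<le> NY y / 2"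
    by metis
  obtain C where C: "\<And>x. x \<in> X \<Longrightarrow> NY (T x) \<le> C * NX x"
    using bounded by auto
  have "\<exists>x\<in>X. T x = y \<and> NX x \<le> 2 * K * NY y" if y: "y \<in> Y" for y
  proof -
    define s where "s = rec_nat 0 (\<lambda>_ x. x + g (y - T x))"
    have s0: "s 0 = 0" and s_Suc: "\<And>k. s (Suc k) = s k + g (y - T (s k))"
      by (simp_all add: s_def)
    have res: "y - T x \<in> Y" if "x \<in> X" for x
      using that y linear_betweenD(1)[OF lin] Y.mem by auto
    have T0: "T 0 = 0"
      using linear_betweenD(3)[OF lin, of 0 0] X.mem by auto
    have s: "s k \<in> X \<and> NY (y - T (s k)) \<le> NY y / 2 ^ k" for k
    proof (induction k)
      case 0
      then show ?case by (simp add: s0 T0 X.mem)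
    next
      case (Suc k)
      have G: "g (y - T (s k)) \<in> X" "NY (y - T (s k) - T (g (y - T (s k)))) \<le> NY (y - T (s k)) / 2"
        using g[of "y - T (s k)"] res Suc by auto
      have eq: "y - T (s (Suc k)) = y - T (s k) - T (g (y - T (s k)))"
        using G Suc linear_betweenD(2)[OF lin] by (simp add: s_Suc)
      have "NY (y - T (s (Suc k))) \<le> NY (y - T (s k)) / 2"
        unfolding eq by (rule G(2))
      then have "NY (y - T (s (Suc k))) \<le> NY y / 2 ^ Suc k"
        using Suc by simp
      then show ?case
        using G(1) Suc X.mem(2) by (simp add: s_Suc)
    qed
    have range: "range s \<subseteq> X" using s by auto
    have step: "NX (s (Suc k) - s k) \<le> (K * NY y) / 2 ^ k" for k
    proof -
      have "NX (s (Suc k) - s k) \<le> K * NY (y - T (s k))"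
        using g[of "y - T (s k)"] res s by (simp add: s_Suc)
      also have "\<dots> \<le> K * (NY y / 2 ^ k)"
        using s K by (intro mult_left_mono) auto
      finally show ?thesis by simp
    qed
    note cauchy = X.geometric_Cauchy[OF range step]
    obtain x where x: "x \<in> X" "(\<lambda>n. NX (s n - x)) \<longlonglongrightarrow> 0"
      using X_complete range cauchy(1) unfolding complete_on_def by blast
    \<comment> \<open>Boundedness of \<open>T\<close> carries the vanishing of the residuals over to
      the limit.\<close>
    have "NY (y - T x) \<le> NY y / 2 ^ k + C * NX (s k - x)" for k
    proof -
      have "NY (y - T x) \<le> NY (y - T (s k)) + NY (T (s k) - T x)"
        using y s x linear_betweenD(1)[OF lin] by (intro Y.norm_diff_triangle) auto
      also have "T (s k) - T x = T (s k - x)"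
        using T_diff s x by auto
      finally show ?thesis
        using s[of k] C[of "s k - x"] x X.mem by auto
    qed
    moreover have "(\<lambda>k. NY y / 2 ^ k + C * NX (s k - x)) \<longlonglongrightarrow> 0 + C * 0"
      by (intro tendsto_intros x LIMSEQ_divide_realpow_zero) simp
    ultimately have "NY (y - T x) \<le> 0"
      using LIMSEQ_le_const by fastforce
    then have "y = T x"
      using Y.norm_definite[of "y - T x"] res x Y.norm_nonneg[of "y - T x"] by auto
    moreover have "NX x \<le> 2 * K * NY y"
    proof -
      have "NX x \<le> 2 * K * NY y + NX (s k - x)" for k
        using X.norm_diff_triangle[of x "s k" 0] s x X.mem cauchy(2)[of k] X.norm_minus_commute[of x "s k"]
        by (auto simp: s0)
      moreover have "(\<lambda>k. 2 * K * NY y + NX (s k - x)) \<longlonglongrightarrow> 2 * K * NY y + 0"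
        by (intro tendsto_intros x)
      ultimately show ?thesis
        using LIMSEQ_le_const by fastforce
    qed
    ultimately show ?thesis using x by auto
  qed
  then show ?thesis
    using that[of "2 * K"] K by auto
qed

end

section \<open>Quadratic minimization\<close>

text \<open>No definiteness is assumed, because the Dirichlet form vanishes on constants.\<close>

locale semi_inner_on =
  fixes V :: "'a::real_vector set" and B :: "'a \<Rightarrow> 'a \<Rightarrow> real"
  assumes sub: "subspace V"
    and sym: "x \<in> V \<Longrightarrow> y \<in> V \<Longrightarrow> B x y = B y x"
    and add_left: "x \<in> V \<Longrightarrow> y \<in> V \<Longrightarrow> z \<in> V \<Longrightarrow> B (x + y) z = B x z + B y z"
    and scale_left: "x \<in> V \<Longrightarrow> y \<in> V \<Longrightarrow> B (c *\<^sub>R x) y = c * B x y"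
    and nonneg: "x \<in> V \<Longrightarrow> 0 \<le> B x x"
begin

lemmas mem = subspace_0[OF sub] subspace_add[OF sub] subspace_diff[OF sub] subspace_neg[OF sub]
  subspace_scale[OF sub]

definition nrm where "nrm x = sqrt (B x x)"

lemma add_right: "x \<in> V \<Longrightarrow> y \<in> V \<Longrightarrow> z \<in> V \<Longrightarrow> B z (x + y) = B z x + B z y"
  by (simp add: sym[of z] mem add_left)

lemma scale_right: "x \<in> V \<Longrightarrow> y \<in> V \<Longrightarrow> B y (c *\<^sub>R x) = c * B y x"
  by (simp add: sym[of y] mem scale_left)

lemma diff_left: "x \<in> V \<Longrightarrow> y \<in> V \<Longrightarrow> z \<in> V \<Longrightarrow> B (x - y) z = B x z - B y z"
  using add_left[of "x - y" y z] by (simp add: mem)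

lemma diff_right: "x \<in> V \<Longrightarrow> y \<in> V \<Longrightarrow> z \<in> V \<Longrightarrow> B z (x - y) = B z x - B z y"
  by (simp add: sym[of z] mem diff_left)

lemma square_add:
  "x \<in> V \<Longrightarrow> y \<in> V \<Longrightarrow> B (x + c *\<^sub>R y) (x + c *\<^sub>R y) = B x x + 2 * c * B x y + c\<^sup>2 * B y y"
  by (simp add: mem add_left add_right scale_left scale_right sym[of y x] power2_eq_square algebra_simps)

lemma nrm_nonneg: "x \<in> V \<Longrightarrow> 0 \<le> nrm x"
  by (simp add: nrm_def nonneg)

lemma nrm_power2: "x \<in> V \<Longrightarrow> (nrm x)\<^sup>2 = B x x"
  by (simp add: nrm_def nonneg)

lemma nrm_scale: "x \<in> V \<Longrightarrow> nrm (c *\<^sub>R x) = \<bar>c\<bar> * nrm x"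
  by (simp add: nrm_def scale_left scale_right mem real_sqrt_mult flip: mult.assoc power2_eq_square)

lemma Cauchy_Schwarz_power2:
  assumes x: "x \<in> V" and y: "y \<in> V"
  shows "(B x y)\<^sup>2 \<le> B x x * B y y"
proof (cases "B y y = 0")
  case True
  have "0 \<le> B x x + 2 * c * B x y" for c
    using nonneg[of "x + c *\<^sub>R y"] square_add[OF x y, of c] True x y by (simp add: mem)
  \<comment> \<open>At this value of \<open>c\<close> the expression above, affine in
    \<open>c\<close>, would equal -1, so its slope has to vanish.\<close>
  moreover have "2 * (- (B x x + 1) / (2 * B x y)) * B x y = - (B x x + 1)" if "B x y \<noteq> 0"
    using that by simp
  ultimately have "B x y = 0"
    by (metis add_le_same_cancel1 add.commute add.inverse_inverse le_minus_one_simps(3) minus_add_cancel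
        minus_add_distrib uminus_add_conv_diff)
  then show ?thesis using True by simp
next
  case False
  \<comment> \<open>The minimum point of the quadratic polynomial in \<open>c\<close> given by
    \<open>square_add\<close>.\<close>
  let ?c = "- B x y / B y y"
  have "0 \<le> B x x + 2 * ?c * B x y + ?c\<^sup>2 * B y y"
    using nonneg[of "x + ?c *\<^sub>R y"] square_add[OF x y, of ?c] x y by (simp add: mem)
  then show ?thesis
    using False nonneg[OF y] by (simp add: field_simps power2_eq_square)
qed

lemma Cauchy_Schwarz:
  assumes x: "x \<in> V" and y: "y \<in> V"
  shows "\<bar>B x y\<bar> \<le> nrm x * nrm y"
  using real_sqrt_le_mono[OF Cauchy_Schwarz_power2[OF x y]] by (simp add: nrm_def real_sqrt_mult)

lemma nrm_add:
  assumes x: "x \<in> V" and y: "y \<in> V"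
  shows "nrm (x + y) \<le> nrm x + nrm y"
proof (rule power2_le_imp_le)
  have "(nrm (x + y))\<^sup>2 = (nrm x)\<^sup>2 + 2 * B x y + (nrm y)\<^sup>2"
    using square_add[OF x y, of 1] x y by (simp add: nrm_power2 mem)
  also have "\<dots> \<le> (nrm x + nrm y)\<^sup>2"
    using Cauchy_Schwarz[OF x y] by (simp add: power2_sum)
  finally show "(nrm (x + y))\<^sup>2 \<le> (nrm x + nrm y)\<^sup>2" .
qed (simp add: nrm_nonneg x y)

lemma nrm_uminus: "x \<in> V \<Longrightarrow> nrm (- x) = nrm x"
  using nrm_scale[of x "-1"] by simp

lemma nrm_diff: "x \<in> V \<Longrightarrow> y \<in> V \<Longrightarrow> nrm (x - y) \<le> nrm x + nrm y"
  using nrm_add[of x "- y"] by (simp add: mem nrm_uminus)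

lemma nrm_triangle_ineq2: "x \<in> V \<Longrightarrow> y \<in> V \<Longrightarrow> \<bar>nrm x - nrm y\<bar> \<le> nrm (x - y)"
  using nrm_add[of "x - y" y] nrm_add[of "y - x" x] nrm_uminus[of "x - y"] by (simp add: mem)

end

lemma (in semi_inner_on) norm_onI:
  assumes "\<And>x. x \<in> V \<Longrightarrow> N x = sqrt (B x x)" "\<And>x. x \<in> V \<Longrightarrow> B x x = 0 \<Longrightarrow> x = 0"
    and "\<And>x. 0 \<le> N x" "\<And>x. N (- x) = N x"
  shows "norm_on V N"
proof
  show "N (x + y) \<le> N x + N y" if "x \<in> V" "y \<in> V" for x y
    using nrm_add[OF that] that by (simp add: assms(1) mem nrm_def)
  show "N (c *\<^sub>R x) = \<bar>c\<bar> * N x" if "x \<in> V" for x c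
    using nrm_scale[OF that, of c] that by (simp add: assms(1) mem nrm_def)
  show "x = 0" if "x \<in> V" "N x = 0" for x
    using assms that by simp
qed (use assms sub in auto)

section \<open>Minimizing a quadratic functional on an affine class\<close>

lemma linear_coeff_zero:
  fixes c d :: real
  assumes "d \<ge> 0" "\<And>t. 0 \<le> t * c + t\<^sup>2 * d"
  shows "c = 0"
proof (rule ccontr)
  assume "c \<noteq> 0"
  \<comment> \<open>At \<open>t = - s\<close> the polynomial takes the value
    \<open>- s\<^sup>2\<close>; the summand 1 covers the case \<open>d = 0\<close>.\<close>
  define s where "s = c / (d + 1)"
  have c: "c = s * (d + 1)" and "s \<noteq> 0"
    using \<open>c \<noteq> 0\<close> assms(1) by (simp_all add: s_def)
  have "0 \<le> (- s) * c + (- s)\<^sup>2 * d"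
    by (rule assms)
  also have "\<dots> = - s\<^sup>2"
    unfolding c by (simp add: power2_eq_square algebra_simps)
  finally show False using \<open>s \<noteq> 0\<close> by simp
qed

text \<open>To be read with \<open>a\<close> the Dirichlet form, \<open>b\<close> the L2 product and
  \<open>N\<close> the Sobolev norm. The inequality with constant \<open>P\<close> is asked for on
  \<open>V\<^sub>0\<close> alone: on all of \<open>V\<close> the constants would refute it.\<close>

locale quadratic_minimization =
  a: semi_inner_on V a + b: semi_inner_on V b + norm_on V N
  for V :: "'a::real_vector set" and a b :: "'a \<Rightarrow> 'a \<Rightarrow> real" and N +
  fixes V\<^sub>0 :: "'a set" and P :: real
  assumes N_eq: "x \<in> V \<Longrightarrow> N x = sqrt (b x x + a x x)"
    and sub_0: "subspace V\<^sub>0" and V_0: "V\<^sub>0 \<subseteq> V"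
    and complete: "complete_on V N"
    and closed_0: "range \<sigma> \<subseteq> V\<^sub>0 \<Longrightarrow> l \<in> V \<Longrightarrow> (\<lambda>n. N (\<sigma> n - l)) \<longlonglongrightarrow> 0 \<Longrightarrow> l \<in> V\<^sub>0"
    and P: "P \<ge> 0" and poincare: "h \<in> V\<^sub>0 \<Longrightarrow> b.nrm h \<le> P * a.nrm h"
begin

lemmas mem_0 = subspace_0[OF sub_0] subspace_add[OF sub_0] subspace_diff[OF sub_0]
  subspace_neg[OF sub_0] subspace_scale[OF sub_0]

lemma in_V: "h \<in> V\<^sub>0 \<Longrightarrow> h \<in> V"
  using V_0 by auto

lemma nrm_le_N: "x \<in> V \<Longrightarrow> a.nrm x \<le> N x" "x \<in> V \<Longrightarrow> b.nrm x \<le> N x"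
  using a.nonneg b.nonneg by (auto simp: N_eq a.nrm_def b.nrm_def)

lemma N_le_nrm: "x \<in> V \<Longrightarrow> N x \<le> b.nrm x + a.nrm x"
  using a.nonneg b.nonneg sqrt_add_le_add_sqrt by (auto simp: N_eq a.nrm_def b.nrm_def)

definition J :: "('a \<Rightarrow> real) \<Rightarrow> 'a \<Rightarrow> real" where
  "J l w = 1 / 2 * a w w - l w"

text \<open>The bound is in terms of \<open>b\<close>, as Cauchy-Schwarz in L2 gives it for the
  source term; the Poincare inequality converts it into control by \<open>a\<close> on
  \<open>V\<^sub>0\<close>.\<close>

definition functional :: "('a \<Rightarrow> real) \<Rightarrow> bool" where
  "functional l \<longleftrightarrow> linear_between V UNIV l \<and> (\<exists>F\<ge>0. \<forall>x\<in>V. \<bar>l x\<bar> \<le> F * b.nrm x)"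

definition shift :: "'a \<Rightarrow> 'a set" where
  "shift g = {w \<in> V. w - g \<in> V\<^sub>0}"

text \<open>The Euler-Lagrange equation, i.e. the weak Poisson equation with border values
  prescribed by \<open>g\<close>. Unlike minimality, it is visibly stable under linear
  combinations.\<close>

definition solves :: "('a \<Rightarrow> real) \<Rightarrow> 'a \<Rightarrow> 'a \<Rightarrow> bool" where
  "solves l g u \<longleftrightarrow> u \<in> shift g \<and> (\<forall>h\<in>V\<^sub>0. a u h = l h)"

lemma J_add:
  assumes l: "functional l" and u: "u \<in> V" and h: "h \<in> V"
  shows "J l (u + t *\<^sub>R h) = J l u + t * (a u h - l h) + t\<^sup>2 * (a h h / 2)"
proof -
  have "l (u + t *\<^sub>R h) = l u + t * l h"
    using l u h unfolding functional_def linear_between_def by (simp add: mem)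
  then show ?thesis
    using a.square_add[OF u h, of t] by (simp add: J_def algebra_simps)
qed

lemma shift_add: "u \<in> shift g \<Longrightarrow> h \<in> V\<^sub>0 \<Longrightarrow> u + h \<in> shift g"
  using mem_0(2)[of "u - g" h] by (simp add: shift_def in_V mem algebra_simps)

lemma shift_diff: "u \<in> shift g \<Longrightarrow> v \<in> shift g \<Longrightarrow> u - v \<in> V\<^sub>0"
  using mem_0(3)[of "u - g" "v - g"] by (simp add: shift_def)

text \<open>The expansion \<open>J_add\<close> is exact and its second-order coefficient is
  nonnegative, so the vanishing of the first-order term is both necessary and sufficient.\<close>

lemma minimizes_iff_solves:
  assumes l: "functional l"
  shows "minimizes_on (J l) (shift g) u \<longleftrightarrow> solves l g u"
proof
  assume min: "minimizes_on (J l) (shift g) u"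
  then have u: "u \<in> shift g" "u \<in> V"
    by (auto simp: minimizes_on_def shift_def)
  have "a u h = l h" if h: "h \<in> V\<^sub>0" for h
  proof -
    have "0 \<le> t * (a u h - l h) + t\<^sup>2 * (a h h / 2)" for t
    proof -
      have "J l u \<le> J l (u + t *\<^sub>R h)"
        using min shift_add[OF u(1) mem_0(5)[OF h]] by (simp add: minimizes_on_def)
      then show ?thesis
        using J_add[OF l u(2) in_V[OF h], of t] by simp
    qed
    then have "a u h - l h = 0"
      by (rule linear_coeff_zero[rotated]) (simp add: a.nonneg in_V h)
    then show ?thesis by simp
  qed
  then show "solves l g u"
    using u by (simp add: solves_def)
next
  assume sol: "solves l g u"
  then have u: "u \<in> shift g" "u \<in> V"
    by (auto simp: solves_def shift_def)
  have "J l u \<le> J l w" if w: "w \<in> shift g" for w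
  proof -
    have h: "w - u \<in> V\<^sub>0" using shift_diff w u by blast
    have "J l w = J l u + a (w - u) (w - u) / 2"
      using J_add[OF l u(2) in_V[OF h], of 1] sol h by (simp add: solves_def)
    then show ?thesis using a.nonneg in_V[OF h] by simp
  qed
  then show "minimizes_on (J l) (shift g) u"
    using u by (simp add: minimizes_on_def)
qed

text \<open>The difference of two solutions lies in \<open>V\<^sub>0\<close> and may serve as test
  vector, so its \<open>a\<close>-seminorm vanishes; the Poincare inequality then kills the full
  norm.\<close>

lemma solves_unique:
  assumes u: "solves l g u" and v: "solves l g v"
  shows "u = v"
proof -
  have uv: "u \<in> V" "v \<in> V" and h: "u - v \<in> V\<^sub>0"
    using u v shift_diff[of u g v] by (simp_all add: solves_def) (simp_all add: shift_def)
  have "a (u - v) (u - v) = 0"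
    using a.diff_left[OF uv in_V[OF h]] u v h by (simp add: solves_def)
  then have "a.nrm (u - v) = 0" by (simp add: a.nrm_def)
  then have "N (u - v) = 0"
    using N_le_nrm[OF in_V[OF h]] poincare[OF h] order_antisym[OF _ norm_nonneg[of "u - v"]] by simp
  then show ?thesis
    using norm_definite[of "u - v"] in_V[OF h] by simp
qed

text \<open>Superposition in source and border datum at once; it yields additivity, homogeneity and
  the splitting of a solution into a source-free part and one with trace 0.\<close>

lemma solves_linear:
  assumes "solves l g u" "solves m k v"
  shows "solves (\<lambda>x. c * l x + m x) (c *\<^sub>R g + k) (c *\<^sub>R u + v)"
proof -
  have "c *\<^sub>R (u - g) + (v - k) \<in> V\<^sub>0"
    using assms by (intro mem_0(2) mem_0(5)) (auto simp: solves_def shift_def)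
  also have "c *\<^sub>R (u - g) + (v - k) = (c *\<^sub>R u + v) - (c *\<^sub>R g + k)"
    by (simp add: scaleR_diff_right)
  finally have "c *\<^sub>R u + v \<in> shift (c *\<^sub>R g + k)"
    using assms mem by (simp add: solves_def shift_def)
  moreover have "a (c *\<^sub>R u + v) h = c * l h + m h" if "h \<in> V\<^sub>0" for h
    using assms that mem in_V by (simp add: solves_def shift_def a.add_left a.scale_left)
  ultimately show ?thesis
    by (simp add: solves_def)
qed

text \<open>Testing with \<open>u - g\<close> gives \<open>a u u = a u g\<close>, so
  \<open>u\<close> has no larger \<open>a\<close>-seminorm than \<open>g\<close>. The
  \<open>b\<close>-part follows from the Poincare inequality for \<open>u - g\<close>, which costs
  the term with \<open>P\<close>.\<close>

lemma solves_zero_bound: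
  assumes g: "g \<in> V" and u: "solves (\<lambda>_. 0) g u"
  shows "N u \<le> (2 + 2 * P) * N g"
proof -
  have uV: "u \<in> V" and h: "u - g \<in> V\<^sub>0"
    using u by (auto simp: solves_def shift_def)
  have "a u u = a u g"
    using a.diff_right[OF uV g uV] u h by (simp add: solves_def)
  then have "(a.nrm u)\<^sup>2 \<le> a.nrm u * a.nrm g"
    using a.Cauchy_Schwarz[OF uV g] by (simp add: a.nrm_power2 uV)
  then have au: "a.nrm u \<le> a.nrm g"
    using a.nrm_nonneg[OF uV] a.nrm_nonneg[OF g] by (cases "a.nrm u = 0") (auto simp: power2_eq_square)
  have "b.nrm u \<le> b.nrm g + b.nrm (u - g)"
    using b.nrm_add[OF g in_V[OF h]] by simp
  also have "b.nrm (u - g) \<le> P * a.nrm (u - g)"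
    using poincare h by simp
  also have "\<dots> \<le> P * (a.nrm u + a.nrm g)"
    using a.nrm_diff[OF uV g] P by (intro mult_left_mono)
  also have "\<dots> \<le> P * (2 * a.nrm g)"
    using au P by (intro mult_left_mono) auto
  finally have "b.nrm u \<le> b.nrm g + P * (2 * a.nrm g)" by simp
  then have "N u \<le> a.nrm g + b.nrm g + P * (2 * a.nrm g)"
    using N_le_nrm[OF uV] au by simp
  also have "\<dots> \<le> N g + N g + P * (2 * N g)"
    using nrm_le_N[OF g] P by (intro add_mono mult_left_mono) auto
  finally show ?thesis by (simp add: algebra_simps)
qed

text \<open>The Poincare inequality makes the source term grow at most linearly in
  \<open>a.nrm w\<close>, with slope \<open>F * P\<close>; half the square of \<open>a.nrm w\<close>
  absorbs this up to \<open>(F * P)\<^sup>2 / 2\<close>.\<close>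

lemma J_bounded_below:
  assumes l: "functional l" and g: "g \<in> V"
  obtains m where "\<And>w. w \<in> shift g \<Longrightarrow> m \<le> J l w"
proof -
  obtain F where F: "F \<ge> 0" "\<And>x. x \<in> V \<Longrightarrow> \<bar>l x\<bar> \<le> F * b.nrm x"
    using l by (auto simp: functional_def)
  let ?D = "F * b.nrm g + F * P * a.nrm g"
  have "- ?D - (F * P)\<^sup>2 / 2 \<le> J l w" if w: "w \<in> shift g" for w
  proof -
    have wV: "w \<in> V" and h: "w - g \<in> V\<^sub>0"
      using w by (auto simp: shift_def)
    have "b.nrm w \<le> b.nrm g + b.nrm (w - g)"
      using b.nrm_add[OF g in_V[OF h]] by simp
    also have "b.nrm (w - g) \<le> P * a.nrm (w - g)"
      using poincare h by simp
    also have "\<dots> \<le> P * (a.nrm w + a.nrm g)"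
      using a.nrm_diff[OF wV g] P by (intro mult_left_mono)
    finally have "b.nrm w \<le> b.nrm g + P * (a.nrm w + a.nrm g)" by simp
    then have "F * b.nrm w \<le> F * (b.nrm g + P * (a.nrm w + a.nrm g))"
      using F by (intro mult_left_mono)
    then have "l w \<le> ?D + F * P * a.nrm w"
      using F(2)[OF wV] by (simp add: algebra_simps)
    moreover have "F * P * a.nrm w \<le> (a.nrm w)\<^sup>2 / 2 + (F * P)\<^sup>2 / 2"
      using zero_le_power2[of "a.nrm w - F * P"] by (simp add: power2_diff algebra_simps)
    ultimately show ?thesis
      by (simp add: J_def flip: a.nrm_power2[OF wV])
  qed
  then show ?thesis using that by blast
qed

lemma minimizer_exists:
  assumes l: "functional l" and g: "g \<in> V"
  shows "\<exists>u. minimizes_on (J l) (shift g) u"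
proof -
  obtain m0 where m0: "\<And>w. w \<in> shift g \<Longrightarrow> m0 \<le> J l w"
    using J_bounded_below[OF l g] by blast
  obtain F where F: "F \<ge> 0" "\<And>x. x \<in> V \<Longrightarrow> \<bar>l x\<bar> \<le> F * b.nrm x"
    using l by (auto simp: functional_def)
  have ll: "l (x - y) = l x - l y" if "x \<in> V" "y \<in> V" for x y
    using l linear_between_diff sub that unfolding functional_def by blast
  define m where "m = Inf (J l ` shift g)"
  have gc: "g \<in> shift g" using g mem_0 by (simp add: shift_def)
  have bdd: "bdd_below (J l ` shift g)"
    using m0 by (intro bdd_belowI[of _ m0]) auto
  have m: "m \<le> J l w" if "w \<in> shift g" for w
    unfolding m_def using bdd that by (intro cInf_lower) auto
  \<comment> \<open>The explicit gap to the infimum becomes the rate at which the minimizing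
    sequence is Cauchy.\<close>
  have "\<exists>w\<in>shift g. J l w < m + 1 / real (Suc n)" for n
    using cInf_lessD[of "J l ` shift g" "m + 1 / real (Suc n)"] gc by (auto simp: m_def)
  then obtain w where w: "\<And>n. w n \<in> shift g" "\<And>n. J l (w n) < m + 1 / real (Suc n)"
    by metis
  have wV: "w n \<in> V" for n using w(1)[of n] by (simp add: shift_def)
  have quad: "a (w i - w j) (w i - w j) \<le> 4 * (1 / real (Suc i) + 1 / real (Suc j))" for i j
  proof -
    let ?h = "w i - w j"
    have h: "?h \<in> V\<^sub>0" using shift_diff w by blast
    \<comment> \<open>parallelogram law\<close>
    have "8 * J l (w j + (1/2) *\<^sub>R ?h) = 4 * J l (w i) + 4 * J l (w j) - a ?h ?h"
      using J_add[OF l wV in_V[OF h], of j "1/2"] J_add[OF l wV in_V[OF h], of j 1]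
      by (simp add: power2_eq_square field_simps)
    moreover have "m \<le> J l (w j + (1/2) *\<^sub>R ?h)"
      using m shift_add[OF w(1) mem_0(5)[OF h]] by blast
    ultimately have "8 * m \<le> 4 * J l (w i) + 4 * J l (w j) - a ?h ?h"
      by simp
    moreover have "4 * J l (w i) < 4 * m + 4 * (1 / real (Suc i))" "4 * J l (w j) < 4 * m + 4 * (1 / real (Suc j))"
      using w(2)[of i] w(2)[of j] by simp_all
    ultimately show ?thesis by argo
  qed
  \<comment> \<open>Subadditivity of the square root splits the bound in \<open>quad\<close> into
    one summand for each index, as \<open>Cauchy_onI_bound\<close> wants it.\<close>
  define r where "r n = sqrt (4 / real (Suc n))" for n
  have r: "r \<longlonglongrightarrow> 0"
  proof -
    have "(\<lambda>n. sqrt (4 * (1 / real (Suc n)))) \<longlonglongrightarrow> sqrt (4 * 0)"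
      using LIMSEQ_inverse_real_of_nat by (intro tendsto_intros) (simp add: inverse_eq_divide)
    then show ?thesis by (simp add: r_def[abs_def])
  qed
  have aN: "a.nrm (w i - w j) \<le> r i + r j" for i j
  proof -
    have "a.nrm (w i - w j) \<le> sqrt (4 / real (Suc i) + 4 / real (Suc j))"
      unfolding a.nrm_def using quad[of i j] by (intro real_sqrt_le_mono) simp
    also have "\<dots> \<le> r i + r j"
      unfolding r_def by (rule sqrt_add_le_add_sqrt) auto
    finally show ?thesis .
  qed
  have "N (w i - w j) \<le> (P + 1) * r i + (P + 1) * r j" for i j
  proof -
    have h: "w i - w j \<in> V\<^sub>0" using shift_diff w by blast
    have "N (w i - w j) \<le> (P + 1) * a.nrm (w i - w j)"
      using N_le_nrm[OF in_V[OF h]] poincare[OF h] by (simp add: algebra_simps)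
    also have "\<dots> \<le> (P + 1) * (r i + r j)"
      using aN P by (intro mult_left_mono) auto
    finally show ?thesis by (simp add: algebra_simps)
  qed
  moreover have "(\<lambda>n. (P + 1) * r n) \<longlonglongrightarrow> 0"
    using tendsto_mult_left[OF r, of "P + 1"] by simp
  ultimately have "Cauchy_on N w"
    by (rule Cauchy_onI_bound)
  moreover have "range w \<subseteq> V" using wV by auto
  ultimately obtain u where u: "u \<in> V" "(\<lambda>n. N (w n - u)) \<longlonglongrightarrow> 0"
    using complete unfolding complete_on_def by blast
  have "u - g \<in> V\<^sub>0"
  proof (rule closed_0)
    show "range (\<lambda>n. w n - g) \<subseteq> V\<^sub>0" using w by (auto simp: shift_def)
    show "u - g \<in> V" using u g mem by simp
    show "(\<lambda>n. N (w n - g - (u - g))) \<longlonglongrightarrow> 0" using u by simp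
  qed
  then have uc: "u \<in> shift g" using u by (simp add: shift_def)
  have "(\<lambda>n. a.nrm (w n)) \<longlonglongrightarrow> a.nrm u"
  proof (rule metric_tendsto_imp_tendsto[OF u(2)])
    show "\<forall>\<^sub>F n in sequentially. dist (a.nrm (w n)) (a.nrm u) \<le> dist (N (w n - u)) 0"
      using a.nrm_triangle_ineq2[OF wV u(1)] nrm_le_N(1)[OF mem(3)[OF wV u(1)]]
      by (intro always_eventually) (force simp: dist_real_def norm_nonneg intro: order_trans)
  qed
  moreover have "(\<lambda>n. l (w n)) \<longlonglongrightarrow> l u"
  proof (rule metric_tendsto_imp_tendsto)
    show "(\<lambda>n. F * N (w n - u)) \<longlonglongrightarrow> 0"
      using tendsto_mult_left[OF u(2), of F] by simp
    have "\<bar>l (w n) - l u\<bar> \<le> F * N (w n - u)" for n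
    proof -
      have d: "w n - u \<in> V" using wV u mem by simp
      have "\<bar>l (w n) - l u\<bar> \<le> F * b.nrm (w n - u)"
        using F(2)[OF d] ll[OF wV u(1)] by simp
      also have "\<dots> \<le> F * N (w n - u)"
        using nrm_le_N(2)[OF d] F by (intro mult_left_mono)
      finally show ?thesis .
    qed
    then show "\<forall>\<^sub>F n in sequentially. dist (l (w n)) (l u) \<le> dist (F * N (w n - u)) 0"
      using F by (intro always_eventually) (simp add: dist_real_def norm_nonneg)
  qed
  ultimately have "(\<lambda>n. 1 / 2 * (a.nrm (w n))\<^sup>2 - l (w n)) \<longlonglongrightarrow> 1 / 2 * (a.nrm u)\<^sup>2 - l u"
    by (intro tendsto_intros)
  then have "(\<lambda>n. J l (w n)) \<longlonglongrightarrow> J l u"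
    by (simp add: J_def a.nrm_power2 wV u)
  moreover have "(\<lambda>n. m + 1 / real (Suc n)) \<longlonglongrightarrow> m + 0"
    using LIMSEQ_inverse_real_of_nat by (intro tendsto_intros) (simp add: inverse_eq_divide)
  ultimately have "J l u \<le> m"
    using LIMSEQ_le[of "\<lambda>n. J l (w n)" "J l u" "\<lambda>n. m + 1 / real (Suc n)" m] w(2)
    by (fastforce intro: less_imp_le)
  then have "minimizes_on (J l) (shift g) u"
    using uc m unfolding minimizes_on_def by fastforce
  then show ?thesis by blast
qed

lemma ex1_minimizer:
  assumes "functional l" "g \<in> V"
  shows "\<exists>!u. minimizes_on (J l) (shift g) u"
  using minimizer_exists[OF assms] minimizes_iff_solves[OF assms(1)] solves_unique by blast

end

section \<open>Square integrable functions\<close>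

text \<open>Measurability is stated separately because it does not follow from that of the square:
  the sign may be wild.\<close>

definition sq_integrable :: "'a measure \<Rightarrow> ('a \<Rightarrow> real) \<Rightarrow> bool" where
  "sq_integrable M f \<longleftrightarrow> f \<in> borel_measurable M \<and> integrable M (\<lambda>x. (f x)\<^sup>2)"

lemma sq_integrable_mult:
  assumes "sq_integrable M f" "sq_integrable M g"
  shows "integrable M (\<lambda>x. f x * g x)"
proof (rule Bochner_Integration.integrable_bound)
  show "integrable M (\<lambda>x. (f x)\<^sup>2 + (g x)\<^sup>2)"
    using assms by (simp add: sq_integrable_def)
  show "(\<lambda>x. f x * g x) \<in> borel_measurable M"
    using assms by (intro borel_measurable_times) (auto simp: sq_integrable_def)
  have "\<bar>f x * g x\<bar> \<le> (f x)\<^sup>2 + (g x)\<^sup>2" for x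
  proof -
    have "2 * (\<bar>f x\<bar> * \<bar>g x\<bar>) \<le> (f x)\<^sup>2 + (g x)\<^sup>2"
      using sum_squares_bound[of "\<bar>f x\<bar>" "\<bar>g x\<bar>"] by simp
    moreover have "0 \<le> \<bar>f x\<bar> * \<bar>g x\<bar>" by simp
    ultimately show ?thesis unfolding abs_mult by linarith
  qed
  then have "norm (f x * g x) \<le> norm ((f x)\<^sup>2 + (g x)\<^sup>2)" for x
    unfolding real_norm_def by (rule order_trans[OF _ abs_ge_self])
  then show "AE x in M. norm (f x * g x) \<le> norm ((f x)\<^sup>2 + (g x)\<^sup>2)"
    by (rule AE_I2)
qed

lemma sq_integrable_scale: "sq_integrable M f \<Longrightarrow> sq_integrable M (\<lambda>x. c * f x)"
  by (auto simp: sq_integrable_def power_mult_distrib intro: borel_measurable_times)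

lemma sq_integrable_add:
  assumes "sq_integrable M f" "sq_integrable M g"
  shows "sq_integrable M (\<lambda>x. f x + g x)"
  using assms sq_integrable_mult[OF assms]
  by (auto simp: sq_integrable_def power2_sum mult.assoc intro: borel_measurable_add)

lemma sq_integrable_diff:
  assumes "sq_integrable M f" "sq_integrable M g"
  shows "sq_integrable M (\<lambda>x. f x - g x)"
  using sq_integrable_add[OF assms(1) sq_integrable_scale[OF assms(2), of "-1"]] by simp

lemma sq_integrable_cong_AE:
  assumes "AE x in M. f x = g x" "f \<in> borel_measurable M" "g \<in> borel_measurable M"
  shows "sq_integrable M f \<longleftrightarrow> sq_integrable M g"
proof -
  have "AE x in M. (f x)\<^sup>2 = (g x)\<^sup>2"
    using assms(1) by eventually_elim simp
  then have "integrable M (\<lambda>x. (f x)\<^sup>2) \<longleftrightarrow> integrable M (\<lambda>x. (g x)\<^sup>2)"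
    using assms(2,3) by (intro integrable_cong_AE borel_measurable_power)
  then show ?thesis
    using assms(2,3) by (simp add: sq_integrable_def)
qed

section \<open>The Riesz-Fischer theorem for functions on an arbitrary measure space\<close>

definition L2_Cauchy :: "'a measure \<Rightarrow> (nat \<Rightarrow> 'a \<Rightarrow> real) \<Rightarrow> bool" where
  "L2_Cauchy M F \<longleftrightarrow> (\<forall>e>0. \<exists>K. \<forall>m\<ge>K. \<forall>n\<ge>K. (LINT x|M. (F m x - F n x)\<^sup>2) < e)"

text \<open>Along a subsequence with rapidly decaying increments the telescoping series converges
  absolutely almost everywhere. The measure is arbitrary, so that the result serves Lebesgue
  measure, the border measure and the product of the latter with itself.\<close>

lemma L2_Cauchy_AE_limit:
  assumes sq: "\<And>n. sq_integrable M (F n)" and cauchy: "L2_Cauchy M F"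
  obtains r :: "nat \<Rightarrow> nat" where "strict_mono r" "AE x in M. (\<lambda>k. F (r k) x) \<longlonglongrightarrow> lim (\<lambda>k. F (r k) x)"
proof -
  have "\<forall>k. \<exists>K. \<forall>m\<ge>K. \<forall>n\<ge>K. (LINT x|M. (F m x - F n x)\<^sup>2) < (1/4) ^ k"
    using cauchy unfolding L2_Cauchy_def by simp
  then obtain K where K: "\<And>k m n. m \<ge> K k \<Longrightarrow> n \<ge> K k \<Longrightarrow> (LINT x|M. (F m x - F n x)\<^sup>2) < (1/4) ^ k"
    by metis
  \<comment> \<open>The sum dominates \<open>K k\<close>, and the successors make it strictly
    increasing.\<close>
  define r where "r k = (\<Sum>j\<le>k. Suc (K j))" for k
  have r: "strict_mono r"
    by (rule strict_monoI_Suc) (simp add: r_def)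
  have rK: "K k \<le> r k" for k
    using member_le_sum[of k "{..k}" "\<lambda>j. Suc (K j)"] by (simp add: r_def)
  define d where "d k x = F (r (Suc k)) x - F (r k) x" for k x
  have d: "sq_integrable M (d k)" for k
    unfolding d_def by (intro sq_integrable_diff sq)
  have [measurable]: "d k \<in> borel_measurable M" for k
    using d by (simp add: sq_integrable_def)
  have d_int: "(LINT x|M. (d k x)\<^sup>2) \<le> (1/4) ^ k" for k
    unfolding d_def using K[of k "r (Suc k)" "r k"] rK[of k] rK[of "Suc k"] strict_monoD[OF r, of k "Suc k"]
    by (intro less_imp_le[OF K]) auto
  \<comment> \<open>The weight \<open>2 ^ k\<close> is a compromise: against the decay
    \<open>(1/4) ^ k\<close> it leaves a summable series, and it is large enough to bound
    \<open>\<bar>d k x\<bar>\<close> itself, not only its square.\<close>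
  have "(\<integral>\<^sup>+x. (\<Sum>k. ennreal (2 ^ k * (d k x)\<^sup>2)) \<partial>M) = (\<Sum>k. \<integral>\<^sup>+x. ennreal (2 ^ k * (d k x)\<^sup>2) \<partial>M)"
    by (intro nn_integral_suminf) auto
  also have "\<dots> \<le> (\<Sum>k. ennreal ((1/2) ^ k))"
  proof (intro suminf_le summableI)
    fix k
    have "(\<integral>\<^sup>+x. ennreal (2 ^ k * (d k x)\<^sup>2) \<partial>M) = ennreal (LINT x|M. 2 ^ k * (d k x)\<^sup>2)"
      using d[of k] by (intro nn_integral_eq_integral) (auto simp: sq_integrable_def)
    also have "(LINT x|M. 2 ^ k * (d k x)\<^sup>2) \<le> 2 ^ k * (1/4) ^ k"
      using d_int[of k] by simp
    also have "\<dots> = (1/2::real) ^ k"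
      by (simp flip: power_mult_distrib)
    finally show "(\<integral>\<^sup>+x. ennreal (2 ^ k * (d k x)\<^sup>2) \<partial>M) \<le> ennreal ((1/2) ^ k)"
      by (simp add: ennreal_leI)
  qed
  also have "\<dots> = ennreal (\<Sum>k. (1/2) ^ k)"
    by (intro suminf_ennreal2 summable_geometric) auto
  also have "\<dots> < \<infinity>" by simp
  finally have fin: "AE x in M. (\<Sum>k. ennreal (2 ^ k * (d k x)\<^sup>2)) \<noteq> \<infinity>"
    by (intro nn_integral_noteq_infinite) auto
  have "(\<lambda>k. F (r k) x) \<longlonglongrightarrow> lim (\<lambda>k. F (r k) x)" if "(\<Sum>k. ennreal (2 ^ k * (d k x)\<^sup>2)) \<noteq> \<infinity>" for x
  proof -
    have s: "summable (\<lambda>k. 2 ^ k * (d k x)\<^sup>2)"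
      using that by (intro summable_suminf_not_top) auto
    have "summable (\<lambda>k. d k x)"
    proof (rule summable_comparison_test')
      show "summable (\<lambda>k. (1/2) ^ k + 2 ^ k * (d k x)\<^sup>2)"
        by (intro summable_add s summable_geometric) simp
      fix k :: nat
      \<comment> \<open>AM-GM\<close>
      have "2 * \<bar>d k x\<bar> \<le> (1/2) ^ k + 2 ^ k * (d k x)\<^sup>2"
      proof -
        have "0 \<le> 2 ^ k * (\<bar>d k x\<bar> - (1/2) ^ k)\<^sup>2" by simp
        also have "\<dots> = 2 ^ k * (d k x)\<^sup>2 - 2 * \<bar>d k x\<bar> + (1/2) ^ k"
          by (simp add: power2_eq_square algebra_simps power_divide)
        finally show ?thesis by simp
      qed
      then show "norm (d k x) \<le> (1/2) ^ k + 2 ^ k * (d k x)\<^sup>2" by simp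
    qed
    then have "convergent (\<lambda>k. \<Sum>j<k. d j x)"
      by (simp add: summable_iff_convergent)
    moreover have "(\<Sum>j<k. d j x) = F (r k) x - F (r 0) x" for k
      unfolding d_def by (rule sum_lessThan_telescope)
    ultimately have "convergent (\<lambda>k. F (r k) x - F (r 0) x)" by simp
    then have "convergent (\<lambda>k. (F (r k) x - F (r 0) x) + F (r 0) x)"
      by (intro convergent_add convergent_const)
    then show ?thesis
      by (simp add: convergent_LIMSEQ_iff)
  qed
  then have "AE x in M. (\<lambda>k. F (r k) x) \<longlonglongrightarrow> lim (\<lambda>k. F (r k) x)"
    using fin by (auto elim: eventually_mono)
  then show ?thesis
    using that r by blast
qed

text \<open>Fatou's lemma along the subsequence, with the other index fixed. The limit
  \<open>f\<close> is a parameter because on the square of the border it is not taken as a new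
  limit: it is the difference quotient of the limit found on the border.\<close>

lemma L2_Cauchy_limit:
  assumes sq: "\<And>n. sq_integrable M (F n)" and cauchy: "L2_Cauchy M F"
    and r: "strict_mono (r :: nat \<Rightarrow> nat)" and f: "f \<in> borel_measurable M"
    and lim: "AE x in M. (\<lambda>k. F (r k) x) \<longlonglongrightarrow> f x"
  shows "sq_integrable M f" "(\<lambda>n. LINT x|M. (F n x - f x)\<^sup>2) \<longlonglongrightarrow> 0"
proof -
  have [measurable]: "F n \<in> borel_measurable M" "f \<in> borel_measurable M" for n
    using sq f by (auto simp: sq_integrable_def)
  have bound: "(\<integral>\<^sup>+x. ennreal ((F n x - f x)\<^sup>2) \<partial>M) \<le> ennreal e"
    if K: "\<And>m n. m \<ge> K \<Longrightarrow> n \<ge> K \<Longrightarrow> (LINT x|M. (F m x - F n x)\<^sup>2) < e" and n: "n \<ge> K" for K n e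
  proof -
    have "(\<integral>\<^sup>+x. ennreal ((F n x - f x)\<^sup>2) \<partial>M)
        \<le> (\<integral>\<^sup>+x. liminf (\<lambda>k. ennreal ((F n x - F (r k) x)\<^sup>2)) \<partial>M)"
    proof (rule nn_integral_mono_AE, use lim in eventually_elim)
      fix x assume "(\<lambda>k. F (r k) x) \<longlonglongrightarrow> f x"
      then have "(\<lambda>k. ennreal ((F n x - F (r k) x)\<^sup>2)) \<longlonglongrightarrow> ennreal ((F n x - f x)\<^sup>2)"
        by (intro tendsto_intros tendsto_ennrealI)
      then show "ennreal ((F n x - f x)\<^sup>2) \<le> liminf (\<lambda>k. ennreal ((F n x - F (r k) x)\<^sup>2))"
        using lim_imp_Liminf[OF sequentially_bot] by fastforce
    qed
    also have "\<dots> \<le> liminf (\<lambda>k. \<integral>\<^sup>+x. ennreal ((F n x - F (r k) x)\<^sup>2) \<partial>M)"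
      by (intro nn_integral_liminf) auto
    also have "\<dots> \<le> ennreal e"
    proof (rule Liminf_le)
      show "\<forall>\<^sub>F k in sequentially. (\<integral>\<^sup>+x. ennreal ((F n x - F (r k) x)\<^sup>2) \<partial>M) \<le> ennreal e"
        unfolding eventually_sequentially
      proof (intro exI[of _ K] allI impI)
        fix k assume "K \<le> k"
        then have "K \<le> r k" using seq_suble[OF r, of k] by simp
        then have "(LINT x|M. (F n x - F (r k) x)\<^sup>2) < e" using K n by simp
        moreover have "(\<integral>\<^sup>+x. ennreal ((F n x - F (r k) x)\<^sup>2) \<partial>M) = ennreal (LINT x|M. (F n x - F (r k) x)\<^sup>2)"
          using sq_integrable_diff[OF sq sq] by (intro nn_integral_eq_integral) (auto simp: sq_integrable_def)
        ultimately show "(\<integral>\<^sup>+x. ennreal ((F n x - F (r k) x)\<^sup>2) \<partial>M) \<le> ennreal e"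
          by (simp add: ennreal_leI)
      qed
    qed simp
    finally show ?thesis .
  qed
  have int: "integrable M (\<lambda>x. (F n x - f x)\<^sup>2)" "(LINT x|M. (F n x - f x)\<^sup>2) \<le> e"
    if K: "\<And>m n. m \<ge> K \<Longrightarrow> n \<ge> K \<Longrightarrow> (LINT x|M. (F m x - F n x)\<^sup>2) < e" and n: "n \<ge> K" and e: "e > 0" for K n e
  proof -
    have *: "(\<integral>\<^sup>+x. ennreal ((F n x - f x)\<^sup>2) \<partial>M) \<le> ennreal e"
      using K n by (rule bound)
    then show i: "integrable M (\<lambda>x. (F n x - f x)\<^sup>2)"
      by (intro integrableI_bounded) (auto intro: le_less_trans)
    then show "(LINT x|M. (F n x - f x)\<^sup>2) \<le> e"
      using * nn_integral_eq_integral[OF i] e by simp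
  qed
  obtain K where K: "\<And>m n. m \<ge> K \<Longrightarrow> n \<ge> K \<Longrightarrow> (LINT x|M. (F m x - F n x)\<^sup>2) < 1"
    using cauchy unfolding L2_Cauchy_def by (metis zero_less_one)
  \<comment> \<open>Square integrability of \<open>f\<close> is inherited from that of a single
    difference, subtracted from \<open>F K\<close>.\<close>
  have "sq_integrable M (\<lambda>x. F K x - f x)"
    using int(1)[OF K, of K] by (simp add: sq_integrable_def)
  then have "sq_integrable M (\<lambda>x. F K x - (F K x - f x))"
    by (rule sq_integrable_diff[OF sq])
  then show "sq_integrable M f" by simp
  show "(\<lambda>n. LINT x|M. (F n x - f x)\<^sup>2) \<longlonglongrightarrow> 0"
  proof (rule LIMSEQ_I)
    fix e :: real assume "e > 0"
    then obtain K where K: "\<And>m n. m \<ge> K \<Longrightarrow> n \<ge> K \<Longrightarrow> (LINT x|M. (F m x - F n x)\<^sup>2) < e / 2"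
      using cauchy unfolding L2_Cauchy_def by (metis half_gt_zero)
    have "norm ((LINT x|M. (F n x - f x)\<^sup>2) - 0) < e" if "n \<ge> K" for n
      using int(2)[OF K that] \<open>e > 0\<close> by simp
    then show "\<exists>K. \<forall>n\<ge>K. norm ((LINT x|M. (F n x - f x)\<^sup>2) - 0) < e" by blast
  qed
qed

section \<open>The space \<open>L2\<close>\<close>

lemma rep_lebfun_measurable [measurable]: "rep_lebfun u \<in> borel_measurable borel"
  using Quotient3_rep_reflp[OF Quotient3_lebfun, of u] by (simp add: ae_rel_def)

lemma rep_abs_lebfun: "f \<in> borel_measurable borel \<Longrightarrow> AE x in lborel. rep_lebfun (abs_lebfun f) x = f x"
  using Quotient3_rep_abs[OF Quotient3_lebfun, of f] by (simp add: ae_rel_def)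

lemma lebfun_eqI: "AE x in lborel. rep_lebfun u x = rep_lebfun v x \<Longrightarrow> u = v"
  using Quotient3_rel_rep[OF Quotient3_lebfun, of u v] by (simp add: ae_rel_def)

lemma rep_lebfun_add: "AE x in lborel. rep_lebfun (u + v) x = rep_lebfun u x + rep_lebfun v x"
  unfolding plus_lebfun_def map_fun_def comp_def by (rule rep_abs_lebfun) measurable

lemma rep_lebfun_diff: "AE x in lborel. rep_lebfun (u - v) x = rep_lebfun u x - rep_lebfun v x"
  unfolding minus_lebfun_def map_fun_def comp_def by (rule rep_abs_lebfun) measurable

lemma rep_lebfun_scaleR: "AE x in lborel. rep_lebfun (c *\<^sub>R u) x = c * rep_lebfun u x"
  unfolding scaleR_lebfun_def map_fun_def comp_def id_def by (rule rep_abs_lebfun) measurable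

lemma rep_lebfun_zero: "AE x in lborel. rep_lebfun 0 x = 0"
  unfolding zero_lebfun_def by (rule rep_abs_lebfun) measurable

context
  fixes \<Omega> :: "(real^'n::finite) set"
  assumes \<Omega>: "open \<Omega>"
begin

lemma open_measurable: "\<Omega> \<in> sets borel"
  using \<Omega> by simp

lemma set_integral_eq_lborel:
  assumes "AE x in lborel. x \<notin> \<Omega> \<longrightarrow> f x = (0::real)" "f \<in> borel_measurable borel"
  shows "(LINT x:\<Omega>|lborel. f x) = (LINT x|lborel. f x)"
  unfolding set_lebesgue_integral_def using assms open_measurable
  by (intro integral_cong_AE) (auto elim!: eventually_mono simp: indicator_def)

lemma L2_iff:
  "u \<in> L2 \<Omega> \<longleftrightarrow> sq_integrable lborel (rep_lebfun u) \<and> (AE x in lborel. x \<notin> \<Omega> \<longrightarrow> rep_lebfun u x = 0)"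
proof -
  have "set_integrable lborel \<Omega> (\<lambda>x. (rep_lebfun u x)\<^sup>2) \<longleftrightarrow> integrable lborel (\<lambda>x. (rep_lebfun u x)\<^sup>2)"
    if "AE x in lborel. x \<notin> \<Omega> \<longrightarrow> rep_lebfun u x = 0"
    unfolding set_integrable_def using that open_measurable
    by (intro integrable_cong_AE) (auto elim!: eventually_mono simp: indicator_def)
  then show ?thesis
    by (auto simp: L2_def sq_integrable_def)
qed

lemma L2_sq_integrable: "u \<in> L2 \<Omega> \<Longrightarrow> sq_integrable lborel (rep_lebfun u)"
  by (simp add: L2_iff)

lemma inner_2_eq:
  assumes "u \<in> L2 \<Omega>"
  shows "inner_2 \<Omega> u v = (LINT x|lborel. rep_lebfun u x * rep_lebfun v x)"
    "inner_2 \<Omega> v u = (LINT x|lborel. rep_lebfun v x * rep_lebfun u x)"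
  unfolding inner_2_def using assms
  by (auto simp: L2_iff elim!: eventually_mono intro!: set_integral_eq_lborel)

lemma subspace_L2: "subspace (L2 \<Omega>)"
  unfolding subspace_def
proof (intro conjI ballI allI)
  show "0 \<in> L2 \<Omega>"
    using rep_lebfun_zero sq_integrable_cong_AE[OF rep_lebfun_zero]
    by (auto simp: L2_iff sq_integrable_def elim!: eventually_mono)
next
  fix u v assume "u \<in> L2 \<Omega>" "v \<in> L2 \<Omega>"
  then have *: "sq_integrable lborel (\<lambda>x. rep_lebfun u x + rep_lebfun v x)"
    "AE x in lborel. x \<notin> \<Omega> \<longrightarrow> rep_lebfun u x + rep_lebfun v x = 0"
    by (auto simp: L2_iff elim: eventually_elim2 intro: sq_integrable_add)
  show "u + v \<in> L2 \<Omega>"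
    unfolding L2_iff
  proof
    show "sq_integrable lborel (rep_lebfun (u + v))"
      using * by (subst sq_integrable_cong_AE[OF rep_lebfun_add]) auto
    show "AE x in lborel. x \<notin> \<Omega> \<longrightarrow> rep_lebfun (u + v) x = 0"
      using rep_lebfun_add[of u v] *(2) by eventually_elim simp
  qed
next
  fix u and c :: real assume "u \<in> L2 \<Omega>"
  then have *: "sq_integrable lborel (\<lambda>x. c * rep_lebfun u x)"
    "AE x in lborel. x \<notin> \<Omega> \<longrightarrow> c * rep_lebfun u x = 0"
    by (auto simp: L2_iff elim: eventually_mono intro: sq_integrable_scale)
  show "c *\<^sub>R u \<in> L2 \<Omega>"
    unfolding L2_iff
  proof
    show "sq_integrable lborel (rep_lebfun (c *\<^sub>R u))"
      using * by (subst sq_integrable_cong_AE[OF rep_lebfun_scaleR]) auto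
    show "AE x in lborel. x \<notin> \<Omega> \<longrightarrow> rep_lebfun (c *\<^sub>R u) x = 0"
      using rep_lebfun_scaleR[of c u] *(2) by eventually_elim simp
  qed
qed

lemma semi_inner_on_L2: "semi_inner_on (L2 \<Omega>) (inner_2 \<Omega>)"
proof
  show "subspace (L2 \<Omega>)" by (rule subspace_L2)
  show "inner_2 \<Omega> x y = inner_2 \<Omega> y x" for x y
    by (simp add: inner_2_def mult.commute)
  show "inner_2 \<Omega> (x + y) z = inner_2 \<Omega> x z + inner_2 \<Omega> y z"
    if "x \<in> L2 \<Omega>" "y \<in> L2 \<Omega>" "z \<in> L2 \<Omega>" for x y z
  proof -
    have "inner_2 \<Omega> (x + y) z = (LINT t|lborel. rep_lebfun x t * rep_lebfun z t + rep_lebfun y t * rep_lebfun z t)"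
      unfolding inner_2_eq(2)[OF that(3)]
      using rep_lebfun_add[of x y] by (intro integral_cong_AE) (auto elim!: eventually_mono simp: algebra_simps)
    also have "\<dots> = inner_2 \<Omega> x z + inner_2 \<Omega> y z"
      unfolding inner_2_eq(2)[OF that(3)]
      using that by (intro Bochner_Integration.integral_add sq_integrable_mult L2_sq_integrable)
    finally show ?thesis .
  qed
  show "inner_2 \<Omega> (c *\<^sub>R x) y = c * inner_2 \<Omega> x y"
    if "x \<in> L2 \<Omega>" "y \<in> L2 \<Omega>" for x y c
  proof -
    have "inner_2 \<Omega> (c *\<^sub>R x) y = (LINT t|lborel. c * (rep_lebfun x t * rep_lebfun y t))"
      unfolding inner_2_eq(2)[OF that(2)]
      using rep_lebfun_scaleR[of c x] by (intro integral_cong_AE) (auto elim!: eventually_mono simp: algebra_simps)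
    then show ?thesis
      unfolding inner_2_eq(2)[OF that(2)] by simp
  qed
  show "0 \<le> inner_2 \<Omega> x x" for x
    by (simp add: inner_2_def set_lebesgue_integral_def)
qed

lemma inner_2_definite:
  assumes u: "u \<in> L2 \<Omega>" and 0: "inner_2 \<Omega> u u = 0"
  shows "u = 0"
proof -
  have "AE x in lborel. (rep_lebfun u x)\<^sup>2 = 0"
    using L2_sq_integrable[OF u] 0 integral_nonneg_eq_0_iff_AE[of lborel "\<lambda>x. (rep_lebfun u x)\<^sup>2"]
    by (simp add: inner_2_eq(1)[OF u] sq_integrable_def power2_eq_square)
  then have "AE x in lborel. rep_lebfun u x = rep_lebfun 0 x"
    using rep_lebfun_zero by eventually_elim simp
  then show ?thesis by (rule lebfun_eqI)
qed

lemma inner_2_diff_self: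
  assumes "u \<in> L2 \<Omega>" "v \<in> L2 \<Omega>"
  shows "inner_2 \<Omega> (u - v) (u - v) = (LINT x|lborel. (rep_lebfun u x - rep_lebfun v x)\<^sup>2)"
  unfolding inner_2_eq(1)[OF subspace_diff[OF subspace_L2 assms]]
  using rep_lebfun_diff[of u v]
  by (intro integral_cong_AE) (auto elim!: eventually_mono simp: power2_eq_square)

theorem complete_L2: "complete_on (L2 \<Omega>) (\<lambda>u. sqrt (inner_2 \<Omega> u u))"
  unfolding complete_on_def
proof (intro allI impI; elim conjE)
  fix \<sigma> :: "nat \<Rightarrow> 'n lebfun"
  assume ran: "range \<sigma> \<subseteq> L2 \<Omega>" and C: "Cauchy_on (\<lambda>u. sqrt (inner_2 \<Omega> u u)) \<sigma>"
  have L: "\<sigma> n \<in> L2 \<Omega>" for n using ran by auto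
  let ?F = "\<lambda>n. rep_lebfun (\<sigma> n)"
  have sq: "sq_integrable lborel (?F n)" for n using L by (rule L2_sq_integrable)
  have cauchy: "L2_Cauchy lborel ?F"
    unfolding L2_Cauchy_def
  proof (intro allI impI)
    fix e :: real assume "e > 0"
    then obtain K where "\<And>m n. m \<ge> K \<Longrightarrow> n \<ge> K \<Longrightarrow> sqrt (inner_2 \<Omega> (\<sigma> m - \<sigma> n) (\<sigma> m - \<sigma> n)) < sqrt e"
      using C unfolding Cauchy_on_def by (metis real_sqrt_gt_0_iff)
    then show "\<exists>K. \<forall>m\<ge>K. \<forall>n\<ge>K. (LINT x|lborel. (?F m x - ?F n x)\<^sup>2) < e"
      using inner_2_diff_self[OF L L] by auto
  qed
  obtain r where r: "strict_mono r" "AE x in lborel. (\<lambda>k. ?F (r k) x) \<longlonglongrightarrow> lim (\<lambda>k. ?F (r k) x)"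
    using L2_Cauchy_AE_limit[OF sq cauchy] by blast
  let ?f = "\<lambda>x. lim (\<lambda>k. ?F (r k) x)"
  have f: "?f \<in> borel_measurable borel" by measurable
  then have f': "?f \<in> borel_measurable lborel" by simp
  note l = L2_Cauchy_limit[OF sq cauchy r(1) f' r(2)]
  let ?u = "abs_lebfun ?f"
  have u: "?u \<in> L2 \<Omega>"
    unfolding L2_iff
  proof
    show "sq_integrable lborel (rep_lebfun ?u)"
      using l(1) f by (subst sq_integrable_cong_AE[OF rep_abs_lebfun]) auto
    \<comment> \<open>One null set serves all indices; outside it and outside
      \<open>\<Omega>\<close> the sequence is constantly 0, and so is its limit.\<close>
    have "AE x in lborel. \<forall>n. x \<notin> \<Omega> \<longrightarrow> ?F n x = 0"
      unfolding AE_all_countable using L by (simp add: L2_iff)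
    then show "AE x in lborel. x \<notin> \<Omega> \<longrightarrow> rep_lebfun ?u x = 0"
      using rep_abs_lebfun[OF f] by eventually_elim simp
  qed
  have "inner_2 \<Omega> (\<sigma> n - ?u) (\<sigma> n - ?u) = (LINT x|lborel. (?F n x - ?f x)\<^sup>2)" for n
    unfolding inner_2_diff_self[OF L u]
    using rep_abs_lebfun[OF f] f by (intro integral_cong_AE) (auto elim!: eventually_mono)
  then have "(\<lambda>n. sqrt (inner_2 \<Omega> (\<sigma> n - ?u) (\<sigma> n - ?u))) \<longlonglongrightarrow> sqrt 0"
    using tendsto_real_sqrt[OF l(2)] by simp
  then show "\<exists>l\<in>L2 \<Omega>. (\<lambda>n. sqrt (inner_2 \<Omega> (\<sigma> n - l) (\<sigma> n - l))) \<longlonglongrightarrow> 0"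
    using u by auto
qed

end

section \<open>Completeness of the border space\<close>

text \<open>Without \<open>\<sigma>\<close>-finiteness the product measure may degenerate to \<open>0\<close>;
  the strips over a null set are null sets in either case.\<close>

lemma AE_pair_measure_self:
  assumes "AE x in M. Q x"
  shows "AE z in M \<Otimes>\<^sub>M M. Q (fst z) \<and> Q (snd z)"
proof -
  obtain N where N: "N \<in> null_sets M" "{x \<in> space M. \<not> Q x} \<subseteq> N"
    using assms by (auto simp: eventually_ae_filter)
  have Ns [measurable]: "N \<in> sets M" and N0: "emeasure M N = 0"
    using N by auto
  have AE_N: "AE x in M. x \<notin> N"
    using N(1) by (rule AE_not_in)
  have "emeasure (M \<Otimes>\<^sub>M M) (N \<times> space M) = 0"
  proof -
    have "(\<integral>\<^sup>+x. (\<integral>\<^sup>+y. indicator (N \<times> space M) (x, y) \<partial>M) \<partial>M) = (\<integral>\<^sup>+x. 0 \<partial>M)"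
      using AE_N by (intro nn_integral_cong_AE) (auto elim!: eventually_mono simp: indicator_def)
    then show ?thesis
      unfolding pair_measure_def by (subst emeasure_measure_of_conv) simp
  qed
  moreover have "emeasure (M \<Otimes>\<^sub>M M) (space M \<times> N) = 0"
  proof -
    have "(\<integral>\<^sup>+y. indicator (space M \<times> N) (x, y) \<partial>M) = (\<integral>\<^sup>+y. 0 \<partial>M)" for x
      using AE_N by (intro nn_integral_cong_AE) (auto elim!: eventually_mono simp: indicator_def)
    then show ?thesis
      unfolding pair_measure_def by (subst emeasure_measure_of_conv) simp
  qed
  ultimately have "N \<times> space M \<union> space M \<times> N \<in> null_sets (M \<Otimes>\<^sub>M M)"
    by (intro null_sets.Un) (auto simp: null_sets_def)
  moreover have "{z \<in> space (M \<Otimes>\<^sub>M M). \<not> (Q (fst z) \<and> Q (snd z))} \<subseteq> N \<times> space M \<union> space M \<times> N"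
    using N(2) by (auto simp: space_pair_measure)
  ultimately show ?thesis
    by (auto simp: eventually_ae_filter)
qed

section \<open>Functions on the border modulo null sets, and their norm\<close>

definition border_hausdorff :: "(real^'n::finite) measure" where
  "border_hausdorff = hausdorff_measure (CARD('n) - 1)"

lemma sets_hausdorff_measure [measurable_cong]: "sets (hausdorff_measure s) = sets borel"
  unfolding hausdorff_measure_def using sets.sigma_sets_eq[of borel] by (simp add: sets_measure_of_conv)

lemma space_hausdorff_measure: "space (hausdorff_measure s) = UNIV"
  unfolding hausdorff_measure_def by (simp add: space_measure_of_conv)

lemma borel_measurable_hausdorff: "f \<in> borel_measurable borel \<Longrightarrow> f \<in> borel_measurable (hausdorff_measure s)"
  using measurable_cong_sets[OF sets_hausdorff_measure refl] by blast

lemma rep_bdrfun_measurable [measurable]: "rep_bdrfun u \<in> borel_measurable borel"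
  using Quotient3_rep_reflp[OF Quotient3_bdrfun, of u] by (simp add: ae_rel_def)

lemma rep_abs_bdrfun:
  fixes f :: "real^'n::finite \<Rightarrow> real"
  shows "f \<in> borel_measurable borel \<Longrightarrow> AE x in border_hausdorff. rep_bdrfun (abs_bdrfun f) x = f x"
  using Quotient3_rep_abs[OF Quotient3_bdrfun, of f] unfolding ae_rel_def border_hausdorff_def by blast

lemma bdrfun_eqI:
  fixes u v :: "'n::finite bdrfun"
  shows "AE x in border_hausdorff. rep_bdrfun u x = rep_bdrfun v x \<Longrightarrow> u = v"
  using Quotient3_rel_rep[OF Quotient3_bdrfun, of u v]
  unfolding ae_rel_def border_hausdorff_def by auto

lemma rep_bdrfun_add:
  fixes u v :: "'n::finite bdrfun"
  shows "AE x in border_hausdorff. rep_bdrfun (u + v) x = rep_bdrfun u x + rep_bdrfun v x"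
  unfolding plus_bdrfun_def map_fun_def comp_def by (rule rep_abs_bdrfun) measurable

lemma rep_bdrfun_diff:
  fixes u v :: "'n::finite bdrfun"
  shows "AE x in border_hausdorff. rep_bdrfun (u - v) x = rep_bdrfun u x - rep_bdrfun v x"
  unfolding minus_bdrfun_def map_fun_def comp_def by (rule rep_abs_bdrfun) measurable

lemma rep_bdrfun_scaleR:
  fixes u :: "'n::finite bdrfun"
  shows "AE x in border_hausdorff. rep_bdrfun (c *\<^sub>R u) x = c * rep_bdrfun u x"
  unfolding scaleR_bdrfun_def map_fun_def comp_def id_def by (rule rep_abs_bdrfun) measurable

lemma rep_bdrfun_zero: "AE x in border_hausdorff. rep_bdrfun (0 :: 'n::finite bdrfun) x = 0"
  unfolding zero_bdrfun_def by (rule rep_abs_bdrfun) measurable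

text \<open>A signed square root of the Slobodeckij quotient. It is linear in \<open>f\<close>, so
  the seminorm becomes the L2 norm of \<open>quot_root f\<close> and gets an inner product. On the
  diagonal, division by 0 yields the value 0 as in \<open>slobodeckij_quot\<close>.\<close>

definition quot_root :: "(real^'n::finite \<Rightarrow> real) \<Rightarrow> (real^'n) \<times> (real^'n) \<Rightarrow> real" where
  "quot_root f z = (f (fst z) - f (snd z)) / sqrt (dist (fst z) (snd z) ^ CARD('n))"

lemma slobodeckij_quot_eq: "slobodeckij_quot g z = (quot_root (rep_bdrfun g) z)\<^sup>2"
  by (cases z) (simp add: slobodeckij_quot_def quot_root_def power_divide)

lemma quot_root_linear:
  "quot_root (\<lambda>x. f x + g x) z = quot_root f z + quot_root g z"
  "quot_root (\<lambda>x. f x - g x) z = quot_root f z - quot_root g z"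
  "quot_root (\<lambda>x. c * f x) z = c * quot_root f z"
  by (simp_all add: quot_root_def add_divide_distrib diff_divide_distrib algebra_simps)

context
  fixes \<Omega> :: "(real^'n::finite) set"
begin

abbreviation border_square :: "((real^'n) \<times> (real^'n)) measure" where
  "border_square \<equiv> border_measure \<Omega> \<Otimes>\<^sub>M border_measure \<Omega>"

lemma frontier_measurable: "frontier \<Omega> \<in> sets borel"
  by (simp add: borel_closed)

lemma AE_border_iff:
  "(AE x in border_measure \<Omega>. Q x) \<longleftrightarrow> (AE x in border_hausdorff. x \<in> frontier \<Omega> \<longrightarrow> Q x)"
  unfolding border_measure_def border_hausdorff_def
  by (intro AE_restrict_space_iff) (simp add: sets_hausdorff_measure space_hausdorff_measure)

lemma AE_border: "AE x in border_hausdorff. Q x \<Longrightarrow> AE x in border_measure \<Omega>. Q x"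
  unfolding AE_border_iff by (auto elim: eventually_mono)

lemma borel_measurable_border: "f \<in> borel_measurable borel \<Longrightarrow> f \<in> borel_measurable (border_measure \<Omega>)"
  for f :: "real^'n \<Rightarrow> real"
  unfolding border_measure_def by (intro measurable_restrict_space1 borel_measurable_hausdorff)

lemma ident_measurable_border: "(\<lambda>x. x) \<in> measurable (border_measure \<Omega>) borel"
  unfolding border_measure_def
  by (intro measurable_restrict_space1) (simp add: measurable_def space_hausdorff_measure sets_hausdorff_measure)

lemma quot_root_measurable:
  assumes "f \<in> borel_measurable borel"
  shows "quot_root f \<in> borel_measurable border_square"
proof -
  note [measurable] = measurable_compose[OF measurable_fst ident_measurable_border]
    measurable_compose[OF measurable_snd ident_measurable_border] assms
  show ?thesis unfolding quot_root_def by measurable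
qed

text \<open>Changing \<open>f\<close> on a null set alters the quotient only on the two strips over
  that set, which are null by \<open>AE_pair_measure_self\<close>. This makes the seminorm
  independent of representatives.\<close>

lemma quot_root_cong_AE:
  assumes "AE x in border_hausdorff. f x = g x"
  shows "AE z in border_square. quot_root f z = quot_root g z"
  using AE_pair_measure_self[OF AE_border[OF assms]] by eventually_elim (simp add: quot_root_def)

lemma W_half_iff:
  "g \<in> W_half \<Omega> \<longleftrightarrow> (AE x in border_hausdorff. x \<notin> frontier \<Omega> \<longrightarrow> rep_bdrfun g x = 0) \<and>
     sq_integrable (border_measure \<Omega>) (rep_bdrfun g) \<and> sq_integrable border_square (quot_root (rep_bdrfun g))"
  unfolding border_hausdorff_def
  by (simp add: W_half_def sq_integrable_def borel_measurable_border quot_root_measurable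
      slobodeckij_quot_eq[abs_def])

lemma W_half_cong:
  assumes "AE x in border_hausdorff. rep_bdrfun g x = f x" "f \<in> borel_measurable borel"
  shows "g \<in> W_half \<Omega> \<longleftrightarrow> (AE x in border_hausdorff. x \<notin> frontier \<Omega> \<longrightarrow> f x = 0) \<and>
     sq_integrable (border_measure \<Omega>) f \<and> sq_integrable border_square (quot_root f)"
proof -
  have "(AE x in border_hausdorff. x \<notin> frontier \<Omega> \<longrightarrow> rep_bdrfun g x = 0) \<longleftrightarrow>
      (AE x in border_hausdorff. x \<notin> frontier \<Omega> \<longrightarrow> f x = 0)"
  proof
    assume "AE x in border_hausdorff. x \<notin> frontier \<Omega> \<longrightarrow> rep_bdrfun g x = 0"
    with assms(1) show "AE x in border_hausdorff. x \<notin> frontier \<Omega> \<longrightarrow> f x = 0"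
      by eventually_elim simp
  next
    assume "AE x in border_hausdorff. x \<notin> frontier \<Omega> \<longrightarrow> f x = 0"
    with assms(1) show "AE x in border_hausdorff. x \<notin> frontier \<Omega> \<longrightarrow> rep_bdrfun g x = 0"
      by eventually_elim simp
  qed
  moreover have "sq_integrable (border_measure \<Omega>) (rep_bdrfun g) \<longleftrightarrow> sq_integrable (border_measure \<Omega>) f"
    using assms by (intro sq_integrable_cong_AE AE_border borel_measurable_border) auto
  moreover have "sq_integrable border_square (quot_root (rep_bdrfun g)) \<longleftrightarrow> sq_integrable border_square (quot_root f)"
    using assms by (intro sq_integrable_cong_AE quot_root_cong_AE quot_root_measurable) auto
  ultimately show ?thesis unfolding W_half_iff by simp
qed

definition inner_half :: "'n bdrfun \<Rightarrow> 'n bdrfun \<Rightarrow> real" where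
  "inner_half g h = (LINT x|border_measure \<Omega>. rep_bdrfun g x * rep_bdrfun h x) +
     (LINT z|border_square. quot_root (rep_bdrfun g) z * quot_root (rep_bdrfun h) z)"

lemma norm_half_eq: "norm_half \<Omega> g = sqrt (inner_half g g)"
  by (simp add: norm_half_def inner_half_def slobodeckij_quot_eq power2_eq_square)

lemma norm_half_cong:
  assumes "AE x in border_hausdorff. rep_bdrfun g x = f x" "f \<in> borel_measurable borel"
  shows "norm_half \<Omega> g =
    sqrt ((LINT x|border_measure \<Omega>. (f x)\<^sup>2) + (LINT z|border_square. (quot_root f z)\<^sup>2))"
proof -
  have "(LINT x|border_measure \<Omega>. (rep_bdrfun g x)\<^sup>2) = (LINT x|border_measure \<Omega>. (f x)\<^sup>2)"
    using AE_border[OF assms(1)] assms(2)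
    by (intro integral_cong_AE borel_measurable_power borel_measurable_border) (auto elim: eventually_mono)
  moreover have "(LINT z|border_square. (quot_root (rep_bdrfun g) z)\<^sup>2) = (LINT z|border_square. (quot_root f z)\<^sup>2)"
    using quot_root_cong_AE[OF assms(1)] assms(2)
    by (intro integral_cong_AE borel_measurable_power quot_root_measurable) (auto elim: eventually_mono)
  ultimately show ?thesis
    by (simp add: norm_half_def slobodeckij_quot_eq)
qed

lemma subspace_W_half: "subspace (W_half \<Omega>)"
  unfolding subspace_def
proof (intro conjI ballI allI)
  show "0 \<in> W_half \<Omega>"
    by (subst W_half_cong[OF rep_bdrfun_zero]) (auto simp: sq_integrable_def quot_root_def[abs_def])
next
  fix g h assume g: "g \<in> W_half \<Omega>" and h: "h \<in> W_half \<Omega>"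
  have "AE x in border_hausdorff. x \<notin> frontier \<Omega> \<longrightarrow> rep_bdrfun g x = 0"
    "AE x in border_hausdorff. x \<notin> frontier \<Omega> \<longrightarrow> rep_bdrfun h x = 0"
    using g h by (simp_all add: W_half_iff)
  then have "AE x in border_hausdorff. x \<notin> frontier \<Omega> \<longrightarrow> rep_bdrfun g x + rep_bdrfun h x = 0"
    by eventually_elim simp
  moreover have "sq_integrable (border_measure \<Omega>) (\<lambda>x. rep_bdrfun g x + rep_bdrfun h x)"
    "sq_integrable border_square (quot_root (\<lambda>x. rep_bdrfun g x + rep_bdrfun h x))"
    unfolding quot_root_linear(1)[abs_def] using g h by (simp_all add: W_half_iff sq_integrable_add)
  ultimately show "g + h \<in> W_half \<Omega>"
    using W_half_cong[OF rep_bdrfun_add, of g h] by simp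
next
  fix g and c :: real assume g: "g \<in> W_half \<Omega>"
  have "AE x in border_hausdorff. x \<notin> frontier \<Omega> \<longrightarrow> rep_bdrfun g x = 0"
    using g by (simp add: W_half_iff)
  then have "AE x in border_hausdorff. x \<notin> frontier \<Omega> \<longrightarrow> c * rep_bdrfun g x = 0"
    by eventually_elim simp
  moreover have "sq_integrable (border_measure \<Omega>) (\<lambda>x. c * rep_bdrfun g x)"
    "sq_integrable border_square (quot_root (\<lambda>x. c * rep_bdrfun g x))"
    unfolding quot_root_linear(3)[abs_def] using g by (simp_all add: W_half_iff sq_integrable_scale)
  ultimately show "c *\<^sub>R g \<in> W_half \<Omega>"
    using W_half_cong[OF rep_bdrfun_scaleR, of c g] by simp
qed

lemma inner_half_left_cong:
  assumes "AE x in border_hausdorff. rep_bdrfun g x = f x" "f \<in> borel_measurable borel"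
  shows "inner_half g h = (LINT x|border_measure \<Omega>. f x * rep_bdrfun h x) +
     (LINT z|border_square. quot_root f z * quot_root (rep_bdrfun h) z)"
proof -
  have "(LINT x|border_measure \<Omega>. rep_bdrfun g x * rep_bdrfun h x) = (LINT x|border_measure \<Omega>. f x * rep_bdrfun h x)"
    using AE_border[OF assms(1)] assms(2)
    by (intro integral_cong_AE borel_measurable_times borel_measurable_border) (auto elim: eventually_mono)
  moreover have "(LINT z|border_square. quot_root (rep_bdrfun g) z * quot_root (rep_bdrfun h) z)
      = (LINT z|border_square. quot_root f z * quot_root (rep_bdrfun h) z)"
    using quot_root_cong_AE[OF assms(1)] assms(2)
    by (intro integral_cong_AE borel_measurable_times quot_root_measurable) (auto elim: eventually_mono)
  ultimately show ?thesis
    by (simp add: inner_half_def)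
qed

lemma inner_half_nonneg: "0 \<le> inner_half g g"
  by (simp add: inner_half_def)

lemma semi_inner_on_W_half: "semi_inner_on (W_half \<Omega>) inner_half"
proof
  show "subspace (W_half \<Omega>)" by (rule subspace_W_half)
  show "inner_half x y = inner_half y x" for x y
    by (simp add: inner_half_def mult.commute)
  show "inner_half (x + y) z = inner_half x z + inner_half y z"
    if W: "x \<in> W_half \<Omega>" "y \<in> W_half \<Omega>" "z \<in> W_half \<Omega>" for x y z
  proof -
    have i: "integrable (border_measure \<Omega>) (\<lambda>t. rep_bdrfun x t * rep_bdrfun z t)"
      "integrable (border_measure \<Omega>) (\<lambda>t. rep_bdrfun y t * rep_bdrfun z t)"
      "integrable border_square (\<lambda>t. quot_root (rep_bdrfun x) t * quot_root (rep_bdrfun z) t)"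
      "integrable border_square (\<lambda>t. quot_root (rep_bdrfun y) t * quot_root (rep_bdrfun z) t)"
      using W unfolding W_half_iff by (blast intro: sq_integrable_mult)+
    have "inner_half (x + y) z = (LINT t|border_measure \<Omega>. (rep_bdrfun x t + rep_bdrfun y t) * rep_bdrfun z t) +
        (LINT t|border_square. quot_root (\<lambda>t. rep_bdrfun x t + rep_bdrfun y t) t * quot_root (rep_bdrfun z) t)"
      by (rule inner_half_left_cong[OF rep_bdrfun_add]) simp
    also have "\<dots> = inner_half x z + inner_half y z"
      unfolding quot_root_linear(1) distrib_right Bochner_Integration.integral_add[OF i(1,2)]
        Bochner_Integration.integral_add[OF i(3,4)] inner_half_def by linarith
    finally show ?thesis .
  qed
  show "inner_half (c *\<^sub>R x) y = c * inner_half x y" for x y c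
  proof -
    have "inner_half (c *\<^sub>R x) y = (LINT t|border_measure \<Omega>. c * rep_bdrfun x t * rep_bdrfun y t) +
        (LINT z|border_square. quot_root (\<lambda>t. c * rep_bdrfun x t) z * quot_root (rep_bdrfun y) z)"
      by (rule inner_half_left_cong[OF rep_bdrfun_scaleR]) simp
    also have "\<dots> = c * inner_half x y"
      unfolding quot_root_linear(3) mult.assoc integral_mult_right_zero inner_half_def distrib_left ..
    finally show ?thesis .
  qed
  show "0 \<le> inner_half x x" for x
    by (rule inner_half_nonneg)
qed

lemma inner_half_definite:
  assumes g: "g \<in> W_half \<Omega>" and 0: "inner_half g g = 0"
  shows "g = 0"
proof -
  have "(LINT x|border_measure \<Omega>. (rep_bdrfun g x)\<^sup>2) + (LINT z|border_square. (quot_root (rep_bdrfun g) z)\<^sup>2) = 0"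
    using 0 by (simp add: inner_half_def power2_eq_square)
  moreover have "0 \<le> (LINT x|border_measure \<Omega>. (rep_bdrfun g x)\<^sup>2)" "0 \<le> (LINT z|border_square. (quot_root (rep_bdrfun g) z)\<^sup>2)"
    by simp_all
  ultimately have "(LINT x|border_measure \<Omega>. (rep_bdrfun g x)\<^sup>2) = 0"
    by linarith
  then have "AE x in border_measure \<Omega>. (rep_bdrfun g x)\<^sup>2 = 0"
    using g integral_nonneg_eq_0_iff_AE[of "border_measure \<Omega>" "\<lambda>x. (rep_bdrfun g x)\<^sup>2"]
    by (simp add: W_half_iff sq_integrable_def)
  then have 1: "AE x in border_hausdorff. x \<in> frontier \<Omega> \<longrightarrow> (rep_bdrfun g x)\<^sup>2 = 0"
    unfolding AE_border_iff .
  have "AE x in border_hausdorff. x \<notin> frontier \<Omega> \<longrightarrow> rep_bdrfun g x = 0"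
    using g by (simp add: W_half_iff)
  with 1 rep_bdrfun_zero have "AE x in border_hausdorff. rep_bdrfun g x = rep_bdrfun 0 x"
    by eventually_elim auto
  then show ?thesis by (rule bdrfun_eqI)
qed

lemma norm_on_W_half: "norm_on (W_half \<Omega>) (norm_half \<Omega>)"
proof (rule semi_inner_on.norm_onI[OF semi_inner_on_W_half])
  show "norm_half \<Omega> (- g) = norm_half \<Omega> g" for g
  proof -
    have "AE x in border_hausdorff. rep_bdrfun (- g) x = - 1 * rep_bdrfun g x"
      using rep_bdrfun_scaleR[of "- 1" g] by simp
    then have "norm_half \<Omega> (- g) = sqrt ((LINT x|border_measure \<Omega>. (- 1 * rep_bdrfun g x)\<^sup>2) +
        (LINT z|border_square. (quot_root (\<lambda>x. - 1 * rep_bdrfun g x) z)\<^sup>2))"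
      by (rule norm_half_cong) simp
    also have "\<dots> = norm_half \<Omega> g"
      unfolding quot_root_linear by (simp add: norm_half_def slobodeckij_quot_eq)
    finally show ?thesis .
  qed
qed (auto simp: norm_half_eq inner_half_nonneg intro: inner_half_definite)

text \<open>A Cauchy sequence is one in L2 twice: the functions on the border and their quotients on
  its square. The subsequence converging almost everywhere on the border makes the quotients
  converge almost everywhere on the square, which identifies the second L2 limit.\<close>

theorem complete_W_half: "complete_on (W_half \<Omega>) (norm_half \<Omega>)"
  unfolding complete_on_def
proof (intro allI impI; elim conjE)
  fix \<sigma> :: "nat \<Rightarrow> 'n bdrfun"
  assume ran: "range \<sigma> \<subseteq> W_half \<Omega>" and C: "Cauchy_on (norm_half \<Omega>) \<sigma>"
  have W: "\<sigma> n \<in> W_half \<Omega>" for n using ran by auto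
  let ?F = "\<lambda>n. rep_bdrfun (\<sigma> n)"
  let ?Q = "\<lambda>n. quot_root (?F n)"
  have sq: "sq_integrable (border_measure \<Omega>) (?F n)" "sq_integrable border_square (?Q n)" for n
    using W by (auto simp: W_half_iff)
  have norm_diff: "norm_half \<Omega> (\<sigma> m - \<sigma> n) = sqrt ((LINT x|border_measure \<Omega>. (?F m x - ?F n x)\<^sup>2) +
      (LINT z|border_square. (?Q m z - ?Q n z)\<^sup>2))" for m n
    by (simp add: norm_half_cong[OF rep_bdrfun_diff] quot_root_linear)
  have "\<exists>K. \<forall>m\<ge>K. \<forall>n\<ge>K. (LINT x|border_measure \<Omega>. (?F m x - ?F n x)\<^sup>2) < e \<and>
      (LINT z|border_square. (?Q m z - ?Q n z)\<^sup>2) < e" if "e > 0" for e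
  proof -
    have "0 < sqrt e" using that by simp
    then obtain K where K: "\<And>m n. m \<ge> K \<Longrightarrow> n \<ge> K \<Longrightarrow> norm_half \<Omega> (\<sigma> m - \<sigma> n) < sqrt e"
      using C unfolding Cauchy_on_def by blast
    have less: "A < e \<and> B < e" if "A + B < e" "0 \<le> A" "0 \<le> B" for A B :: real
      using that by linarith
    have "(LINT x|border_measure \<Omega>. (?F m x - ?F n x)\<^sup>2) < e \<and>
      (LINT z|border_square. (?Q m z - ?Q n z)\<^sup>2) < e" if "m \<ge> K" "n \<ge> K" for m n
      by (rule less[OF K[OF that, unfolded norm_diff real_sqrt_less_iff]]) simp_all
    then show ?thesis by blast
  qed
  then have cauchy: "L2_Cauchy (border_measure \<Omega>) ?F" "L2_Cauchy border_square ?Q"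
    unfolding L2_Cauchy_def by blast+
  obtain r where r: "strict_mono r" "AE x in border_measure \<Omega>. (\<lambda>k. ?F (r k) x) \<longlonglongrightarrow> lim (\<lambda>k. ?F (r k) x)"
    using L2_Cauchy_AE_limit[OF sq(1) cauchy(1)] by blast
  \<comment> \<open>Cut off to 0 outside the frontier, as membership in \<open>W_half\<close>
    demands.\<close>
  define f where "f x = (if x \<in> frontier \<Omega> then lim (\<lambda>k. ?F (r k) x) else 0)" for x
  have f: "f \<in> borel_measurable borel"
    unfolding f_def using frontier_measurable
    by (intro measurable_If_set) (auto intro: borel_measurable_lim_metric)
  have lim: "AE x in border_measure \<Omega>. (\<lambda>k. ?F (r k) x) \<longlonglongrightarrow> f x"
    using r(2) unfolding AE_border_iff by eventually_elim (simp add: f_def)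
  have "AE z in border_square. (\<lambda>k. ?Q (r k) z) \<longlonglongrightarrow> quot_root f z"
    using AE_pair_measure_self[OF lim]
  proof eventually_elim
    case (elim z)
    \<comment> \<open>Written as a product with a constant inverse, the convergence also covers the
      diagonal, where that factor is \<open>inverse 0 = 0\<close>.\<close>
    then have "(\<lambda>k. (?F (r k) (fst z) - ?F (r k) (snd z)) * inverse (sqrt (dist (fst z) (snd z) ^ CARD('n))))
        \<longlonglongrightarrow> (f (fst z) - f (snd z)) * inverse (sqrt (dist (fst z) (snd z) ^ CARD('n)))"
      by (intro tendsto_mult tendsto_diff tendsto_const) auto
    then show ?case by (simp add: quot_root_def divide_inverse)
  qed
  note l = L2_Cauchy_limit[OF sq(1) cauchy(1) r(1) borel_measurable_border[OF f] lim]
    L2_Cauchy_limit[OF sq(2) cauchy(2) r(1) quot_root_measurable[OF f] this]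
  let ?g = "abs_bdrfun f"
  have g: "?g \<in> W_half \<Omega>"
    using l by (simp add: W_half_cong[OF rep_abs_bdrfun[OF f] f]) (simp add: f_def)
  have "norm_half \<Omega> (\<sigma> n - ?g) = sqrt ((LINT x|border_measure \<Omega>. (?F n x - f x)\<^sup>2) +
      (LINT z|border_square. (?Q n z - quot_root f z)\<^sup>2))" for n
  proof -
    have "AE x in border_hausdorff. rep_bdrfun (\<sigma> n - ?g) x = ?F n x - f x"
      using rep_bdrfun_diff[of "\<sigma> n" ?g] rep_abs_bdrfun[OF f] by eventually_elim simp
    from norm_half_cong[OF this] show ?thesis
      using f by (simp add: quot_root_linear)
  qed
  moreover have "(\<lambda>n. sqrt ((LINT x|border_measure \<Omega>. (?F n x - f x)\<^sup>2) +
      (LINT z|border_square. (?Q n z - quot_root f z)\<^sup>2))) \<longlonglongrightarrow> sqrt (0 + 0)"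
    by (intro tendsto_intros l)
  ultimately have "(\<lambda>n. norm_half \<Omega> (\<sigma> n - ?g)) \<longlonglongrightarrow> 0"
    by (simp only: add_0 real_sqrt_zero)
  then show "\<exists>l\<in>W_half \<Omega>. (\<lambda>n. norm_half \<Omega> (\<sigma> n - l)) \<longlonglongrightarrow> 0"
    using g by blast
qed

end

section \<open>Test functions\<close>

lemma C_k_SucD: "C_k (Suc k) f \<Longrightarrow> C_k k f"
  by (induction k arbitrary: f)
    (auto simp: differentiable_imp_continuous_within intro!: continuous_at_imp_continuous_on)

lemma partial_deriv_eqI: "(f has_derivative f') (at x) \<Longrightarrow> partial_deriv i f x = f' (axis i 1)"
  unfolding partial_deriv_def using frechet_derivative_at by metis

lemma partial_deriv_const: "partial_deriv i (\<lambda>_. c) x = 0"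
  by (rule partial_deriv_eqI[of _ "\<lambda>_. 0"]) simp

lemma partial_deriv_add:
  "f differentiable at x \<Longrightarrow> g differentiable at x \<Longrightarrow>
    partial_deriv i (\<lambda>x. f x + g x) x = partial_deriv i f x + partial_deriv i g x"
  unfolding frechet_derivative_works
  by (subst partial_deriv_eqI, rule has_derivative_add) (auto simp: partial_deriv_def)

lemma partial_deriv_mult:
  "f differentiable at x \<Longrightarrow> g differentiable at x \<Longrightarrow>
    partial_deriv i (\<lambda>x. f x * g x) x = f x * partial_deriv i g x + partial_deriv i f x * g x"
  unfolding frechet_derivative_works
  by (subst partial_deriv_eqI, rule has_derivative_mult) (auto simp: partial_deriv_def)

lemma C_k_const: "C_k k (\<lambda>_. c)"
  by (induction k arbitrary: c) (simp_all add: partial_deriv_const[abs_def])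

lemma C_k_add: "C_k k f \<Longrightarrow> C_k k g \<Longrightarrow> C_k k (\<lambda>x. f x + g x)"
proof (induction k arbitrary: f g)
  case 0
  then show ?case by (auto intro: continuous_on_add)
next
  case (Suc k)
  then have "partial_deriv i (\<lambda>x. f x + g x) = (\<lambda>x. partial_deriv i f x + partial_deriv i g x)" for i
    by (intro ext partial_deriv_add) auto
  then show ?case
    using Suc by auto
qed

lemma C_k_mult: "C_k k f \<Longrightarrow> C_k k g \<Longrightarrow> C_k k (\<lambda>x. f x * g x)"
proof (induction k arbitrary: f g)
  case 0
  then show ?case by (auto intro: continuous_on_mult)
next
  case (Suc k)
  have "C_k k f" "C_k k g"
    using Suc.prems by (auto intro: C_k_SucD simp del: C_k.simps)
  then have "C_k k (\<lambda>x. f x * partial_deriv i g x + partial_deriv i f x * g x)" for i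
    using Suc by (intro C_k_add) auto
  moreover have "partial_deriv i (\<lambda>x. f x * g x) = (\<lambda>x. f x * partial_deriv i g x + partial_deriv i f x * g x)" for i
    using Suc.prems by (intro ext partial_deriv_mult) auto
  ultimately show ?case
    using Suc.prems by auto
qed

lemma C_k_prod: "finite I \<Longrightarrow> (\<And>i. i \<in> I \<Longrightarrow> C_k k (f i)) \<Longrightarrow> C_k k (\<lambda>x. \<Prod>i\<in>I. f i x)"
  by (induction I rule: finite_induct) (auto intro: C_k_const C_k_mult)

section \<open>Smooth bump functions on boxes\<close>

definition exp_cutoff :: "nat \<Rightarrow> real \<Rightarrow> real" where
  "exp_cutoff j t = (if t > 0 then inverse t ^ j * exp (- inverse t) else 0)"

lemma exp_cutoff_tendsto_0: "(exp_cutoff j \<longlongrightarrow> 0) (at 0)"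
proof -
  have "((\<lambda>s. s ^ j / exp s) \<longlongrightarrow> (0::real)) at_top"
    by (rule tendsto_power_div_exp_0)
  then have "((\<lambda>t. inverse t ^ j / exp (inverse t)) \<longlongrightarrow> (0::real)) (at_right 0)"
    using filterlim_inverse_at_top_right by (rule filterlim_compose)
  then have "(exp_cutoff j \<longlongrightarrow> 0) (at_right 0)"
    by (rule Lim_transform_eventually)
      (auto simp: exp_cutoff_def exp_minus divide_inverse eventually_at_filter)
  moreover have "(exp_cutoff j \<longlongrightarrow> 0) (at_left 0)"
    by (rule tendsto_eventually) (auto simp: exp_cutoff_def eventually_at_filter)
  ultimately show ?thesis
    by (simp add: filterlim_at_split)
qed

text \<open>The reason for the index \<open>j\<close>: differentiation maps the family into its own
  linear span, so that smoothness of all members follows by one induction.\<close>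

lemma exp_cutoff_has_derivative:
  "(exp_cutoff j has_real_derivative exp_cutoff (j + 2) t - real j * exp_cutoff (j + 1) t) (at t)"
proof (cases "t = 0")
  case True
  \<comment> \<open>Dividing by \<open>h\<close> raises the index by one, so the difference quotient
    at 0 is again a member of the family and tends to 0.\<close>
  have "((\<lambda>h. exp_cutoff j h / h) \<longlongrightarrow> 0) (at 0)"
    by (rule Lim_transform_eventually[OF exp_cutoff_tendsto_0[of "Suc j"]])
      (auto simp: exp_cutoff_def divide_inverse eventually_at_filter)
  then show ?thesis
    using True by (simp add: has_field_derivative_iff exp_cutoff_def)
next
  case False
  show ?thesis
  proof (cases "t > 0")
    case True
    have "((\<lambda>t. inverse t ^ j * exp (- inverse t)) has_real_derivative
        exp_cutoff (j + 2) t - real j * exp_cutoff (j + 1) t) (at t)"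
      using True
      by (auto intro!: derivative_eq_intros simp: exp_cutoff_def power2_eq_square field_simps)
        (cases j; simp add: field_simps)
    then show ?thesis
      by (rule has_field_derivative_transform_within_open[of _ _ _ "{0<..}"])
        (use True in \<open>auto simp: exp_cutoff_def\<close>)
  next
    case neg: False
    have "((\<lambda>t. 0) has_real_derivative exp_cutoff (j + 2) t - real j * exp_cutoff (j + 1) t) (at t)"
      using neg by (simp add: exp_cutoff_def)
    then show ?thesis
      by (rule has_field_derivative_transform_within_open[of _ _ _ "{..<0}"])
        (use False neg in \<open>auto simp: exp_cutoff_def\<close>)
  qed
qed

lemma exp_cutoff_component_has_derivative:
  "((\<lambda>x::real^'n::finite. exp_cutoff j (c * x $ i + d)) has_derivative
     (\<lambda>h. (exp_cutoff (j + 2) (c * x $ i + d) - real j * exp_cutoff (j + 1) (c * x $ i + d)) * (c * h $ i))) (at x)"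
proof -
  have "((\<lambda>x::real^'n. c * x $ i + d) has_derivative (\<lambda>h. c * h $ i)) (at x)"
    by (auto intro!: derivative_eq_intros bounded_linear_imp_has_derivative bounded_linear_vec_nth)
  from has_derivative_compose[OF this exp_cutoff_has_derivative[THEN has_field_derivative_imp_has_derivative]]
  show ?thesis by simp
qed

text \<open>The induction is for all \<open>j\<close> together, since a derivative of index
  \<open>j\<close> involves \<open>j + 1\<close> and \<open>j + 2\<close>. The affine argument, with
  \<open>c\<close> of either sign, covers both faces of a box.\<close>

lemma C_k_exp_cutoff: "C_k k (\<lambda>x::real^'n::finite. exp_cutoff j (c * x $ i + d))"
proof (induction k arbitrary: j)
  case 0
  show ?case
    using exp_cutoff_component_has_derivative
    by (auto intro!: continuous_at_imp_continuous_on has_derivative_continuous)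
next
  case (Suc k)
  have "partial_deriv i' (\<lambda>x::real^'n. exp_cutoff j (c * x $ i + d)) =
      (\<lambda>x. (exp_cutoff (j + 2) (c * x $ i + d) + (- real j) * exp_cutoff (j + 1) (c * x $ i + d)) *
        (c * axis i' 1 $ i))" for i'
    by (rule ext) (simp add: partial_deriv_eqI[OF exp_cutoff_component_has_derivative])
  moreover have "C_k k (\<lambda>x::real^'n. (exp_cutoff (j + 2) (c * x $ i + d) + (- real j) * exp_cutoff (j + 1) (c * x $ i + d)) *
        (c * axis i' 1 $ i))" for i'
    by (intro C_k_mult C_k_add C_k_const Suc)
  moreover have "(\<lambda>x::real^'n. exp_cutoff j (c * x $ i + d)) differentiable at x" for x
    using exp_cutoff_component_has_derivative unfolding differentiable_def by blast
  ultimately show ?case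
    by simp
qed

text \<open>The factor \<open>c\<close> is a steepness: as it grows the bumps tend to the indicator
  of the open box, while staying between 0 and 1 and keeping their support.\<close>

definition box_bump :: "real \<Rightarrow> real^'n \<Rightarrow> real^'n \<Rightarrow> real^'n::finite \<Rightarrow> real" where
  "box_bump c a b x = (\<Prod>i\<in>UNIV. exp_cutoff 0 (c * (x $ i - a $ i)) * exp_cutoff 0 (c * (b $ i - x $ i)))"

lemma C_k_box_bump: "C_k k (box_bump c a b)"
proof -
  have "C_k k (\<lambda>x. \<Prod>i\<in>UNIV. exp_cutoff 0 (c * x $ i + (- c * a $ i)) * exp_cutoff 0 ((- c) * x $ i + c * b $ i))"
    by (intro C_k_prod C_k_mult C_k_exp_cutoff) auto
  then show ?thesis
    by (simp add: box_bump_def[abs_def] algebra_simps)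
qed

lemma box_bump_nonzero_iff: "c > 0 \<Longrightarrow> box_bump c a b x \<noteq> 0 \<longleftrightarrow> x \<in> box a b"
  by (auto simp: box_bump_def exp_cutoff_def mem_box_cart zero_less_mult_iff split: if_splits)

lemma box_bump_test_function:
  assumes "c > 0" "cbox a b \<subseteq> \<Omega>"
  shows "box_bump c a b \<in> test_functions \<Omega>"
proof -
  have "closure {x. box_bump c a b x \<noteq> 0} \<subseteq> cbox a b"
    using box_bump_nonzero_iff[OF assms(1)] box_subset_cbox[of a b] by (intro closure_minimal) auto
  moreover have "compact (closure {x. box_bump c a b x \<noteq> 0})"
    using calculation bounded_subset[OF bounded_cbox] by (simp add: compact_eq_bounded_closed)
  ultimately show ?thesis
    using assms C_k_box_bump by (auto simp: test_functions_def)
qed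

lemma exp_cutoff_0_bounds: "0 \<le> exp_cutoff 0 t" "exp_cutoff 0 t \<le> 1"
  by (auto simp: exp_cutoff_def)

lemma box_bump_bounds: "0 \<le> box_bump c a b x" "box_bump c a b x \<le> 1"
  unfolding box_bump_def
  by (auto intro!: prod_nonneg prod_le_1 mult_nonneg_nonneg mult_le_one exp_cutoff_0_bounds)

lemma box_bump_tendsto: "(\<lambda>n. box_bump (real (Suc n)) a b x) \<longlonglongrightarrow> indicator (box a b) x"
proof (cases "x \<in> box a b")
  case True
  have *: "(\<lambda>n. exp_cutoff 0 (real (Suc n) * t)) \<longlonglongrightarrow> 1" if "t > 0" for t
  proof -
    have "(\<lambda>n. exp (- (inverse (real (Suc n)) * inverse t))) \<longlonglongrightarrow> exp (- (0 * inverse t))"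
      by (intro tendsto_intros LIMSEQ_inverse_real_of_nat)
    then show ?thesis
      using that by (simp add: exp_cutoff_def)
  qed
  have "(\<lambda>n. box_bump (real (Suc n)) a b x) \<longlonglongrightarrow> (\<Prod>i\<in>(UNIV::'a set). 1 * 1)"
    unfolding box_bump_def using True by (intro tendsto_prod tendsto_mult *) (auto simp: mem_box_cart)
  then show ?thesis using True by simp
next
  case False
  then have "box_bump (real (Suc n)) a b x = 0" for n
    using box_bump_nonzero_iff[of "real (Suc n)" a b x] by auto
  then show ?thesis using False by simp
qed

lemma test_functionsD:
  assumes "\<phi> \<in> test_functions \<Omega>"
  shows "C_k k \<phi>" "\<phi> differentiable at x" "C_k k (partial_deriv i \<phi>)"
  using assms C_k.simps(2)[of k \<phi>] by (auto simp: test_functions_def simp del: C_k.simps)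

lemma C_k_continuous_on: "C_k k f \<Longrightarrow> continuous_on A f"
proof (induction k)
  case 0
  then show ?case by (auto intro: continuous_on_subset)
next
  case (Suc k)
  then show ?case using C_k_SucD by blast
qed

section \<open>The fundamental lemma of the calculus of variations\<close>

text \<open>The cubes have \<open>x\<close> as a corner, not as centre, to fit the form of Lebesgue
  differentiation used in \<open>fundamental_lemma\<close>.\<close>

lemma open_small_cbox:
  fixes x :: "'a::euclidean_space"
  assumes "open \<Omega>" "x \<in> \<Omega>"
  obtains r where "r > 0" "\<And>h. 0 < h \<Longrightarrow> h < r \<Longrightarrow> cbox x (x + h *\<^sub>R One) \<subseteq> \<Omega>"
proof -
  obtain e where e: "e > 0" "ball x e \<subseteq> \<Omega>"
    using assms open_contains_ball by blast
  have pos: "0 < norm (One::'a) + 1"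
    by (simp add: add_nonneg_pos)
  show ?thesis
  proof (rule that)
    show "e / (norm (One::'a) + 1) > 0" using e pos by simp
    fix h assume h: "0 < h" "h < e / (norm (One::'a) + 1)"
    have "y \<in> ball x e" if y: "y \<in> cbox x (x + h *\<^sub>R One)" for y
    proof -
      have "norm (y - x) \<le> norm (h *\<^sub>R (One::'a))"
        using y h by (intro norm_le_componentwise) (force simp: mem_box inner_diff_left inner_add_left)
      also have "\<dots> \<le> h * (norm (One::'a) + 1)" using h by (simp add: algebra_simps)
      also have "\<dots> < e" using h pos by (simp add: pos_less_divide_eq)
      finally show ?thesis by (simp add: dist_norm norm_minus_commute)
    qed
    then show "cbox x (x + h *\<^sub>R One) \<subseteq> \<Omega>" using e by blast
  qed
qed

text \<open>Steepening bumps exhaust the indicator of a box, so by dominated convergence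
  \<open>v\<close> has integral 0 over every box in \<open>\<Omega>\<close>. Lebesgue
  differentiation then recovers \<open>v\<close> almost everywhere from its means over shrinking
  cubes.\<close>

lemma fundamental_lemma:
  fixes v :: "real^'n::finite \<Rightarrow> real"
  assumes \<Omega>: "open \<Omega>" and v [measurable]: "v \<in> borel_measurable borel"
    and int: "\<And>a b. set_integrable lborel (cbox a b) v"
    and zero: "\<And>\<phi>. \<phi> \<in> test_functions \<Omega> \<Longrightarrow> (LINT x:\<Omega>|lborel. v x * \<phi> x) = 0"
  shows "AE x in lborel. x \<in> \<Omega> \<longrightarrow> v x = 0"
proof -
  have box0: "integral (cbox a b) v = 0" if ab: "cbox a b \<subseteq> \<Omega>" for a b
  proof -
    have [measurable]: "box_bump c a b \<in> borel_measurable borel" for c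
      using C_k_continuous_on[OF C_k_box_bump] by (rule borel_measurable_continuous_onI)
    have [measurable]: "\<Omega> \<in> sets borel" using \<Omega> by simp
    have "(\<lambda>n. LINT x|lborel. indicator \<Omega> x *\<^sub>R (v x * box_bump (real (Suc n)) a b x))
        \<longlonglongrightarrow> (LINT x|lborel. indicator (box a b) x *\<^sub>R v x)"
    proof (rule integral_dominated_convergence)
      show "integrable lborel (\<lambda>x. \<bar>indicator (cbox a b) x *\<^sub>R v x\<bar>)"
        using int[of a b] by (intro integrable_abs) (simp add: set_integrable_def)
      have ind: "indicator \<Omega> x *\<^sub>R (v x * indicator (box a b) x) = indicator (box a b) x *\<^sub>R v x" for x
        using ab box_subset_cbox[of a b] by (auto simp: indicator_def)
      show "AE x in lborel. (\<lambda>n. indicator \<Omega> x *\<^sub>R (v x * box_bump (real (Suc n)) a b x))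
          \<longlonglongrightarrow> indicator (box a b) x *\<^sub>R v x"
        unfolding ind[symmetric] by (intro AE_I2 tendsto_scaleR tendsto_mult tendsto_const box_bump_tendsto)
      show "AE x in lborel. norm (indicator \<Omega> x *\<^sub>R (v x * box_bump (real (Suc n)) a b x))
          \<le> \<bar>indicator (cbox a b) x *\<^sub>R v x\<bar>" for n
      proof (intro AE_I2)
        fix x
        show "norm (indicator \<Omega> x *\<^sub>R (v x * box_bump (real (Suc n)) a b x)) \<le> \<bar>indicator (cbox a b) x *\<^sub>R v x\<bar>"
        proof (cases "x \<in> box a b")
          case True
          then have "x \<in> cbox a b" "x \<in> \<Omega>" using ab box_subset_cbox[of a b] by auto
          then show ?thesis
            using box_bump_bounds[of "real (Suc n)" a b x] by (simp add: abs_mult mult_left_le)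
        next
          case False
          then have "box_bump (real (Suc n)) a b x = 0"
            using box_bump_nonzero_iff[of "real (Suc n)" a b x] by auto
          then show ?thesis by simp
        qed
      qed
    qed auto
    moreover have "(LINT x|lborel. indicator \<Omega> x *\<^sub>R (v x * box_bump (real (Suc n)) a b x)) = 0" for n
      using zero[OF box_bump_test_function[of "real (Suc n)" a b \<Omega>]] ab by (simp add: set_lebesgue_integral_def)
    ultimately have "(LINT x:box a b|lborel. v x) = 0"
      by (simp add: set_lebesgue_integral_def LIMSEQ_const_iff)
    moreover have "set_integrable lborel (box a b) v"
      by (rule set_integrable_subset[OF int[of a b] _ box_subset_cbox]) simp
    ultimately have "integral (box a b) v = 0"
      using set_borel_integral_eq_integral(2) by metis
    then show ?thesis by (simp add: integral_open_interval)
  qed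
  have "v integrable_on cbox a b" for a b
    using set_borel_integral_eq_integral(1)[OF int] .
  then obtain N where N: "negligible N"
    "\<And>x e. \<lbrakk>x \<notin> N; 0 < e\<rbrakk> \<Longrightarrow> \<exists>d>0. \<forall>h. 0 < h \<and> h < d \<longrightarrow>
        norm (integral (cbox x (x + h *\<^sub>R One)) v /\<^sub>R h ^ DIM(real^'n) - v x) < e"
    using integrable_ccontinuous_explicit[of v] by blast
  have zero_off_N: "v x = 0" if x: "x \<in> \<Omega>" "x \<notin> N" for x
  proof (rule ccontr)
    assume "v x \<noteq> 0"
    then obtain d where d: "d > 0" "\<And>h. 0 < h \<Longrightarrow> h < d \<Longrightarrow>
        norm (integral (cbox x (x + h *\<^sub>R One)) v /\<^sub>R h ^ DIM(real^'n) - v x) < \<bar>v x\<bar>"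
      using N(2)[OF x(2), of "\<bar>v x\<bar>"] by auto
    obtain r where r: "r > 0" "\<And>h. 0 < h \<Longrightarrow> h < r \<Longrightarrow> cbox x (x + h *\<^sub>R One) \<subseteq> \<Omega>"
      using open_small_cbox[OF \<Omega> x(1)] by blast
    have h: "0 < min d r / 2" "min d r / 2 < d" "min d r / 2 < r"
      using d r by auto
    show False
      using d(2)[OF h(1,2)] box0[OF r(2)[OF h(1,3)]] by simp
  qed
  \<comment> \<open>The exceptional set is null only for the completed measure; the statement
    transfers back to \<open>lborel\<close> nevertheless.\<close>
  have "AE x in lebesgue. x \<notin> N"
    using N(1) by (intro AE_not_in) (simp add: negligible_iff_null_sets)
  then have "AE x in lborel. x \<notin> N"
    by (simp add: AE_completion_iff)
  then show ?thesis
    by eventually_elim (use zero_off_N in blast)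
qed

section \<open>Integration by parts\<close>

lemma integrable_compact_support:
  fixes f :: "real^'n::finite \<Rightarrow> real"
  assumes "continuous_on UNIV f" "compact K" "\<And>x. x \<notin> K \<Longrightarrow> f x = 0"
  shows "integrable lborel f"
proof -
  have "integrable lborel (\<lambda>x. indicator K x *\<^sub>R f x)"
    using assms by (intro borel_integrable_compact) (auto intro: continuous_on_subset)
  also have "(\<lambda>x. indicator K x *\<^sub>R f x) = f"
    using assms(3) by (intro ext) (auto simp: indicator_def)
  finally show ?thesis .
qed

lemma partial_deriv_zero_off:
  assumes "closed K" "\<And>x. x \<notin> K \<Longrightarrow> f x = 0" "x \<notin> K"
  shows "partial_deriv i f x = 0"
proof -
  have "((\<lambda>_. 0) has_derivative (\<lambda>_. 0)) (at x)" by simp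
  then have "(f has_derivative (\<lambda>_. 0)) (at x)"
    by (rule has_derivative_transform_within_open[of _ _ _ _ "- K"]) (use assms in auto)
  then show ?thesis by (rule partial_deriv_eqI)
qed

lemma has_real_derivative_line:
  assumes "\<And>x. f differentiable at x"
  shows "((\<lambda>t. f (x + t *\<^sub>R axis i 1)) has_real_derivative partial_deriv i f (x + t *\<^sub>R axis i 1)) (at t)"
proof -
  let ?y = "x + t *\<^sub>R axis i 1"
  have f: "(f has_derivative frechet_derivative f (at ?y)) (at ?y)"
    using assms by (simp add: frechet_derivative_works)
  have "((\<lambda>t. x + t *\<^sub>R axis i 1) has_derivative (\<lambda>s. s *\<^sub>R axis i 1)) (at t)"
    by (auto intro!: derivative_eq_intros)
  from has_derivative_compose[OF this f]
  have "((\<lambda>t. f (x + t *\<^sub>R axis i 1)) has_derivative (\<lambda>s. frechet_derivative f (at ?y) (s *\<^sub>R axis i 1))) (at t)" .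
  also have "(\<lambda>s. frechet_derivative f (at ?y) (s *\<^sub>R axis i 1)) = (\<lambda>s. s * partial_deriv i f ?y)"
    using linear_scale[OF has_derivative_linear[OF f]] by (simp add: partial_deriv_def)
  finally show ?thesis
    by (simp add: has_field_derivative_def mult_commute_abs)
qed

lemma lborel_integral_translation:
  fixes f :: "'a::euclidean_space \<Rightarrow> real"
  assumes [measurable]: "f \<in> borel_measurable borel"
  shows "(LINT x|lborel. f (x + c)) = (LINT x|lborel. f x)"
    "integrable lborel (\<lambda>x. f (x + c)) \<longleftrightarrow> integrable lborel f"
proof -
  have "(LINT x|lborel. f x) = (LINT x|distr lborel borel ((+) c). f x)"
    by (simp add: lborel_distr_plus)
  also have "\<dots> = (LINT x|lborel. f (x + c))"
    by (subst integral_distr) (auto simp: add.commute)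
  finally show "(LINT x|lborel. f (x + c)) = (LINT x|lborel. f x)" ..
  have "integrable lborel f \<longleftrightarrow> integrable (distr lborel borel ((+) c)) f"
    by (simp add: lborel_distr_plus)
  also have "\<dots> \<longleftrightarrow> integrable lborel (\<lambda>x. f (x + c))"
    by (subst integrable_distr_eq) (auto simp: add.commute)
  finally show "integrable lborel (\<lambda>x. f (x + c)) \<longleftrightarrow> integrable lborel f" ..
qed

text \<open>The difference quotients in direction \<open>i\<close> have integral \<open>0\<close> by translation invariance.\<close>

lemma integral_partial_deriv_zero:
  fixes f :: "real^'n::finite \<Rightarrow> real"
  assumes f: "C_k (Suc 0) f" and K: "compact K" "\<And>x. x \<notin> K \<Longrightarrow> f x = 0"
  shows "(LINT x|lborel. partial_deriv i f x) = 0"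
proof -
  let ?e = "axis i 1 :: real^'n"
  have diff: "f differentiable at x" and cont: "continuous_on UNIV (partial_deriv i f)" for x
    using f by auto
  have f_cont: "continuous_on UNIV f"
    using f by (rule C_k_continuous_on)
  have [measurable]: "f \<in> borel_measurable borel" "partial_deriv i f \<in> borel_measurable borel"
    using cont f_cont by (auto intro: borel_measurable_continuous_onI)
  have zero: "partial_deriv i f x = 0" if "x \<notin> K" for x
    using partial_deriv_zero_off[of K f x i] compact_imp_closed[OF K(1)] K(2) that by blast
  have "bounded (partial_deriv i f ` K)"
    using compact_continuous_image[OF continuous_on_subset[OF cont] K(1)] by (auto intro: compact_imp_bounded)
  then obtain B where B: "B > 0" "\<And>x. x \<in> K \<Longrightarrow> \<bar>partial_deriv i f x\<bar> \<le> B"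
    unfolding bounded_pos by auto
  then have B': "\<bar>partial_deriv i f x\<bar> \<le> B" for x
    using zero[of x] by (cases "x \<in> K") auto
  obtain R where R: "\<And>x. x \<in> K \<Longrightarrow> norm x \<le> R"
    using compact_imp_bounded[OF K(1)] unfolding bounded_iff by blast
  define h where "h n = inverse (real (Suc n))" for n
  have h: "0 < h n" "h n \<le> 1" for n
    unfolding h_def by (auto simp: inverse_le_1_iff)
  define q where "q n x = (f (x + h n *\<^sub>R ?e) - f x) / h n" for n x
  have f_int: "integrable lborel f"
    using f_cont K by (rule integrable_compact_support)
  have "(LINT x|lborel. q n x) = 0" for n
    unfolding q_def using f_int
    by (simp add: lborel_integral_translation)
  moreover have "(\<lambda>n. LINT x|lborel. q n x) \<longlonglongrightarrow> (LINT x|lborel. partial_deriv i f x)"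
  proof (rule integral_dominated_convergence)
    \<comment> \<open>The mean value theorem bounds the quotients by \<open>B\<close>, and steps
      \<open>h n\<close> of size at most 1 keep their supports in the ball of radius
      \<open>R + 1\<close>.\<close>
    show "integrable lborel (\<lambda>x. indicator (cball 0 (R + 1)) x *\<^sub>R B)"
      by (intro borel_integrable_compact) auto
    show "q n \<in> borel_measurable lborel" for n
      unfolding q_def by measurable
    show "AE x in lborel. (\<lambda>n. q n x) \<longlonglongrightarrow> partial_deriv i f x"
    proof (intro AE_I2)
      fix x
      have "((\<lambda>t. (f (x + t *\<^sub>R ?e) - f x) / t) \<longlongrightarrow> partial_deriv i f x) (at 0)"
        using has_real_derivative_line[OF diff, of x i 0] by (simp add: has_field_derivative_iff)
      moreover have "filterlim h (at 0) sequentially"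
        unfolding filterlim_at using h(1) LIMSEQ_inverse_real_of_nat
        by (auto simp: h_def[abs_def])
      ultimately show "(\<lambda>n. q n x) \<longlonglongrightarrow> partial_deriv i f x"
        unfolding q_def by (rule filterlim_compose)
    qed
    show "AE x in lborel. norm (q n x) \<le> indicator (cball 0 (R + 1)) x *\<^sub>R B" for n
    proof (intro AE_I2)
      fix x
      show "norm (q n x) \<le> indicator (cball 0 (R + 1)) x *\<^sub>R B"
      proof (cases "x \<in> cball 0 (R + 1)")
        case True
        obtain z where "f (x + h n *\<^sub>R ?e) - f (x + 0 *\<^sub>R ?e) = (h n - 0) * partial_deriv i f (x + z *\<^sub>R ?e)"
          using MVT2[OF h(1)[of n], where f = "\<lambda>t. f (x + t *\<^sub>R ?e)"
              and f' = "\<lambda>t. partial_deriv i f (x + t *\<^sub>R ?e)"]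
            has_real_derivative_line[OF diff] by blast
        then have "q n x = partial_deriv i f (x + z *\<^sub>R ?e)"
          using h(1)[of n] by (simp add: q_def)
        then show ?thesis using True B' by simp
      next
        case False
        then have "R + 1 < norm x" by simp
        moreover have "norm x \<le> norm (x + h n *\<^sub>R ?e) + h n"
          using norm_triangle_ineq4[of "x + h n *\<^sub>R ?e" "h n *\<^sub>R ?e"] h(1)[of n] by simp
        ultimately have "x \<notin> K" "x + h n *\<^sub>R ?e \<notin> K"
          using R[of x] R[of "x + h n *\<^sub>R ?e"] h(2)[of n] by auto
        then show ?thesis using False K(2) by (simp add: q_def)
      qed
    qed
  qed simp
  ultimately show ?thesis
    by (simp add: LIMSEQ_const_iff)
qed

text \<open>Compact support is asked of \<open>g\<close> alone, so that \<open>f\<close> may be a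
  coordinate function, as in \<open>poincare_test_function\<close>.\<close>

lemma integration_by_parts:
  fixes f g :: "real^'n::finite \<Rightarrow> real"
  assumes f: "C_k (Suc 0) f" and g: "C_k (Suc 0) g" and K: "compact K" "\<And>x. x \<notin> K \<Longrightarrow> g x = 0"
  shows "(LINT x|lborel. f x * partial_deriv i g x) = - (LINT x|lborel. partial_deriv i f x * g x)"
proof -
  have zero: "partial_deriv i g x = 0" if "x \<notin> K" for x
    using partial_deriv_zero_off[of K g x i] compact_imp_closed[OF K(1)] K(2) that by blast
  have cont: "continuous_on UNIV (partial_deriv i f)" "continuous_on UNIV (partial_deriv i g)"
    using f g by auto
  have i: "integrable lborel (\<lambda>x. f x * partial_deriv i g x)" "integrable lborel (\<lambda>x. partial_deriv i f x * g x)"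
    using K zero cont C_k_continuous_on[OF f] C_k_continuous_on[OF g]
    by (auto intro!: integrable_compact_support[of _ K] continuous_on_mult)
  have "(LINT x|lborel. partial_deriv i (\<lambda>x. f x * g x) x) = 0"
    using K by (intro integral_partial_deriv_zero[of _ K] C_k_mult f g) auto
  also have "partial_deriv i (\<lambda>x. f x * g x) = (\<lambda>x. f x * partial_deriv i g x + partial_deriv i f x * g x)"
    using f g by (intro ext partial_deriv_mult) auto
  finally show ?thesis
    using i by simp
qed

section \<open>The Sobolev space\<close>

context
  fixes \<Omega> :: "(real^'n::finite) set"
  assumes \<Omega>: "open \<Omega>"
begin

interpretation L2: semi_inner_on "L2 \<Omega>" "inner_2 \<Omega>"
  by (rule semi_inner_on_L2[OF \<Omega>])

lemma abs_lebfun_in_L2: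
  assumes f: "continuous_on UNIV f" and K: "compact K" "K \<subseteq> \<Omega>" "\<And>x. x \<notin> K \<Longrightarrow> f x = 0"
  shows "abs_lebfun f \<in> L2 \<Omega>"
proof -
  have m: "f \<in> borel_measurable borel"
    using f by (rule borel_measurable_continuous_onI)
  have "integrable lborel (\<lambda>x. (f x)\<^sup>2)"
    using f K by (intro integrable_compact_support[of _ K] continuous_on_power) auto
  then have "sq_integrable lborel (rep_lebfun (abs_lebfun f))"
    using m by (subst sq_integrable_cong_AE[OF rep_abs_lebfun]) (auto simp: sq_integrable_def)
  moreover have "AE x in lborel. x \<notin> \<Omega> \<longrightarrow> rep_lebfun (abs_lebfun f) x = 0"
    using rep_abs_lebfun[OF m] by eventually_elim (use K in auto)
  ultimately show ?thesis
    by (simp add: L2_iff[OF \<Omega>])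
qed

lemma inner_2_abs_lebfun:
  assumes "continuous_on UNIV f"
  shows "inner_2 \<Omega> u (abs_lebfun f) = (LINT x:\<Omega>|lborel. rep_lebfun u x * f x)"
proof -
  have m [measurable]: "f \<in> borel_measurable borel" "\<Omega> \<in> sets borel"
    using assms \<Omega> by (auto intro: borel_measurable_continuous_onI)
  have "AE x in lborel. indicator \<Omega> x *\<^sub>R (rep_lebfun u x * rep_lebfun (abs_lebfun f) x) =
      indicator \<Omega> x *\<^sub>R (rep_lebfun u x * f x)"
    using rep_abs_lebfun[OF m(1)] by eventually_elim simp
  then show ?thesis
    unfolding inner_2_def set_lebesgue_integral_def by (intro integral_cong_AE) auto
qed

lemma inner_2_abs_abs:
  assumes f: "continuous_on UNIV f" and g: "continuous_on UNIV g" and zero: "\<And>x. x \<notin> \<Omega> \<Longrightarrow> g x = 0"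
  shows "inner_2 \<Omega> (abs_lebfun f) (abs_lebfun g) = (LINT x|lborel. f x * g x)"
proof -
  have m [measurable]: "f \<in> borel_measurable borel" "g \<in> borel_measurable borel" "\<Omega> \<in> sets borel"
    using f g \<Omega> by (auto intro: borel_measurable_continuous_onI)
  have "AE x in lborel. indicator \<Omega> x *\<^sub>R (rep_lebfun (abs_lebfun f) x * g x) = f x * g x"
    using rep_abs_lebfun[OF m(1)] by eventually_elim (use zero in \<open>auto simp: indicator_def\<close>)
  then show ?thesis
    unfolding inner_2_abs_lebfun[OF g] set_lebesgue_integral_def by (intro integral_cong_AE) auto
qed

lemma test_function_support:
  assumes "\<phi> \<in> test_functions \<Omega>"
  obtains K where "compact K" "K \<subseteq> \<Omega>" "\<And>x. x \<notin> K \<Longrightarrow> \<phi> x = 0" "\<And>i x. x \<notin> K \<Longrightarrow> partial_deriv i \<phi> x = 0"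
proof
  let ?K = "closure {x. \<phi> x \<noteq> 0}"
  show "compact ?K" "?K \<subseteq> \<Omega>" using assms by (auto simp: test_functions_def)
  show *: "\<phi> x = 0" if "x \<notin> ?K" for x
    using that closure_subset[of "{x. \<phi> x \<noteq> 0}"] by auto
  show "partial_deriv i \<phi> x = 0" if "x \<notin> ?K" for i x
    using partial_deriv_zero_off[of ?K \<phi> x i] * that by blast
qed

lemma test_function_continuous:
  assumes "\<phi> \<in> test_functions \<Omega>"
  shows "continuous_on UNIV \<phi>" "continuous_on UNIV (partial_deriv i \<phi>)"
  using test_functionsD(1,3)[OF assms] C_k_continuous_on by blast+

lemma test_function_in_L2:
  assumes "\<phi> \<in> test_functions \<Omega>"
  shows "abs_lebfun \<phi> \<in> L2 \<Omega>" "abs_lebfun (partial_deriv i \<phi>) \<in> L2 \<Omega>"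
proof -
  obtain K where K: "compact K" "K \<subseteq> \<Omega>" "\<And>x. x \<notin> K \<Longrightarrow> \<phi> x = 0"
    "\<And>i x. x \<notin> K \<Longrightarrow> partial_deriv i \<phi> x = 0"
    using test_function_support[OF assms] by blast
  show "abs_lebfun \<phi> \<in> L2 \<Omega>"
    by (rule abs_lebfun_in_L2[OF test_function_continuous(1)[OF assms] K(1-3)])
  show "abs_lebfun (partial_deriv i \<phi>) \<in> L2 \<Omega>"
    by (rule abs_lebfun_in_L2[OF test_function_continuous(2)[OF assms] K(1,2,4)])
qed

section \<open>Weak partial derivatives\<close>

lemma has_weak_partial_iff:
  "has_weak_partial \<Omega> i u v \<longleftrightarrow> (\<forall>\<phi>\<in>test_functions \<Omega>.
     inner_2 \<Omega> u (abs_lebfun (partial_deriv i \<phi>)) = - inner_2 \<Omega> v (abs_lebfun \<phi>))"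
  unfolding has_weak_partial_def
  by (intro ball_cong refl) (simp add: inner_2_abs_lebfun test_function_continuous)

text \<open>This makes weak derivatives unique, and hence the \<open>THE\<close> in
  \<open>weak_partial\<close> meaningful.\<close>

lemma L2_zeroI:
  assumes u: "u \<in> L2 \<Omega>" and zero: "\<And>\<phi>. \<phi> \<in> test_functions \<Omega> \<Longrightarrow> inner_2 \<Omega> u (abs_lebfun \<phi>) = 0"
  shows "u = 0"
proof -
  have "set_integrable lborel (cbox a b) (rep_lebfun u)" for a b
  proof -
    \<comment> \<open>Local integrability of \<open>u\<close>: boxes have finite measure, so their
      indicators are square integrable and may be paired with \<open>u\<close>.\<close>
    have "sq_integrable lborel (indicator (cbox a b) :: real^'n \<Rightarrow> real)"
      using emeasure_lborel_cbox_finite[of a b]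
      by (simp add: sq_integrable_def power2_eq_square flip: indicator_inter_arith)
    then show ?thesis
      using sq_integrable_mult[OF _ L2_sq_integrable[OF \<Omega> u]] by (simp add: set_integrable_def)
  qed
  moreover have "(LINT x:\<Omega>|lborel. rep_lebfun u x * \<phi> x) = 0" if "\<phi> \<in> test_functions \<Omega>" for \<phi>
    using zero[OF that] by (simp add: inner_2_abs_lebfun test_function_continuous that)
  ultimately have "AE x in lborel. x \<in> \<Omega> \<longrightarrow> rep_lebfun u x = 0"
    by (intro fundamental_lemma[OF \<Omega>]) auto
  moreover have "AE x in lborel. x \<notin> \<Omega> \<longrightarrow> rep_lebfun u x = 0"
    using u by (simp add: L2_iff[OF \<Omega>])
  ultimately have "AE x in lborel. rep_lebfun u x = rep_lebfun 0 x"
    using rep_lebfun_zero by eventually_elim auto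
  then show ?thesis by (rule lebfun_eqI)
qed

lemma weak_partial_eqI:
  assumes v: "v \<in> L2 \<Omega>" "has_weak_partial \<Omega> i u v"
  shows "weak_partial \<Omega> i u = v"
  unfolding weak_partial_def
proof (rule the_equality)
  fix w assume w: "w \<in> L2 \<Omega> \<and> has_weak_partial \<Omega> i u w"
  have "w - v = 0"
    using v w by (intro L2_zeroI) (auto simp: L2.mem has_weak_partial_iff L2.diff_left test_function_in_L2)
  then show "w = v" by simp
qed (use v in blast)

lemma W12_weak_partial:
  assumes "u \<in> W12 \<Omega>"
  shows "weak_partial \<Omega> i u \<in> L2 \<Omega>" "has_weak_partial \<Omega> i u (weak_partial \<Omega> i u)"
proof -
  obtain v where "v \<in> L2 \<Omega>" "has_weak_partial \<Omega> i u v"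
    using assms by (auto simp: W12_def)
  then show "weak_partial \<Omega> i u \<in> L2 \<Omega>" "has_weak_partial \<Omega> i u (weak_partial \<Omega> i u)"
    using weak_partial_eqI by auto
qed

lemma W12_L2: "u \<in> W12 \<Omega> \<Longrightarrow> u \<in> L2 \<Omega>"
  by (simp add: W12_def)

lemma W12I:
  assumes "u \<in> L2 \<Omega>" "\<And>i. v i \<in> L2 \<Omega>" "\<And>i. has_weak_partial \<Omega> i u (v i)"
  shows "u \<in> W12 \<Omega>"
  using assms by (auto simp: W12_def)

lemma has_weak_partial_add:
  assumes "u \<in> W12 \<Omega>" "v \<in> W12 \<Omega>"
  shows "has_weak_partial \<Omega> i (u + v) (weak_partial \<Omega> i u + weak_partial \<Omega> i v)"
  using W12_weak_partial(2)[OF assms(1)] W12_weak_partial(2)[OF assms(2)] W12_weak_partial(1) assms W12_L2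
  by (simp add: has_weak_partial_iff L2.add_left test_function_in_L2)

lemma has_weak_partial_scaleR:
  assumes "u \<in> W12 \<Omega>"
  shows "has_weak_partial \<Omega> i (c *\<^sub>R u) (c *\<^sub>R weak_partial \<Omega> i u)"
  using W12_weak_partial(2)[OF assms(1)] W12_weak_partial(1) assms W12_L2
  by (simp add: has_weak_partial_iff L2.scale_left test_function_in_L2)

lemma subspace_W12: "subspace (W12 \<Omega>)"
  unfolding subspace_def
proof (intro conjI ballI allI)
  have "has_weak_partial \<Omega> i 0 0" for i
    using L2.scale_left[OF L2.mem(1), where c = 0]
    by (simp add: has_weak_partial_iff test_function_in_L2)
  then show "0 \<in> W12 \<Omega>"
    using L2.mem(1) by (auto simp: W12_def)
  show "u + v \<in> W12 \<Omega>" if "u \<in> W12 \<Omega>" "v \<in> W12 \<Omega>" for u v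
    by (rule W12I[OF L2.mem(2)[OF W12_L2 W12_L2] L2.mem(2)[OF W12_weak_partial(1) W12_weak_partial(1)]
          has_weak_partial_add]) (rule that)+
  show "c *\<^sub>R u \<in> W12 \<Omega>" if "u \<in> W12 \<Omega>" for u c
    by (rule W12I[OF L2.mem(5)[OF W12_L2] L2.mem(5)[OF W12_weak_partial(1)] has_weak_partial_scaleR])
      (rule that)+
qed

lemma weak_partial_add:
  "u \<in> W12 \<Omega> \<Longrightarrow> v \<in> W12 \<Omega> \<Longrightarrow> weak_partial \<Omega> i (u + v) = weak_partial \<Omega> i u + weak_partial \<Omega> i v"
  by (intro weak_partial_eqI has_weak_partial_add L2.mem W12_weak_partial)

lemma weak_partial_scaleR:
  "u \<in> W12 \<Omega> \<Longrightarrow> weak_partial \<Omega> i (c *\<^sub>R u) = c *\<^sub>R weak_partial \<Omega> i u"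
  by (intro weak_partial_eqI has_weak_partial_scaleR L2.mem W12_weak_partial)

lemma weak_partial_diff:
  "u \<in> W12 \<Omega> \<Longrightarrow> v \<in> W12 \<Omega> \<Longrightarrow> weak_partial \<Omega> i (u - v) = weak_partial \<Omega> i u - weak_partial \<Omega> i v"
  using weak_partial_add[of "u - v" v i] subspace_diff[OF subspace_W12, of u v] by simp

lemma inner_nabla_eq:
  assumes u: "u \<in> W12 \<Omega>" and v: "v \<in> W12 \<Omega>"
  shows "inner_nabla \<Omega> u v = (\<Sum>i\<in>UNIV. inner_2 \<Omega> (weak_partial \<Omega> i u) (weak_partial \<Omega> i v))"
proof -
  have "integrable lborel (\<lambda>x. indicator \<Omega> x *\<^sub>R (rep_lebfun (weak_partial \<Omega> i u) x * rep_lebfun (weak_partial \<Omega> i v) x))" for i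
    using W12_weak_partial(1)[OF u] W12_weak_partial(1)[OF v] \<Omega>
    by (intro integrable_mult_indicator sq_integrable_mult[OF L2_sq_integrable[OF \<Omega>] L2_sq_integrable[OF \<Omega>]]) auto
  then show ?thesis
    unfolding inner_nabla_def inner_2_def set_lebesgue_integral_def
    by (simp only: scaleR_sum_right Bochner_Integration.integral_sum)
qed

lemma semi_inner_on_W12_2: "semi_inner_on (W12 \<Omega>) (inner_2 \<Omega>)"
  by standard (auto simp: W12_L2 L2.sym L2.add_left L2.scale_left L2.nonneg subspace_W12)

lemma semi_inner_on_nabla: "semi_inner_on (W12 \<Omega>) (inner_nabla \<Omega>)"
proof
  show "subspace (W12 \<Omega>)" by (rule subspace_W12)
  note mem = subspace_add[OF subspace_W12] subspace_scale[OF subspace_W12]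
  show "inner_nabla \<Omega> x y = inner_nabla \<Omega> y x" for x y
    by (simp add: inner_nabla_def mult.commute)
  show "inner_nabla \<Omega> (x + y) z = inner_nabla \<Omega> x z + inner_nabla \<Omega> y z"
    if "x \<in> W12 \<Omega>" "y \<in> W12 \<Omega>" "z \<in> W12 \<Omega>" for x y z
    using that by (simp add: inner_nabla_eq mem weak_partial_add L2.add_left W12_weak_partial(1) sum.distrib)
  show "inner_nabla \<Omega> (c *\<^sub>R x) y = c * inner_nabla \<Omega> x y" if "x \<in> W12 \<Omega>" "y \<in> W12 \<Omega>" for x y c
    using that by (simp add: inner_nabla_eq mem weak_partial_scaleR L2.scale_left W12_weak_partial(1) sum_distrib_left)
  show "0 \<le> inner_nabla \<Omega> x x" if "x \<in> W12 \<Omega>" for x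
    using that by (simp add: inner_nabla_eq sum_nonneg L2.nonneg W12_weak_partial(1))
qed

end

section \<open>The norm of \<open>W12\<close> and its completeness\<close>

context
  fixes \<Omega> :: "(real^'n::finite) set"
  assumes \<Omega>: "open \<Omega>"
begin

interpretation L2: semi_inner_on "L2 \<Omega>" "inner_2 \<Omega>"
  by (rule semi_inner_on_L2[OF \<Omega>])

interpretation nabla: semi_inner_on "W12 \<Omega>" "inner_nabla \<Omega>"
  by (rule semi_inner_on_nabla[OF \<Omega>])

lemma inner_2_nonneg: "0 \<le> inner_2 \<Omega> u u"
  by (simp add: inner_2_def set_lebesgue_integral_def)

lemma inner_nabla_nonneg: "0 \<le> inner_nabla \<Omega> u u"
  unfolding inner_nabla_def set_lebesgue_integral_def
  by (intro Bochner_Integration.integral_nonneg) (auto intro!: sum_nonneg simp: indicator_def)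

lemma rep_lebfun_uminus: "AE x in lborel. rep_lebfun (- u) x = - rep_lebfun u x"
  using rep_lebfun_scaleR[of "-1" u] by simp

lemma inner_2_uminus: "inner_2 \<Omega> (- u) v = - inner_2 \<Omega> u v" "inner_2 \<Omega> v (- u) = - inner_2 \<Omega> v u"
proof -
  have [measurable]: "\<Omega> \<in> sets borel" using \<Omega> by simp
  have "inner_2 \<Omega> (- u) v = (LINT x|lborel. - (indicator \<Omega> x *\<^sub>R (rep_lebfun u x * rep_lebfun v x)))"
    unfolding inner_2_def set_lebesgue_integral_def
  proof (intro integral_cong_AE)
    show "AE x in lborel. indicator \<Omega> x *\<^sub>R (rep_lebfun (- u) x * rep_lebfun v x) =
        - (indicator \<Omega> x *\<^sub>R (rep_lebfun u x * rep_lebfun v x))"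
      using rep_lebfun_uminus[of u] by eventually_elim simp
  qed measurable
  then show "inner_2 \<Omega> (- u) v = - inner_2 \<Omega> u v"
    by (simp add: inner_2_def set_lebesgue_integral_def)
  then show "inner_2 \<Omega> v (- u) = - inner_2 \<Omega> v u"
    by (simp add: inner_2_def mult.commute)
qed

lemma has_weak_partial_uminus: "has_weak_partial \<Omega> i (- u) v \<longleftrightarrow> has_weak_partial \<Omega> i u (- v)"
  unfolding has_weak_partial_iff[OF \<Omega>] by (auto simp: inner_2_uminus)

text \<open>For \<open>u\<close> without weak derivative both sides are the same \<open>THE\<close>-term with an empty predicate;
  \<open>Metric_space\<close> requires the symmetry of the distance on the whole type.\<close>

lemma weak_partial_uminus_cases:
  "weak_partial \<Omega> i (- u) = weak_partial \<Omega> i u \<or> weak_partial \<Omega> i (- u) = - weak_partial \<Omega> i u"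
proof (cases "\<exists>v\<in>L2 \<Omega>. has_weak_partial \<Omega> i u v")
  case True
  then obtain v where v: "v \<in> L2 \<Omega>" "has_weak_partial \<Omega> i u v" by blast
  have "weak_partial \<Omega> i u = v"
    by (rule weak_partial_eqI[OF \<Omega> v])
  moreover have "weak_partial \<Omega> i (- u) = - v"
    using v by (intro weak_partial_eqI[OF \<Omega>]) (simp_all add: L2.mem has_weak_partial_uminus)
  ultimately show ?thesis by simp
next
  case False
  then have "(\<lambda>v. v \<in> L2 \<Omega> \<and> has_weak_partial \<Omega> i u v) = (\<lambda>_. False)"
    by blast
  moreover have "(\<lambda>v. v \<in> L2 \<Omega> \<and> has_weak_partial \<Omega> i (- u) v) = (\<lambda>_. False)"
    using False L2.mem(4) by (auto simp: has_weak_partial_uminus)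
  ultimately show ?thesis
    by (simp only: weak_partial_def simp_thms)
qed

lemma inner_nabla_uminus: "inner_nabla \<Omega> (- u) (- u) = inner_nabla \<Omega> u u"
proof -
  have [measurable]: "\<Omega> \<in> sets borel" using \<Omega> by simp
  let ?D = "\<lambda>u i x. rep_lebfun (weak_partial \<Omega> i u) x * rep_lebfun (weak_partial \<Omega> i u) x"
  have "AE x in lborel. ?D (- u) i x = ?D u i x" for i
    using weak_partial_uminus_cases[of i u]
  proof
    assume "weak_partial \<Omega> i (- u) = - weak_partial \<Omega> i u"
    then show ?thesis
      using rep_lebfun_uminus[of "weak_partial \<Omega> i u"] by (auto elim: eventually_mono)
  qed simp
  then have "AE x in lborel. \<forall>i. ?D (- u) i x = ?D u i x"
    by (simp add: AE_all_countable)
  then have "AE x in lborel. indicator \<Omega> x *\<^sub>R (\<Sum>i\<in>UNIV. ?D (- u) i x) = indicator \<Omega> x *\<^sub>R (\<Sum>i\<in>UNIV. ?D u i x)"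
    by eventually_elim simp
  then show ?thesis
    unfolding inner_nabla_def set_lebesgue_integral_def by (intro integral_cong_AE) auto
qed

lemma inner_2_le_12: "inner_2 \<Omega> u u \<le> inner_12 \<Omega> u u"
  using inner_nabla_nonneg by (simp add: inner_12_def)

lemma inner_nabla_le_12: "inner_nabla \<Omega> u u \<le> inner_12 \<Omega> u u"
  using inner_2_nonneg by (simp add: inner_12_def)

lemma weak_partial_le_nabla:
  assumes "u \<in> W12 \<Omega>"
  shows "inner_2 \<Omega> (weak_partial \<Omega> i u) (weak_partial \<Omega> i u) \<le> inner_nabla \<Omega> u u"
  unfolding inner_nabla_eq[OF \<Omega> assms assms]
  by (rule member_le_sum) (auto simp: inner_2_nonneg)

lemma weak_partial_le_12:
  assumes "u \<in> W12 \<Omega>"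
  shows "inner_2 \<Omega> (weak_partial \<Omega> i u) (weak_partial \<Omega> i u) \<le> inner_12 \<Omega> u u"
  using weak_partial_le_nabla[OF assms, of i] inner_2_nonneg[of u] by (simp add: inner_12_def)

lemma norm_on_W12: "norm_on (W12 \<Omega>) (norm_12 \<Omega>)"
proof (rule semi_inner_on.norm_onI)
  interpret b: semi_inner_on "W12 \<Omega>" "inner_2 \<Omega>"
    by (rule semi_inner_on_W12_2[OF \<Omega>])
  show "semi_inner_on (W12 \<Omega>) (inner_12 \<Omega>)"
    by standard
      (simp_all add: inner_12_def b.sub b.sym nabla.sym b.add_left nabla.add_left b.scale_left nabla.scale_left
        b.nonneg nabla.nonneg distrib_left)
  show "u = 0" if "u \<in> W12 \<Omega>" "inner_12 \<Omega> u u = 0" for u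
    using that inner_2_le_12[of u] inner_2_nonneg[of u] W12_L2[OF \<Omega>]
    by (intro inner_2_definite[OF \<Omega>]) auto
  show "0 \<le> norm_12 \<Omega> u" for u
    using inner_2_nonneg[of u] inner_nabla_nonneg[of u] by (simp add: norm_12_def inner_12_def)
  show "norm_12 \<Omega> (- u) = norm_12 \<Omega> u" for u
    by (simp add: norm_12_def inner_12_def inner_2_uminus inner_nabla_uminus)
qed (simp add: norm_12_def)

interpretation W: norm_on "W12 \<Omega>" "norm_12 \<Omega>"
  by (rule norm_on_W12)

lemma inner_2_tendsto:
  assumes "\<And>n. \<sigma> n \<in> L2 \<Omega>" "u \<in> L2 \<Omega>" "w \<in> L2 \<Omega>"
    and lim: "(\<lambda>n. sqrt (inner_2 \<Omega> (\<sigma> n - u) (\<sigma> n - u))) \<longlonglongrightarrow> 0"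
  shows "(\<lambda>n. inner_2 \<Omega> (\<sigma> n) w) \<longlonglongrightarrow> inner_2 \<Omega> u w"
proof (rule metric_tendsto_imp_tendsto)
  show "(\<lambda>n. L2.nrm (\<sigma> n - u) * L2.nrm w) \<longlonglongrightarrow> 0"
    using tendsto_mult_right[OF lim, of "L2.nrm w"] by (simp add: L2.nrm_def)
  have "\<bar>inner_2 \<Omega> (\<sigma> n) w - inner_2 \<Omega> u w\<bar> \<le> L2.nrm (\<sigma> n - u) * L2.nrm w" for n
    using L2.Cauchy_Schwarz[of "\<sigma> n - u" w] assms by (simp add: L2.diff_left L2.mem)
  then show "\<forall>\<^sub>F n in sequentially. dist (inner_2 \<Omega> (\<sigma> n) w) (inner_2 \<Omega> u w) \<le> dist (L2.nrm (\<sigma> n - u) * L2.nrm w) 0"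
    by (intro always_eventually allI) (simp add: dist_real_def order_trans[OF _ abs_ge_self])
qed

text \<open>The functions and each of their weak partials converge in L2. For a fixed test function
  both sides of the defining identity are continuous in L2, so the limits of the partials are the
  weak partials of the limit.\<close>

theorem complete_W12: "complete_on (W12 \<Omega>) (norm_12 \<Omega>)"
  unfolding complete_on_def
proof (intro allI impI; elim conjE)
  fix \<sigma> :: "nat \<Rightarrow> 'n lebfun"
  assume ran: "range \<sigma> \<subseteq> W12 \<Omega>" and C: "Cauchy_on (norm_12 \<Omega>) \<sigma>"
  have \<sigma>: "\<sigma> n \<in> W12 \<Omega>" for n using ran by auto
  let ?D = "\<lambda>i n. weak_partial \<Omega> i (\<sigma> n)"
  let ?N = "\<lambda>u. sqrt (inner_2 \<Omega> u u)"
  have L2: "\<sigma> n \<in> L2 \<Omega>" "?D i n \<in> L2 \<Omega>" for i n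
    using W12_L2[OF \<Omega> \<sigma>] W12_weak_partial(1)[OF \<Omega> \<sigma>] by auto
  have C2: "Cauchy_on ?N \<sigma>"
    using C by (rule Cauchy_on_mono) (simp add: norm_12_def inner_2_le_12)
  obtain u where u: "u \<in> L2 \<Omega>" "(\<lambda>n. ?N (\<sigma> n - u)) \<longlonglongrightarrow> 0"
    by (rule complete_onD[OF complete_L2[OF \<Omega>] L2(1) C2])
  have "\<exists>v\<in>L2 \<Omega>. (\<lambda>n. ?N (?D i n - v)) \<longlonglongrightarrow> 0" for i
  proof -
    have CD: "Cauchy_on ?N (?D i)"
      using C
    proof (rule Cauchy_on_mono)
      show "?N (?D i m - ?D i n) \<le> norm_12 \<Omega> (\<sigma> m - \<sigma> n)" for m n
        using weak_partial_le_12[OF W.mem(3)[OF \<sigma> \<sigma>], of i m n] weak_partial_diff[OF \<Omega> \<sigma> \<sigma>]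
        by (simp add: norm_12_def)
    qed
    show ?thesis
      by (rule complete_onD[OF complete_L2[OF \<Omega>] L2(2) CD]) blast
  qed
  then have "\<exists>v. \<forall>i. v i \<in> L2 \<Omega> \<and> (\<lambda>n. ?N (?D i n - v i)) \<longlonglongrightarrow> 0"
    by (intro choice) blast
  then obtain v where v: "\<And>i. v i \<in> L2 \<Omega>" "\<And>i. (\<lambda>n. ?N (?D i n - v i)) \<longlonglongrightarrow> 0"
    by blast
  have weak: "has_weak_partial \<Omega> i u (v i)" for i
    unfolding has_weak_partial_iff[OF \<Omega>]
  proof
    fix \<phi> assume \<phi>: "\<phi> \<in> test_functions \<Omega>"
    note \<phi>L2 = test_function_in_L2[OF \<Omega> \<phi>]
    have "(\<lambda>n. inner_2 \<Omega> (\<sigma> n) (abs_lebfun (partial_deriv i \<phi>))) \<longlonglongrightarrow> inner_2 \<Omega> u (abs_lebfun (partial_deriv i \<phi>))"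
      by (rule inner_2_tendsto[OF L2(1) u(1) \<phi>L2(2) u(2)])
    moreover have "(\<lambda>n. - inner_2 \<Omega> (?D i n) (abs_lebfun \<phi>)) \<longlonglongrightarrow> - inner_2 \<Omega> (v i) (abs_lebfun \<phi>)"
      by (intro tendsto_minus inner_2_tendsto[OF L2(2) v(1) \<phi>L2(1) v(2)])
    moreover have "inner_2 \<Omega> (\<sigma> n) (abs_lebfun (partial_deriv i \<phi>)) = - inner_2 \<Omega> (?D i n) (abs_lebfun \<phi>)" for n
      using W12_weak_partial(2)[OF \<Omega> \<sigma>] \<phi> unfolding has_weak_partial_iff[OF \<Omega>] by blast
    ultimately show "inner_2 \<Omega> u (abs_lebfun (partial_deriv i \<phi>)) = - inner_2 \<Omega> (v i) (abs_lebfun \<phi>)"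
      using LIMSEQ_unique by simp
  qed
  have uW: "u \<in> W12 \<Omega>"
    by (rule W12I[OF \<Omega> u(1) v(1) weak])
  have Du: "weak_partial \<Omega> i u = v i" for i
    by (rule weak_partial_eqI[OF \<Omega> v(1) weak])
  have sq: "(\<lambda>n. inner_2 \<Omega> (\<tau> n) (\<tau> n)) \<longlonglongrightarrow> 0" if "(\<lambda>n. ?N (\<tau> n)) \<longlonglongrightarrow> 0" for \<tau>
    using tendsto_power[OF that, of 2] by (simp add: inner_2_nonneg)
  have "norm_12 \<Omega> (\<sigma> n - u) = sqrt (inner_2 \<Omega> (\<sigma> n - u) (\<sigma> n - u) +
      (\<Sum>i\<in>UNIV. inner_2 \<Omega> (?D i n - v i) (?D i n - v i)))" for n
    by (simp add: norm_12_def inner_12_def inner_nabla_eq[OF \<Omega>] W.mem \<sigma> uW weak_partial_diff[OF \<Omega>] Du)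
  moreover have "(\<lambda>n. sqrt (inner_2 \<Omega> (\<sigma> n - u) (\<sigma> n - u) +
      (\<Sum>i\<in>UNIV. inner_2 \<Omega> (?D i n - v i) (?D i n - v i)))) \<longlonglongrightarrow> sqrt (0 + (\<Sum>i\<in>(UNIV::'n set). 0))"
    by (intro tendsto_intros sq u v)
  ultimately have "(\<lambda>n. norm_12 \<Omega> (\<sigma> n - u)) \<longlonglongrightarrow> 0"
    by (simp only: sum.neutral_const add_0 real_sqrt_zero)
  then show "\<exists>l\<in>W12 \<Omega>. (\<lambda>n. norm_12 \<Omega> (\<sigma> n - l)) \<longlonglongrightarrow> 0"
    using uW by blast
qed

section \<open>The Poincare inequality\<close>

text \<open>Places the test functions inside \<open>W12\<close>, where their closure is taken, and
  lets the Poincare inequality be computed with classical derivatives.\<close>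

lemma test_function_weak_partial:
  assumes \<phi>: "\<phi> \<in> test_functions \<Omega>"
  shows "abs_lebfun \<phi> \<in> W12 \<Omega>" "weak_partial \<Omega> i (abs_lebfun \<phi>) = abs_lebfun (partial_deriv i \<phi>)"
proof -
  have weak: "has_weak_partial \<Omega> i (abs_lebfun \<phi>) (abs_lebfun (partial_deriv i \<phi>))" for i
    unfolding has_weak_partial_iff[OF \<Omega>]
  proof
    fix \<psi> assume \<psi>: "\<psi> \<in> test_functions \<Omega>"
    obtain K where K: "compact K" "K \<subseteq> \<Omega>" "\<And>x. x \<notin> K \<Longrightarrow> \<psi> x = 0"
      "\<And>i x. x \<notin> K \<Longrightarrow> partial_deriv i \<psi> x = 0"
      using test_function_support[OF \<Omega> \<psi>] by blast
    have zero: "\<psi> x = 0" "partial_deriv i \<psi> x = 0" if "x \<notin> \<Omega>" for x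
      using K that by auto
    note cont = test_function_continuous[OF \<Omega> \<phi>] test_function_continuous[OF \<Omega> \<psi>]
    have "inner_2 \<Omega> (abs_lebfun \<phi>) (abs_lebfun (partial_deriv i \<psi>)) = (LINT x|lborel. \<phi> x * partial_deriv i \<psi> x)"
      by (rule inner_2_abs_abs[OF \<Omega> cont(1) cont(4) zero(2)])
    also have "\<dots> = - (LINT x|lborel. partial_deriv i \<phi> x * \<psi> x)"
      by (rule integration_by_parts[OF test_functionsD(1)[OF \<phi>] test_functionsD(1)[OF \<psi>] K(1) K(3)])
    also have "(LINT x|lborel. partial_deriv i \<phi> x * \<psi> x) = inner_2 \<Omega> (abs_lebfun (partial_deriv i \<phi>)) (abs_lebfun \<psi>)"
      by (rule inner_2_abs_abs[OF \<Omega> cont(2) cont(3) zero(1), symmetric])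
    finally show "inner_2 \<Omega> (abs_lebfun \<phi>) (abs_lebfun (partial_deriv i \<psi>)) =
        - inner_2 \<Omega> (abs_lebfun (partial_deriv i \<phi>)) (abs_lebfun \<psi>)" .
  qed
  note L = test_function_in_L2[OF \<Omega> \<phi>]
  show "abs_lebfun \<phi> \<in> W12 \<Omega>"
    by (rule W12I[OF \<Omega> L(1) L(2) weak])
  show "weak_partial \<Omega> i (abs_lebfun \<phi>) = abs_lebfun (partial_deriv i \<phi>)"
    by (rule weak_partial_eqI[OF \<Omega> L(2) weak])
qed

lemma C_k_component: "C_k (Suc 0) (\<lambda>x::real^'n. x $ i)"
proof -
  have d: "((\<lambda>x::real^'n. x $ i) has_derivative (\<lambda>h. h $ i)) (at x)" for x
    by (intro bounded_linear_imp_has_derivative bounded_linear_vec_nth)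
  have "partial_deriv j (\<lambda>x::real^'n. x $ i) = (\<lambda>_. axis j 1 $ i)" for j
    by (rule ext) (rule partial_deriv_eqI[OF d])
  then show ?thesis
    using d by (auto simp: differentiable_def)
qed

text \<open>The coordinate \<open>x $ i\<close> has partial derivative 1, so integration by parts
  turns the integral of \<phi> squared into -2 times that of
  \<open>x $ i * \<phi> x * partial_deriv i \<phi> x\<close>. The coordinate is at most
  \<open>R\<close> on \<open>\<Omega>\<close>; Cauchy-Schwarz and division by the norm of \<phi>
  leave \<open>2 * R\<close>.\<close>

lemma poincare_test_function:
  assumes \<phi>: "\<phi> \<in> test_functions \<Omega>" and R: "R \<ge> 0" "\<And>x. x \<in> \<Omega> \<Longrightarrow> norm x \<le> R"
  shows "L2.nrm (abs_lebfun \<phi>) \<le> 2 * R * L2.nrm (abs_lebfun (partial_deriv i \<phi>))"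
proof -
  obtain K where K: "compact K" "K \<subseteq> \<Omega>" "\<And>x. x \<notin> K \<Longrightarrow> \<phi> x = 0"
    "\<And>i x. x \<notin> K \<Longrightarrow> partial_deriv i \<phi> x = 0"
    using test_function_support[OF \<Omega> \<phi>] by blast
  have zero: "\<phi> x = 0" "partial_deriv i \<phi> x = 0" if "x \<notin> \<Omega>" for x
    using K that by auto
  note cont = test_function_continuous[OF \<Omega> \<phi>]
  note L = test_function_in_L2[OF \<Omega> \<phi>]
  let ?u = "abs_lebfun \<phi>" and ?D = "abs_lebfun (partial_deriv i \<phi>)"
  let ?xu = "abs_lebfun (\<lambda>x. x $ i * \<phi> x)"
  have cx: "continuous_on UNIV (\<lambda>x. x $ i * \<phi> x)"
    using cont by (intro continuous_intros)
  have xL: "?xu \<in> L2 \<Omega>"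
    using K by (intro abs_lebfun_in_L2[OF \<Omega> cx]) auto
  have i2: "integrable lborel (\<lambda>x. \<phi> x * \<phi> x)" "integrable lborel (\<lambda>x. (x $ i * \<phi> x) * (x $ i * \<phi> x))"
    using cont cx K by (auto intro!: integrable_compact_support[of _ K] continuous_on_mult)
  have uu: "inner_2 \<Omega> ?u ?u = (LINT x|lborel. \<phi> x * \<phi> x)"
    by (rule inner_2_abs_abs[OF \<Omega> cont(1) cont(1) zero(1)])
  have xD: "inner_2 \<Omega> ?xu ?D = (LINT x|lborel. (x $ i * \<phi> x) * partial_deriv i \<phi> x)"
    by (rule inner_2_abs_abs[OF \<Omega> cx cont(2) zero(2)])
  have xx: "inner_2 \<Omega> ?xu ?xu = (LINT x|lborel. (x $ i * \<phi> x) * (x $ i * \<phi> x))"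
    using zero by (intro inner_2_abs_abs[OF \<Omega> cx cx]) simp
  have pd: "partial_deriv i (\<lambda>x. \<phi> x * \<phi> x) = (\<lambda>x. 2 * (\<phi> x * partial_deriv i \<phi> x))"
    using test_functionsD(2)[OF \<phi>] by (auto simp: partial_deriv_mult)
  have pc: "partial_deriv i (\<lambda>x::real^'n. x $ i) x = 1" for x
    by (subst partial_deriv_eqI[OF bounded_linear_imp_has_derivative[OF bounded_linear_vec_nth]]) simp
  have "(LINT x|lborel. x $ i * partial_deriv i (\<lambda>x. \<phi> x * \<phi> x) x) =
      - (LINT x|lborel. partial_deriv i (\<lambda>x. x $ i) x * (\<phi> x * \<phi> x))"
    using K(3) by (intro integration_by_parts[OF C_k_component _ K(1)] C_k_mult test_functionsD(1)[OF \<phi>]) auto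
  also have "(LINT x|lborel. x $ i * partial_deriv i (\<lambda>x. \<phi> x * \<phi> x) x) =
      (LINT x|lborel. 2 * ((x $ i * \<phi> x) * partial_deriv i \<phi> x))"
    unfolding pd by (simp add: mult_ac)
  also have "\<dots> = 2 * inner_2 \<Omega> ?xu ?D"
    unfolding xD by (rule integral_mult_right_zero)
  finally have eq: "inner_2 \<Omega> ?u ?u = - 2 * inner_2 \<Omega> ?xu ?D"
    unfolding uu pc by simp
  have "inner_2 \<Omega> ?xu ?xu \<le> (LINT x|lborel. R\<^sup>2 * (\<phi> x * \<phi> x))"
    unfolding xx
  proof (rule integral_mono)
    fix x
    show "(x $ i * \<phi> x) * (x $ i * \<phi> x) \<le> R\<^sup>2 * (\<phi> x * \<phi> x)"
    proof (cases "x \<in> \<Omega>")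
      case True
      then have "\<bar>x $ i\<bar> \<le> R"
        using R(2) component_le_norm_cart[of x i] by force
      then have "(x $ i)\<^sup>2 \<le> R\<^sup>2"
        by (simp add: abs_le_square_iff[symmetric])
      then have "(x $ i)\<^sup>2 * (\<phi> x)\<^sup>2 \<le> R\<^sup>2 * (\<phi> x)\<^sup>2"
        by (intro mult_right_mono) auto
      then show ?thesis by (simp add: power2_eq_square mult_ac)
    qed (simp add: zero)
  qed (use i2 in auto)
  also have "\<dots> = R\<^sup>2 * inner_2 \<Omega> ?u ?u"
    unfolding uu by (rule integral_mult_right_zero)
  finally have "sqrt (inner_2 \<Omega> ?xu ?xu) \<le> sqrt (R\<^sup>2 * inner_2 \<Omega> ?u ?u)"
    by (rule real_sqrt_le_mono)
  then have xb: "L2.nrm ?xu \<le> R * L2.nrm ?u"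
    using R(1) by (simp add: L2.nrm_def real_sqrt_mult)
  have "(L2.nrm ?u)\<^sup>2 = - 2 * inner_2 \<Omega> ?xu ?D"
    using eq L2.nrm_power2[OF L(1)] by simp
  also have "\<dots> \<le> 2 * (L2.nrm ?xu * L2.nrm ?D)"
    using L2.Cauchy_Schwarz[OF xL L(2)[of i]] by linarith
  also have "\<dots> \<le> 2 * ((R * L2.nrm ?u) * L2.nrm ?D)"
    using xb L2.nrm_nonneg[OF L(2)[of i]] by (intro mult_left_mono mult_right_mono) auto
  finally have "L2.nrm ?u * L2.nrm ?u \<le> L2.nrm ?u * (2 * R * L2.nrm ?D)"
    by (simp add: power2_eq_square mult_ac)
  then show ?thesis
    using L2.nrm_nonneg[OF L(1)] L2.nrm_nonneg[OF L(2)[of i]] R(1)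
    by (cases "L2.nrm ?u = 0") (auto simp: mult_le_cancel_left)
qed

lemma W12_0_iff:
  "u \<in> W12_0 \<Omega> \<longleftrightarrow> u \<in> W12 \<Omega> \<and> (\<forall>r>0. \<exists>\<phi>\<in>test_functions \<Omega>. norm_12 \<Omega> (u - abs_lebfun \<phi>) < r)"
  unfolding W12_0_def W12_topology_def W.metric_closure_of
  using test_function_weak_partial(1) by auto

lemma W12_0_closed:
  assumes "range \<sigma> \<subseteq> W12_0 \<Omega>" "l \<in> W12 \<Omega>" "(\<lambda>n. norm_12 \<Omega> (\<sigma> n - l)) \<longlonglongrightarrow> 0"
  shows "l \<in> W12_0 \<Omega>"
proof -
  have "closedin W.mtopology (W12_0 \<Omega>)"
    unfolding W12_0_def W12_topology_def by (rule closedin_closure_of)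
  moreover have "range \<sigma> \<subseteq> W12 \<Omega>"
    using assms(1) by (auto simp: W12_0_iff)
  then have "limitin W.mtopology \<sigma> l sequentially"
    using assms by (simp add: W.limitin_iff)
  ultimately show ?thesis
    using assms(1) unfolding W.metric_closedin_iff_sequentially_closed by blast
qed

text \<open>Both seminorms are dominated by \<open>norm_12\<close>, so the inequality survives
  approximation by test functions.\<close>

lemma poincare:
  assumes "bounded \<Omega>"
  obtains P where "P \<ge> 0" "\<And>u. u \<in> W12_0 \<Omega> \<Longrightarrow> sqrt (inner_2 \<Omega> u u) \<le> P * sqrt (inner_nabla \<Omega> u u)"
proof -
  obtain R where R: "R > 0" "\<And>x. x \<in> \<Omega> \<Longrightarrow> norm x \<le> R"
    using assms unfolding bounded_pos by blast
  let ?P = "2 * R"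
  have test: "L2.nrm (abs_lebfun \<phi>) \<le> ?P * nabla.nrm (abs_lebfun \<phi>)" if \<phi>: "\<phi> \<in> test_functions \<Omega>" for \<phi>
  proof -
    \<comment> \<open>Any single direction will do; the index type is nonempty.\<close>
    fix i :: 'n
    have "L2.nrm (abs_lebfun (partial_deriv i \<phi>)) \<le> nabla.nrm (abs_lebfun \<phi>)"
      using weak_partial_le_nabla[OF test_function_weak_partial(1)[OF \<phi>], of i] test_function_weak_partial(2)[OF \<phi>]
      by (simp add: L2.nrm_def nabla.nrm_def)
    then have "?P * L2.nrm (abs_lebfun (partial_deriv i \<phi>)) \<le> ?P * nabla.nrm (abs_lebfun \<phi>)"
      using R by (intro mult_left_mono) auto
    moreover have "L2.nrm (abs_lebfun \<phi>) \<le> ?P * L2.nrm (abs_lebfun (partial_deriv i \<phi>))"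
      using R by (intro poincare_test_function[OF \<phi>]) auto
    ultimately show ?thesis by linarith
  qed
  have "L2.nrm u \<le> ?P * nabla.nrm u" if u: "u \<in> W12_0 \<Omega>" for u
  proof (rule field_le_epsilon)
    fix e :: real assume e: "e > 0"
    \<comment> \<open>An approximation within \<open>r\<close> costs \<open>r\<close> in the L2 norm
      and \<open>?P * r\<close> through the gradient, together \<open>e\<close>.\<close>
    define r where "r = e / (1 + ?P)"
    have "r * (1 + ?P) = e"
      using R unfolding r_def by simp
    moreover have "r > 0"
      using e R unfolding r_def by simp
    ultimately have r: "r > 0" "r + ?P * r = e"
      by (simp_all add: algebra_simps)
    have uW: "u \<in> W12 \<Omega>" using u by (simp add: W12_0_iff)
    obtain \<phi> where \<phi>: "\<phi> \<in> test_functions \<Omega>" "norm_12 \<Omega> (u - abs_lebfun \<phi>) < r"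
      using u r by (auto simp: W12_0_iff)
    note \<phi>W = test_function_weak_partial(1)[OF \<phi>(1)]
    have dW: "u - abs_lebfun \<phi> \<in> W12 \<Omega>" using W.mem(3)[OF uW \<phi>W] .
    have "L2.nrm (u - abs_lebfun \<phi>) \<le> norm_12 \<Omega> (u - abs_lebfun \<phi>)"
      "nabla.nrm (u - abs_lebfun \<phi>) \<le> norm_12 \<Omega> (u - abs_lebfun \<phi>)"
      unfolding L2.nrm_def nabla.nrm_def norm_12_def
      by (simp_all only: real_sqrt_le_iff inner_2_le_12 inner_nabla_le_12)
    then have small: "L2.nrm (u - abs_lebfun \<phi>) \<le> r" "nabla.nrm (u - abs_lebfun \<phi>) \<le> r"
      using \<phi>(2) by linarith+
    have "L2.nrm u \<le> L2.nrm (u - abs_lebfun \<phi>) + L2.nrm (abs_lebfun \<phi>)"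
      using L2.nrm_add[of "u - abs_lebfun \<phi>" "abs_lebfun \<phi>"] W12_L2[OF \<Omega>] dW \<phi>W by simp
    also have "\<dots> \<le> r + ?P * nabla.nrm (abs_lebfun \<phi>)"
      using small test[OF \<phi>(1)] by simp
    also have "nabla.nrm (abs_lebfun \<phi>) \<le> nabla.nrm u + r"
      using nabla.nrm_diff[OF uW dW] small by simp
    then have "r + ?P * nabla.nrm (abs_lebfun \<phi>) \<le> r + ?P * (nabla.nrm u + r)"
      using R by (intro add_left_mono mult_left_mono) auto
    also have "\<dots> = ?P * nabla.nrm u + e"
      unfolding r(2)[symmetric] by (simp add: algebra_simps)
    finally show "L2.nrm u \<le> ?P * nabla.nrm u + e" .
  qed
  then show ?thesis
    using that[of ?P] R by (simp add: L2.nrm_def nabla.nrm_def)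
qed

lemma quadratic_minimization_W12:
  assumes "bounded \<Omega>" "subspace (W12_0 \<Omega>)"
  obtains P where "quadratic_minimization (W12 \<Omega>) (inner_nabla \<Omega>) (inner_2 \<Omega>) (norm_12 \<Omega>) (W12_0 \<Omega>) P"
proof -
  interpret b: semi_inner_on "W12 \<Omega>" "inner_2 \<Omega>"
    by (rule semi_inner_on_W12_2[OF \<Omega>])
  obtain P where P: "P \<ge> 0" "\<And>u. u \<in> W12_0 \<Omega> \<Longrightarrow> sqrt (inner_2 \<Omega> u u) \<le> P * sqrt (inner_nabla \<Omega> u u)"
    using poincare[OF assms(1)] by blast
  have "quadratic_minimization (W12 \<Omega>) (inner_nabla \<Omega>) (inner_2 \<Omega>) (norm_12 \<Omega>) (W12_0 \<Omega>) P"
  proof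
    show "norm_12 \<Omega> x = sqrt (inner_2 \<Omega> x x + inner_nabla \<Omega> x x)" for x
      by (simp add: norm_12_def inner_12_def)
    show "W12_0 \<Omega> \<subseteq> W12 \<Omega>"
      by (auto simp: W12_0_iff)
    show "b.nrm h \<le> P * nabla.nrm h" if "h \<in> W12_0 \<Omega>" for h
      using P(2)[OF that] by (simp add: b.nrm_def nabla.nrm_def)
  qed (use P assms(2) complete_W12 W12_0_closed in auto)
  then show ?thesis by (rule that)
qed

end

section \<open>The solution map on the border space\<close>

lemma inner_2_functional:
  assumes \<Omega>: "open \<Omega>" and f: "f \<in> L2 \<Omega>"
  shows "linear_between (W12 \<Omega>) UNIV (inner_2 \<Omega> f)"
    "\<exists>F\<ge>0. \<forall>x\<in>W12 \<Omega>. \<bar>inner_2 \<Omega> f x\<bar> \<le> F * sqrt (inner_2 \<Omega> x x)"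
proof -
  interpret L2: semi_inner_on "L2 \<Omega>" "inner_2 \<Omega>"
    by (rule semi_inner_on_L2[OF \<Omega>])
  show "linear_between (W12 \<Omega>) UNIV (inner_2 \<Omega> f)"
    using f W12_L2[OF \<Omega>] by (simp add: linear_between_def L2.add_right L2.scale_right)
  show "\<exists>F\<ge>0. \<forall>x\<in>W12 \<Omega>. \<bar>inner_2 \<Omega> f x\<bar> \<le> F * sqrt (inner_2 \<Omega> x x)"
    using L2.Cauchy_Schwarz[OF f] L2.nrm_nonneg[OF f] W12_L2[OF \<Omega>]
    by (intro exI[of _ "L2.nrm f"]) (auto simp: L2.nrm_def)
qed

lemma norm_nabla_power2: "open \<Omega> \<Longrightarrow> (norm_nabla \<Omega> w)\<^sup>2 = inner_nabla \<Omega> w w"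
  by (simp add: norm_nabla_def inner_nabla_nonneg)

text \<open>\<open>T\<close> vanishes on \<open>W12_0\<close>, so it is constant on a coset and
  \<open>the_elem\<close> returns that value.\<close>

lemma trace_quot_coset:
  assumes \<Omega>: "open \<Omega>" and T: "linear_between (W12 \<Omega>) Y T"
    and null: "{u \<in> W12 \<Omega>. T u = 0} = W12_0 \<Omega>" and g: "g \<in> W12 \<Omega>"
  shows "trace_quot T (coset \<Omega> g) = T g"
proof -
  have "0 \<in> W12_0 \<Omega>"
    using subspace_0[OF subspace_linear_kernel[OF T subspace_W12[OF \<Omega>]]] by (simp only: null)
  then have "g \<in> coset \<Omega> g"
    by (force simp: coset_def)
  moreover have "T x = T g" if "x \<in> coset \<Omega> g" for x
  proof -
    obtain h where h: "x = g + h" "h \<in> W12 \<Omega>" "T h = 0"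
      using \<open>x \<in> coset \<Omega> g\<close> null by (auto simp: coset_def)
    then show ?thesis
      using linear_betweenD(2)[OF T g h(2)] by simp
  qed
  ultimately have "T ` coset \<Omega> g = {T g}"
    by blast
  then show ?thesis by (simp add: trace_quot_def)
qed

theorem mainTheorem4:
  fixes \<Omega> :: "(real^'n::finite) set"
    and T :: "'n lebfun \<Rightarrow> 'n bdrfun"
    and f :: "'n lebfun"
  assumes "\<Omega> \<noteq> {}" and "bounded \<Omega>" and "open \<Omega>"
    and trace: "is_trace_map \<Omega> T"
    and trace_unique: "\<And>T'. is_trace_map \<Omega> T' \<Longrightarrow> (\<forall>u \<in> W12 \<Omega>. T' u = T u)"
    and trace_onto: "T ` W12 \<Omega> = W_half \<Omega>"
    and trace_null: "{u \<in> W12 \<Omega>. T u = 0} = W12_0 \<Omega>"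
    and f: "f \<in> L2 \<Omega>"
  shows "(\<forall>g\<^sub>0 \<in> W_half \<Omega>.
            (\<exists>!u. minimizes_on (energy \<Omega> f) {w \<in> W12 \<Omega>. T w = g\<^sub>0} u) \<and>
            minimizes_on (energy \<Omega> f) {w \<in> W12 \<Omega>. T w = g\<^sub>0} (S_quot \<Omega> f (E \<Omega> T g\<^sub>0)))
       \<and> affine_between (W_half \<Omega>) (W12 \<Omega>) (\<lambda>g\<^sub>0. S_quot \<Omega> f (E \<Omega> T g\<^sub>0))
       \<and> continuous_map (W_half_topology \<Omega>) (W12_topology \<Omega>) (\<lambda>g\<^sub>0. S_quot \<Omega> f (E \<Omega> T g\<^sub>0))
       \<and> (f = 0 \<longrightarrow> linear_between (W_half \<Omega>) (W12 \<Omega>) (\<lambda>g\<^sub>0. S_quot \<Omega> f (E \<Omega> T g\<^sub>0)))"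
proof -
  note \<Omega> = \<open>open \<Omega>\<close>
  note W = subspace_W12[OF \<Omega>]
  have T: "linear_between (W12 \<Omega>) (W_half \<Omega>) T"
    using trace by (simp add: is_trace_map_def)
  have W0: "subspace (W12_0 \<Omega>)"
    using subspace_linear_kernel[OF T W] by (simp only: trace_null)
  obtain P where "quadratic_minimization (W12 \<Omega>) (inner_nabla \<Omega>) (inner_2 \<Omega>) (norm_12 \<Omega>) (W12_0 \<Omega>) P"
    using quadratic_minimization_W12[OF \<Omega> \<open>bounded \<Omega>\<close> W0] by blast
  then interpret Q: quadratic_minimization "W12 \<Omega>" "inner_nabla \<Omega>" "inner_2 \<Omega>" "norm_12 \<Omega>" "W12_0 \<Omega>" P .
  interpret T: bounded_surjection "W12 \<Omega>" "norm_12 \<Omega>" "W_half \<Omega>" "norm_half \<Omega>" T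
    using norm_on_W12[OF \<Omega>] norm_on_W_half[of \<Omega>] T trace_onto trace complete_W12[OF \<Omega>] complete_W_half[of \<Omega>]
    by (simp add: bounded_surjection_def bounded_surjection_axioms_def is_trace_map_def)
  have T_eq: "T w = T g \<longleftrightarrow> w - g \<in> W12_0 \<Omega>" if "w \<in> W12 \<Omega>" "g \<in> W12 \<Omega>" for w g
    unfolding trace_null[symmetric] using T.T_diff[OF that] Q.mem(3)[OF that] by simp
  \<comment> \<open>Turns the constraint on the trace into the affine class of any lift, the form in
    which the abstract minimization applies.\<close>
  have class_eq: "{w \<in> W12 \<Omega>. T w = T g} = Q.shift g" if "g \<in> W12 \<Omega>" for g
    using T_eq that by (auto simp: Q.shift_def)
  have functional: "Q.functional (inner_2 \<Omega> k)" if "k \<in> L2 \<Omega>" for k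
    using inner_2_functional[OF \<Omega> that] by (simp add: Q.functional_def Q.b.nrm_def)
  have energy: "energy \<Omega> k = Q.J (inner_2 \<Omega> k)" for k
    by (rule ext) (simp add: energy_def Q.J_def norm_nabla_power2[OF \<Omega>])
  have S_min: "minimizes_on (energy \<Omega> k) (Q.shift g) (S \<Omega> k g)" if "k \<in> L2 \<Omega>" "g \<in> W12 \<Omega>" for k g
    unfolding S_def energy Q.shift_def[symmetric]
    by (rule theI'[OF Q.ex1_minimizer[OF functional[OF that(1)] that(2)]])
  let ?U = "\<lambda>k g\<^sub>0. S_quot \<Omega> k (E \<Omega> T g\<^sub>0)"
  \<comment> \<open>\<open>inv_into\<close> returns a class known only by its trace, so its
    representative \<open>g'\<close> may differ from \<open>g\<close>; equal traces give equal shift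
    classes, hence the same minimizer.\<close>
  have U_eq: "\<exists>g'. g' \<in> W12 \<Omega> \<and> T g' = T g \<and> ?U k (T g) = S \<Omega> k g'" if g: "g \<in> W12 \<Omega>" for k g
  proof -
    have "T g \<in> trace_quot T ` W12_quot \<Omega>"
      using trace_quot_coset[OF \<Omega> T trace_null g] g by (force simp: W12_quot_def)
    then have "E \<Omega> T (T g) \<in> W12_quot \<Omega>" "trace_quot T (E \<Omega> T (T g)) = T g"
      unfolding E_def by (rule inv_into_into, rule f_inv_into_f)
    then obtain g' where g': "g' \<in> W12 \<Omega>" "E \<Omega> T (T g) = coset \<Omega> g'" "T g' = T g"
      using trace_quot_coset[OF \<Omega> T trace_null] by (auto simp: W12_quot_def)
    have "S \<Omega> k x = S \<Omega> k g'" if x: "x \<in> coset \<Omega> g'" for x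
    proof -
      obtain h where h: "x = g' + h" "h \<in> W12_0 \<Omega>"
        using x by (auto simp: coset_def)
      then have "x \<in> W12 \<Omega>"
        using Q.mem(2)[OF g'(1) Q.in_V] by simp
      moreover from this have "T x = T g'"
        using T_eq[of x g'] g'(1) h by simp
      ultimately have "Q.shift x = Q.shift g'"
        using class_eq g'(1) by metis
      then show ?thesis by (simp add: S_def Q.shift_def)
    qed
    moreover have "g' \<in> coset \<Omega> g'"
      using Q.mem_0(1) by (force simp: coset_def)
    ultimately have "S \<Omega> k ` coset \<Omega> g' = {S \<Omega> k g'}"
      by blast
    then show ?thesis
      using g' by (auto simp: S_quot_def)
  qed
  have U_min: "minimizes_on (energy \<Omega> k) (Q.shift g) (?U k (T g))" if k: "k \<in> L2 \<Omega>" and g: "g \<in> W12 \<Omega>" for k g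
  proof -
    obtain g' where g': "g' \<in> W12 \<Omega>" "T g' = T g" "?U k (T g) = S \<Omega> k g'"
      using U_eq[OF g] by blast
    have "Q.shift g = Q.shift g'"
      using class_eq[OF g] class_eq[OF g'(1)] g'(2) by simp
    then show ?thesis
      using S_min[OF k g'(1)] g'(3) by simp
  qed
  \<comment> \<open>From here on, identities between values of the solution map are proved by
    showing that both sides solve the same Euler-Lagrange problem.\<close>
  have U_solves: "Q.solves (inner_2 \<Omega> k) g (?U k (T g))" if "k \<in> L2 \<Omega>" "g \<in> W12 \<Omega>" for k g
    using U_min[OF that] Q.minimizes_iff_solves[OF functional[OF that(1)]] by (simp add: energy)
  have 0: "0 \<in> L2 \<Omega>"
    using subspace_0[OF subspace_L2[OF \<Omega>]] .
  have zero: "inner_2 \<Omega> 0 h = 0" if "h \<in> W12 \<Omega>" for h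
    using semi_inner_on.scale_left[OF semi_inner_on_L2[OF \<Omega>] 0 W12_L2[OF \<Omega> that], of 0] by simp
  have U0_solves: "Q.solves (\<lambda>_. 0) g (?U 0 (T g))" if "g \<in> W12 \<Omega>" for g
    using U_solves[OF 0 that] zero Q.in_V by (simp add: Q.solves_def)
  have U_in: "?U k g\<^sub>0 \<in> W12 \<Omega>" if "k \<in> L2 \<Omega>" "g\<^sub>0 \<in> W_half \<Omega>" for k g\<^sub>0
    using U_solves[OF that(1)] that(2) unfolding trace_onto[symmetric] by (auto simp: Q.solves_def Q.shift_def)
  have lin: "linear_between (W_half \<Omega>) (W12 \<Omega>) (?U 0)"
    unfolding linear_between_def
  proof (intro conjI ballI allI)
    show "?U 0 \<in> W_half \<Omega> \<rightarrow> W12 \<Omega>"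
      using U_in[OF 0] by blast
    fix x assume "x \<in> W_half \<Omega>"
    then obtain g where g: "g \<in> W12 \<Omega>" "x = T g"
      unfolding trace_onto[symmetric] by blast
    show "?U 0 (x + y) = ?U 0 x + ?U 0 y" if y: "y \<in> W_half \<Omega>" for y
    proof -
      obtain h where h: "h \<in> W12 \<Omega>" "y = T h"
        using y unfolding trace_onto[symmetric] by blast
      have "Q.solves (\<lambda>_. 0) (g + h) (?U 0 x + ?U 0 y)"
        using Q.solves_linear[OF U0_solves[OF g(1)] U0_solves[OF h(1)], of 1] g h by simp
      moreover have "Q.solves (\<lambda>_. 0) (g + h) (?U 0 (x + y))"
        using U0_solves[OF Q.mem(2)[OF g(1) h(1)]] linear_betweenD(2)[OF T g(1) h(1)] g h by simp
      ultimately show ?thesis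
        using Q.solves_unique by blast
    qed
    show "?U 0 (c *\<^sub>R x) = c *\<^sub>R ?U 0 x" for c
    proof -
      \<comment> \<open>Homogeneity is superposition with the zero solution.\<close>
      have "Q.solves (\<lambda>_. 0) 0 0"
        using Q.mem_0(1) Q.in_V Q.a.scale_left[OF Q.mem(1), of _ 0] Q.mem(1)
        by (simp add: Q.solves_def Q.shift_def)
      then have "Q.solves (\<lambda>_. 0) (c *\<^sub>R g) (c *\<^sub>R ?U 0 x)"
        using Q.solves_linear[OF U0_solves[OF g(1)], of "\<lambda>_. 0" 0 0 c] g by simp
      moreover have "Q.solves (\<lambda>_. 0) (c *\<^sub>R g) (?U 0 (c *\<^sub>R x))"
        using U0_solves[OF Q.mem(5)[OF g(1)]] linear_betweenD(3)[OF T g(1)] g by simp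
      ultimately show ?thesis
        using Q.solves_unique by blast
    qed
  qed
  \<comment> \<open>The linear part is the source-free solution; the constant is the solution with
    source \<open>f\<close> and trace 0.\<close>
  have affine: "?U f g\<^sub>0 = ?U 0 g\<^sub>0 + ?U f 0" if g\<^sub>0: "g\<^sub>0 \<in> W_half \<Omega>" for g\<^sub>0
  proof -
    obtain g where g: "g \<in> W12 \<Omega>" "g\<^sub>0 = T g"
      using g\<^sub>0 unfolding trace_onto[symmetric] by blast
    have T0: "T 0 = 0"
      using linear_betweenD(3)[OF T Q.mem(1), of 0] by simp
    have "Q.solves (inner_2 \<Omega> f) g (?U 0 g\<^sub>0 + ?U f 0)"
      using Q.solves_linear[OF U0_solves[OF g(1)] U_solves[OF f Q.mem(1)], of 1] g T0 by simp
    moreover have "Q.solves (inner_2 \<Omega> f) g (?U f g\<^sub>0)"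
      using U_solves[OF f g(1)] g by simp
    ultimately show ?thesis
      using Q.solves_unique by blast
  qed
  have zero_half: "0 \<in> W_half \<Omega>"
    by (rule T.Y.mem(1))
  obtain K where K: "K \<ge> 0" "\<And>y. y \<in> W_half \<Omega> \<Longrightarrow> \<exists>x\<in>W12 \<Omega>. T x = y \<and> norm_12 \<Omega> x \<le> K * norm_half \<Omega> y"
    by (rule T.bounded_preimage) (rule that)
  \<comment> \<open>The stability constant times the lifting constant of the open mapping theorem;
    the summand 1 makes \<open>e / C\<close> a legitimate radius even for
    \<open>K = 0\<close>.\<close>
  define C where "C = (2 + 2 * P) * K + 1"
  have C: "C > 0"
    using Q.P K(1) by (simp add: C_def add_nonneg_pos)
  have bound: "norm_12 \<Omega> (?U f x - ?U f y) \<le> C * norm_half \<Omega> (x - y)"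
    if x: "x \<in> W_half \<Omega>" and y: "y \<in> W_half \<Omega>" for x y
  proof -
    have xy: "x - y \<in> W_half \<Omega>" using T.Y.mem(3)[OF x y] .
    obtain g where g: "g \<in> W12 \<Omega>" "T g = x - y" "norm_12 \<Omega> g \<le> K * norm_half \<Omega> (x - y)"
      using K(2)[OF xy] by blast
    \<comment> \<open>The source cancels in the difference, which therefore solves the problem
      without source for every lift of \<open>x - y\<close>, in particular for the small lift
      \<open>g\<close>.\<close>
    have "?U f x - ?U f y = ?U 0 (x - y)"
      using affine[OF x] affine[OF y] linear_between_diff[OF lin T.Y.sub x y] by simp
    then have "norm_12 \<Omega> (?U f x - ?U f y) \<le> (2 + 2 * P) * norm_12 \<Omega> g"
      using Q.solves_zero_bound[OF g(1) U0_solves[OF g(1)]] g(2) by simp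
    also have "\<dots> \<le> (2 + 2 * P) * (K * norm_half \<Omega> (x - y))"
      using g(3) Q.P by (intro mult_left_mono) auto
    also have "\<dots> \<le> C * norm_half \<Omega> (x - y)"
      using T.Y.norm_nonneg[of "x - y"] by (simp add: C_def algebra_simps)
    finally show ?thesis .
  qed
  show ?thesis
  proof (intro conjI ballI impI)
    fix g\<^sub>0 assume "g\<^sub>0 \<in> W_half \<Omega>"
    then obtain g where g: "g \<in> W12 \<Omega>" "g\<^sub>0 = T g"
      unfolding trace_onto[symmetric] by blast
    show "\<exists>!u. minimizes_on (energy \<Omega> f) {w \<in> W12 \<Omega>. T w = g\<^sub>0} u"
      unfolding g(2) class_eq[OF g(1)] energy by (rule Q.ex1_minimizer[OF functional[OF f] g(1)])
    show "minimizes_on (energy \<Omega> f) {w \<in> W12 \<Omega>. T w = g\<^sub>0} (?U f g\<^sub>0)"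
      unfolding g(2) class_eq[OF g(1)] by (rule U_min[OF f g(1)])
  next
    show "affine_between (W_half \<Omega>) (W12 \<Omega>) (?U f)"
      unfolding affine_between_def using lin affine U_in[OF f zero_half] by blast
    show "linear_between (W_half \<Omega>) (W12 \<Omega>) (?U f)" if "f = 0"
      using lin that by simp
    show "continuous_map (W_half_topology \<Omega>) (W12_topology \<Omega>) (?U f)"
      unfolding W_half_topology_def W12_topology_def T.Y.metric_continuous_map[OF Q.Metric_space_axioms]
    proof (intro conjI ballI allI impI)
      show "?U f ` W_half \<Omega> \<subseteq> W12 \<Omega>"
        using U_in[OF f] by blast
      fix x and e :: real assume x: "x \<in> W_half \<Omega>" and e: "e > 0"
      have "norm_12 \<Omega> (?U f x - ?U f y) < e" if y: "y \<in> W_half \<Omega>" "norm_half \<Omega> (x - y) < e / C" for y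
        using bound[OF x y(1)] y(2) C by (simp add: pos_less_divide_eq mult.commute)
      then show "\<exists>\<delta>>0. \<forall>y. y \<in> W_half \<Omega> \<and> norm_half \<Omega> (x - y) < \<delta> \<longrightarrow> norm_12 \<Omega> (?U f x - ?U f y) < e"
        using e C by (intro exI[of _ "e / C"]) auto
    qed
  qed
qed

end
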